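(* Let $p$ be a prime with $p\equiv 1 \pmod 4$, and let $\mathcal{C}(p)$ be the family of graphs defined in the context. (a) A graph $\Gamma$ belongs to $\mathcal{C}(p)$ if and only if $\Gamma$ is a connected non-bipartite antipodal double cover of the complete graph $K_{p+1}$ and $\operatorname{Aut}\Gamma \cong PSL(2,p)\times Z_2$. (b) All graphs in $\mathcal{C}(p)$ are isomorphic to each other, are geodesic transitive, and have diameter $3$.
   Context: All graphs are finite, simple and undirected. For a finite group $G$, a core-free subgroup $H$ and $g\in G$ with $G=\langle H,g\rangle$ and $HgH=Hg^{-1}H$, the coset graph $\mathrm{Cos}(G,H,HgH)$ has vertex set the right cosets $\{Hx : x\in G\}$, with $Hx$ adjacent to $Hy$ iff $yx^{-1}\in HgH$. The family $\mathcal{C}(p)$: $\mathcal{C}(5)$ consists only of the icosahedron. For a prime $p>5$ with $p\equiv 1\pmod 4$, $\mathcal{C}(p)$ consists of the coset graphs $\mathrm{Cos}(G,H,HgH)$ obtained as follows: $G=PSL(2,p)$; choose $a\in G$ of order $p$, so that $N_G(\langle a\rangle)=\langle a\rangle{:}\langle b\rangle\cong Z_p{:}Z_{(p-1)/2}$ for some $b\in G$ of order $(p-1)/2$; then $N_G(\langle b^2\rangle)=\langle b\rangle{:}\langle c\rangle\cong D_{p-1}$ (dihedral of order $p-1$) for some $c\in G$ of order $2$; let $H=\langle a\rangle{:}\langle b^2\rangle$ and $g=cb^{2i}$ for some integer $i$. For a graph $\Gamma$ of diameter $d\ge 2$, $\Gamma$ is antipodal if the relation "equal or at distance $d$" is an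 equivalence relation on vertices, i.e. the vertex set is partitioned into fibres such that distinct vertices in the same fibre are at distance $d$ and vertices in different fibres are at distance less than $d$. The antipodal quotient has the fibres as vertices, two fibres adjacent iff some vertex of one is adjacent to some vertex of the other. $\Gamma$ is an antipodal cover of its quotient $\Sigma$ if for every edge $\{B,B'\}$ of $\Sigma$ and every $v\in B$, $v$ has exactly one neighbour in $B'$; it is a double cover if fibres have size $2$. An $i$-geodesic is a shortest path between two vertices at distance $i$; $\Gamma$ is geodesic transitive if $\operatorname{Aut}\Gamma$ is transitive on the set of $i$-geodesics for every $1\le i\le \operatorname{diam}(\Gamma)$. *)

theory Defs
  imports
    "HOL-Algebra.Algebra"
    "HOL-Number_Theory.Residues"
    "Graph_Theory.Graph_Theory"
begin

text \<open>
  A finite simple undirected graph is a \<open>pair_graph\<close>: a loop-free digraph on a finite vertex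
  set whose arc relation is symmetric.  Each edge is thus a pair of opposite arcs.
\<close>

section \<open>Distance, geodesics and automorphisms\<close>

definition gdist :: "'a pair_pre_digraph \<Rightarrow> 'a \<Rightarrow> 'a \<Rightarrow> ereal" where
  "gdist \<Gamma> u v = wf_digraph.\<mu> (with_proj \<Gamma>) (\<lambda>_. 1) u v"

definition gdiam :: "'a pair_pre_digraph \<Rightarrow> ereal" where
  "gdiam \<Gamma> = (SUP (u, v) \<in> pverts \<Gamma> \<times> pverts \<Gamma>. gdist \<Gamma> u v)"

definition geodesic :: "'a pair_pre_digraph \<Rightarrow> nat \<Rightarrow> 'a list \<Rightarrow> bool" where
  "geodesic \<Gamma> i xs \<longleftrightarrow>
     vwalk xs (with_proj \<Gamma>) \<and> vwalk_length xs = i \<and>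
     gdist \<Gamma> (hd xs) (last xs) = ereal (real i)"

definition aut_group :: "'a pair_pre_digraph \<Rightarrow> ('a \<Rightarrow> 'a) monoid" where
  "aut_group \<Gamma> = BijGroup (pverts \<Gamma>)
     \<lparr>carrier := {f \<in> Bij (pverts \<Gamma>). \<forall>u \<in> pverts \<Gamma>. \<forall>v \<in> pverts \<Gamma>.
                  (f u, f v) \<in> parcs \<Gamma> \<longleftrightarrow> (u, v) \<in> parcs \<Gamma>}\<rparr>"

definition geodesic_transitive :: "'a pair_pre_digraph \<Rightarrow> bool" where
  "geodesic_transitive \<Gamma> \<longleftrightarrow>
     (\<forall>i::nat. 1 \<le> i \<and> ereal (real i) \<le> gdiam \<Gamma> \<longrightarrow>
        (\<forall>xs ys. geodesic \<Gamma> i xs \<and> geodesic \<Gamma> i ys \<longrightarrow>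
           (\<exists>f \<in> carrier (aut_group \<Gamma>). map f xs = ys)))"

definition bipartite_graph :: "'a pair_pre_digraph \<Rightarrow> bool" where
  "bipartite_graph \<Gamma> \<longleftrightarrow>
     (\<exists>S T. pverts \<Gamma> = S \<union> T \<and> S \<inter> T = {} \<and> parcs \<Gamma> \<subseteq> S \<times> T \<union> T \<times> S)"


section \<open>Antipodal covers\<close>

definition antipodal_rel :: "'a pair_pre_digraph \<Rightarrow> 'a rel" where
  "antipodal_rel \<Gamma> = {(u, v) \<in> pverts \<Gamma> \<times> pverts \<Gamma>. u = v \<or> gdist \<Gamma> u v = gdiam \<Gamma>}"

definition antipodal :: "'a pair_pre_digraph \<Rightarrow> bool" where
  "antipodal \<Gamma> \<longleftrightarrow>
     (\<exists>d::nat. d \<ge> 2 \<and> gdiam \<Gamma> = ereal (real d)) \<and> equiv (pverts \<Gamma>) (antipodal_rel \<Gamma>)"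

definition antipodal_quotient :: "'a pair_pre_digraph \<Rightarrow> 'a set pair_pre_digraph" where
  "antipodal_quotient \<Gamma> =
     (let F = pverts \<Gamma> // antipodal_rel \<Gamma> in
      \<lparr>pverts = F,
       parcs = {(B, B') \<in> F \<times> F. B \<noteq> B' \<and> (\<exists>u \<in> B. \<exists>v \<in> B'. (u, v) \<in> parcs \<Gamma>)}\<rparr>)"

definition antipodal_cover :: "'a pair_pre_digraph \<Rightarrow> bool" where
  "antipodal_cover \<Gamma> \<longleftrightarrow> antipodal \<Gamma> \<and>
     (\<forall>(B, B') \<in> parcs (antipodal_quotient \<Gamma>). \<forall>v \<in> B. \<exists>!w. w \<in> B' \<and> (v, w) \<in> parcs \<Gamma>)"

definition antipodal_double_cover :: "'a pair_pre_digraph \<Rightarrow> bool" where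
  "antipodal_double_cover \<Gamma> \<longleftrightarrow>
     antipodal_cover \<Gamma> \<and> (\<forall>B \<in> pverts (antipodal_quotient \<Gamma>). card B = 2)"


section \<open>Groups\<close>

text \<open>The quadruple \<open>(a, b, c, d)\<close> stands for the matrix with rows \<open>(a, b)\<close> and \<open>(c, d)\<close>.\<close>

definition SL2 :: "('r, 'm) ring_scheme \<Rightarrow> ('r \<times> 'r \<times> 'r \<times> 'r) monoid" where
  "SL2 R =
     \<lparr>carrier = {(a, b, c, d). a \<in> carrier R \<and> b \<in> carrier R \<and> c \<in> carrier R \<and> d \<in> carrier R \<and>
                   a \<otimes>\<^bsub>R\<^esub> d \<ominus>\<^bsub>R\<^esub> b \<otimes>\<^bsub>R\<^esub> c = \<one>\<^bsub>R\<^esub>},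
      monoid.mult = (\<lambda>(a, b, c, d) (a', b', c', d').
                (a \<otimes>\<^bsub>R\<^esub> a' \<oplus>\<^bsub>R\<^esub> b \<otimes>\<^bsub>R\<^esub> c', a \<otimes>\<^bsub>R\<^esub> b' \<oplus>\<^bsub>R\<^esub> b \<otimes>\<^bsub>R\<^esub> d',
                 c \<otimes>\<^bsub>R\<^esub> a' \<oplus>\<^bsub>R\<^esub> d \<otimes>\<^bsub>R\<^esub> c', c \<otimes>\<^bsub>R\<^esub> b' \<oplus>\<^bsub>R\<^esub> d \<otimes>\<^bsub>R\<^esub> d')),
      monoid.one = (\<one>\<^bsub>R\<^esub>, \<zero>\<^bsub>R\<^esub>, \<zero>\<^bsub>R\<^esub>, \<one>\<^bsub>R\<^esub>)\<rparr>"

definition PSL2 :: "nat \<Rightarrow> (int \<times> int \<times> int \<times> int) set monoid" where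
  "PSL2 p =
     (let R = residue_ring (int p) in
      SL2 R Mod {(\<one>\<^bsub>R\<^esub>, \<zero>\<^bsub>R\<^esub>, \<zero>\<^bsub>R\<^esub>, \<one>\<^bsub>R\<^esub>), (\<ominus>\<^bsub>R\<^esub> \<one>\<^bsub>R\<^esub>, \<zero>\<^bsub>R\<^esub>, \<zero>\<^bsub>R\<^esub>, \<ominus>\<^bsub>R\<^esub> \<one>\<^bsub>R\<^esub>)})"

text \<open>\<open>S = N:K\<close> inside \<open>G\<close>, with normal factor \<open>N\<close>.\<close>

definition inner_semidirect ::
    "('g, 'm) monoid_scheme \<Rightarrow> 'g set \<Rightarrow> 'g set \<Rightarrow> 'g set \<Rightarrow> bool" where
  "inner_semidirect G S N K \<longleftrightarrow>
     subgroup S G \<and> N \<lhd> (G\<lparr>carrier := S\<rparr>) \<and> subgroup K (G\<lparr>carrier := S\<rparr>) \<and>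
     N \<inter> K = {\<one>\<^bsub>G\<^esub>} \<and> N <#>\<^bsub>G\<^esub> K = S"


section \<open>Coset graphs and the family\<close>

text \<open>
  The definition is total.  For a finite group \<open>G\<close>, a core-free subgroup \<open>H\<close> and
  \<open>D = HgH = Hg\<^sup>-\<^sup>1H\<close> with \<open>G = \<langle>H, g\<rangle>\<close> it is the usual \<open>Cos(G, H, HgH)\<close>.
\<close>

definition coset_graph ::
    "('g, 'm) monoid_scheme \<Rightarrow> 'g set \<Rightarrow> 'g set \<Rightarrow> 'g set pair_pre_digraph" where
  "coset_graph G H D =
     \<lparr>pverts = rcosets\<^bsub>G\<^esub> H,
      parcs = {(H #>\<^bsub>G\<^esub> x, H #>\<^bsub>G\<^esub> y) | x y.
                 x \<in> carrier G \<and> y \<in> carrier G \<and> y \<otimes>\<^bsub>G\<^esub> inv\<^bsub>G\<^esub> x \<in> D}\<rparr>"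

definition double_coset :: "('g, 'm) monoid_scheme \<Rightarrow> 'g set \<Rightarrow> 'g \<Rightarrow> 'g set" where
  "double_coset G H g = (H #>\<^bsub>G\<^esub> g) <#>\<^bsub>G\<^esub> H"

text \<open>
  Apex 0, upper pentagon 1..5, lower pentagon 6..10, opposite apex 11; the pentagons are
  joined by a band of ten triangles.
\<close>

definition icosahedron :: "nat pair_pre_digraph" where
  "icosahedron =
     (let E = {(0,1), (0,2), (0,3), (0,4), (0,5),
               (1,2), (2,3), (3,4), (4,5), (5,1),
               (1,6), (1,7), (2,7), (2,8), (3,8), (3,9), (4,9), (4,10), (5,10), (5,6),
               (6,7), (7,8), (8,9), (9,10), (10,6),
               (11,6), (11,7), (11,8), (11,9), (11,10)}
      in \<lparr>pverts = {0..11}, parcs = E \<union> E\<inverse>\<rparr>)"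

text \<open>
  \<open>C_datum p a b c H\<close>: the choices of \<open>a\<close>, \<open>b\<close>, \<open>c\<close> in \<open>G = PSL(2,p)\<close>, and the resulting \<open>H\<close>,
  for \<open>p > 5\<close>.  Given the orders of \<open>b\<close> and \<open>c\<close>, the relation \<open>cbc = b\<^sup>-\<^sup>1\<close> says that
  \<open>\<langle>b\<rangle>:\<langle>c\<rangle>\<close> is dihedral of order \<open>p - 1\<close>.
\<close>

definition C_datum ::
  "nat \<Rightarrow> (int \<times> int \<times> int \<times> int) set \<Rightarrow> (int \<times> int \<times> int \<times> int) set \<Rightarrow>
   (int \<times> int \<times> int \<times> int) set \<Rightarrow> (int \<times> int \<times> int \<times> int) set set \<Rightarrow> bool" where
  "C_datum p a b c H \<longleftrightarrow>
     (let G = PSL2 p; A = generate G {a}; B = generate G {b}; B2 = generate G {b [^]\<^bsub>G\<^esub> (2::nat)} in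
      a \<in> carrier G \<and> group.ord G a = p \<and>
      b \<in> carrier G \<and> group.ord G b = (p - 1) div 2 \<and>
      inner_semidirect G (normalizer G A) A B \<and>
      c \<in> carrier G \<and> group.ord G c = 2 \<and>
      inner_semidirect G (normalizer G B2) B (generate G {c}) \<and>
      c \<otimes>\<^bsub>G\<^esub> b \<otimes>\<^bsub>G\<^esub> c = inv\<^bsub>G\<^esub> b \<and>
      inner_semidirect G H A B2)"

text \<open>As usual, graphs are taken up to isomorphism, so the family is closed under it.\<close>

definition family_C :: "nat \<Rightarrow> 'a pair_pre_digraph set" where
  "family_C p =
     (if p = 5 then {\<Gamma>. digraph_iso (with_proj icosahedron) (with_proj \<Gamma>)}
      else {\<Gamma>. \<exists>a b c H (i::int). C_datum p a b c H \<and>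
              (let G = PSL2 p; g = c \<otimes>\<^bsub>G\<^esub> b [^]\<^bsub>G\<^esub> (2 * i) in
               digraph_iso (with_proj (coset_graph G H (double_coset G H g))) (with_proj \<Gamma>))})"

end

theory Submission
  imports
    Defs
    "HOL-Number_Theory.Euler_Criterion"
    "HOL-Number_Theory.Residue_Primitive_Roots"
    "HOL-Computational_Algebra.Polynomial"
begin

text \<open>
  Up to isomorphism there is one graph for each \<open>p\<close>.  Its vertices are the nonzero vectors of the
  plane over the field with \<open>p\<close> elements, taken modulo nonzero squares, and two classes are adjacent
  when \<open>det(v, w)\<close> is a nonzero square; this is symmetric because \<open>- 1\<close> is a square.  The fibres are
  the punctured lines, each consisting of two classes.

  In a coset graph of the family, \<open>H\<close> is the stabilizer of the class of a vector fixed by \<open>a\<close>, since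
  \<open>b\<close> multiplies this vector by a nonresidue.  The orbits of \<open>PSL(2,p)\<close> on the pairs of nonparallel
  classes are distinguished by the quadratic character of the determinant, and multiplying the
  determinant by a nonresidue interchanges the two possible graphs.

  An automorphism that fixes a vertex permutes its \<open>p\<close> neighbours and preserves there the relation
  that \<open>x - y\<close> is a square, so it is affine by a theorem of Carlitz.  Hence every automorphism is
  induced by a linear map whose determinant is a square, which gives \<open>PSL(2,p) \<times> Z\<^sub>2\<close> and geodesic
  transitivity.

  Conversely, let a cover with this automorphism group be given.  An element of order \<open>p\<close> fixes one
  fibre pointwise and permutes the remaining fibres in a cycle, so the cover is described by a set
  \<open>S\<close> of residues, which the diagonal elements make invariant under multiplication by squares.  If
  \<open>S\<close> is empty the cover is bipartite, if \<open>S\<close> is everything it is disconnected, and the squares and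
  the nonsquares give isomorphic graphs.
\<close>

section \<open>Quadratic residues modulo a prime\<close>

text \<open>The rigidity of the character becomes algebra through Euler's criterion: preserving
  squareness of differences reads \<open>(g x - g y) ^ m \<asymp> (x - y) ^ m\<close>, which is
  polynomial in \<open>g y\<close> and makes the mixed power moments of \<open>g\<close> of low
  degree vanish. The factor Z_2 comes from scalars: multiplication by a nonresidue fixes every line
  and exchanges its two classes, while a square scalar acts trivially. In the converse the fixed
  fibre is found by counting: there are p + 1 fibres, one orbit takes up p of them, and the two
  points of the last fibre cannot be exchanged because p is odd. The value p = 5 stands apart since
  there b^2 = 1, so the normalizer of its span is the whole group and no data exist. To do all
  arithmetic in one ring, vectors and matrices have integer entries and are compared modulo p.
  Division is replaced by the adjugate, which is harmless when the determinant is a square, because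
  square scalars act trivially on classes.\<close>

locale prime_1_mod_4 =
  fixes p :: nat
  assumes prime_p: "Factorial_Ring.prime p" and p_cong_1: "[p = 1] (mod 4)"
begin

abbreviation eqv :: "int \<Rightarrow> int \<Rightarrow> bool" (infix "\<asymp>" 50) where
  "a \<asymp> b \<equiv> [a = b] (mod int p)"

definition m :: nat where "m = (p - 1) div 2"

definition chi :: "int \<Rightarrow> int" where "chi a = Legendre a (int p)"

lemma p_ge_5: "p \<ge> 5"
proof -
  have "p mod 4 = 1" using p_cong_1 by (simp add: cong_def)
  moreover have "p \<ge> 2" using prime_p by (rule prime_ge_2_nat)
  ultimately show ?thesis by presburger
qed

lemma p_eq: "p = 2 * m + 1" and even_m: "even m" and m_ge_2: "m \<ge> 2"
proof -
  have "p mod 4 = 1" using p_cong_1 by (simp add: cong_def)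
  then show "p = 2 * m + 1" "even m" "m \<ge> 2" using p_ge_5 unfolding m_def by presburger+
qed

lemma prime_int_p: "Factorial_Ring.prime (int p)"
  using prime_p by simp

lemma eqv_eq_trans [trans]: "a \<asymp> b \<Longrightarrow> b = c \<Longrightarrow> a \<asymp> c"
  and eq_eqv_trans [trans]: "a = b \<Longrightarrow> b \<asymp> c \<Longrightarrow> a \<asymp> c"
  by simp_all

lemma mult_eqv_0_iff: "a * b \<asymp> 0 \<longleftrightarrow> a \<asymp> 0 \<or> b \<asymp> 0"
  using prime_int_p by (simp add: cong_0_iff prime_dvd_mult_iff)

lemma power_eqv_0_iff: "n > 0 \<Longrightarrow> a ^ n \<asymp> 0 \<longleftrightarrow> a \<asymp> 0"
  using prime_int_p by (simp add: cong_0_iff prime_dvd_power_iff)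

lemma mult_eqv_cancel: "c * a \<asymp> c * b \<Longrightarrow> \<not> c \<asymp> 0 \<Longrightarrow> a \<asymp> b"
  using mult_eqv_0_iff[of c "a - b"] by (simp add: cong_iff_dvd_diff right_diff_distrib)

lemma eqv_small: "a \<asymp> b \<Longrightarrow> a \<in> {0..<int p} \<Longrightarrow> b \<in> {0..<int p} \<Longrightarrow> a = b"
  by (auto simp: cong_def)

lemma one_not_eqv_0: "\<not> 1 \<asymp> 0" and two_not_eqv_0: "\<not> 2 \<asymp> 0"
  using p_ge_5 by (auto simp: cong_def)

lemma not_eqv_0_eqv: "a \<asymp> b \<Longrightarrow> a \<asymp> 0 \<longleftrightarrow> b \<asymp> 0"
  using cong_trans cong_sym by blast

lemma fermat: "\<not> a \<asymp> 0 \<Longrightarrow> a ^ (p - 1) \<asymp> 1"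
proof -
  assume a: "\<not> a \<asymp> 0"
  then have "coprime a (int p)"
    using prime_int_p prime_imp_coprime[of "int p" a] by (simp add: cong_0_iff coprime_commute)
  then have *: "[a ^ totient (nat \<bar>int p\<bar>) = 1] (mod int p)"
  proof -
    have "[(nat (a mod int p)) ^ totient p = 1] (mod p)"
    proof (rule euler_theorem)
      have "int (nat (a mod int p)) = a mod int p" using p_ge_5 by simp
      moreover have "coprime (a mod int p) (int p)" using \<open>coprime a (int p)\<close> p_ge_5 by (metis coprime_mod_left_iff of_nat_0_eq_iff not_numeral_le_zero)
      ultimately show "coprime (nat (a mod int p)) p" by (metis coprime_int_iff)
    qed
    then have "[int (nat (a mod int p)) ^ totient p = 1] (mod int p)"
      by (metis cong_int_iff of_nat_1 of_nat_power)
    moreover have "int (nat (a mod int p)) = a mod int p" using p_ge_5 by simp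
    ultimately show ?thesis by (simp add: cong_def power_mod)
  qed
  then show ?thesis using totient_prime[OF prime_p] by simp
qed

lemma ex_inverse: assumes "\<not> a \<asymp> 0" obtains b where "a * b \<asymp> 1" "\<not> b \<asymp> 0"
proof -
  have "a * a ^ (p - 2) = a ^ (p - 1)"
    using p_ge_5 by (simp flip: power_Suc add: numeral_2_eq_2 Suc_diff_Suc)
  then have 1: "a * a ^ (p - 2) \<asymp> 1" using fermat[OF assms] by simp
  have "\<not> a ^ (p - 2) \<asymp> 0" using assms power_eqv_0_iff p_ge_5 by simp
  with 1 show ?thesis by (rule that)
qed

lemma chi_euler: "chi a \<asymp> a ^ m"
proof -
  have "nat ((int p - 1) div 2) = m" unfolding m_def using p_ge_5 by (simp add: nat_div_distrib nat_diff_distrib)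
  then show ?thesis unfolding chi_def m_def
    using euler_criterion[of p a] prime_p p_ge_5 by simp
qed

lemma chi_eq_0_iff: "chi a = 0 \<longleftrightarrow> a \<asymp> 0"
  unfolding chi_def Legendre_def by simp

lemma chi_cases: "chi a = 0 \<or> chi a = 1 \<or> chi a = - 1"
  unfolding chi_def Legendre_def by simp

lemma chi_cases': "\<not> a \<asymp> 0 \<Longrightarrow> chi a = 1 \<or> chi a = - 1"
  unfolding chi_def Legendre_def by simp

text \<open>Two such values differ by at most 2, which is less than \<open>p\<close>. This lifts
  Euler's congruence for \<open>chi\<close> to equations.\<close>

lemma sign_eqv_imp_eq:
  assumes "x = 0 \<or> x = 1 \<or> x = - 1" "y = 0 \<or> y = 1 \<or> y = (- 1 :: int)" "x \<asymp> y"
  shows "x = y"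
proof -
  have "int p dvd x - y" using assms(3) by (simp add: cong_iff_dvd_diff)
  moreover have "\<bar>x - y\<bar> < int p" using assms(1,2) p_ge_5 by auto
  ultimately show ?thesis using zdvd_imp_le[of "int p" "\<bar>x - y\<bar>"] by force
qed

lemma chi_cong: "a \<asymp> b \<Longrightarrow> chi a = chi b"
  by (rule sign_eqv_imp_eq[OF chi_cases chi_cases])
    (meson chi_euler cong_pow cong_sym cong_trans)

lemma chi_mult: "chi (a * b) = chi a * chi b"
proof (rule sign_eqv_imp_eq[OF chi_cases])
  show "chi a * chi b = 0 \<or> chi a * chi b = 1 \<or> chi a * chi b = - 1"
    using chi_cases[of a] chi_cases[of b] by auto
  have "chi (a * b) \<asymp> a ^ m * b ^ m"
    using chi_euler[of "a * b"] by (simp add: power_mult_distrib)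
  also have "a ^ m * b ^ m \<asymp> chi a * chi b"
    by (intro cong_mult cong_sym[OF chi_euler])
  finally show "chi (a * b) \<asymp> chi a * chi b" .
qed

lemma chi_1 [simp]: "chi 1 = 1"
  by (rule sign_eqv_imp_eq[OF chi_cases]) (use chi_euler[of 1] in auto)

text \<open>Euler's criterion with the even exponent \<open>m\<close>; here \<open>p\<close> being 1
  modulo 4 makes adjacency symmetric.\<close>

lemma chi_minus_1 [simp]: "chi (- 1) = 1"
  by (rule sign_eqv_imp_eq[OF chi_cases]) (use chi_euler[of "- 1"] even_m in auto)

lemma chi_0 [simp]: "chi 0 = 0"
  by (simp add: chi_eq_0_iff)

lemma chi_minus [simp]: "chi (- a) = chi a"
  using chi_mult[of "- 1" a] by simp

lemma chi_square: "\<not> t \<asymp> 0 \<Longrightarrow> chi (t * t) = 1"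
  using chi_cases'[of t] by (auto simp: chi_mult)

lemma chi_eq_1D: assumes "chi a = 1" obtains t where "t * t \<asymp> a" "\<not> t \<asymp> 0"
proof -
  have a: "\<not> a \<asymp> 0" using assms chi_eq_0_iff by force
  then have "QuadRes (int p) a"
    using assms unfolding chi_def Legendre_def by (auto split: if_splits)
  then obtain t where t: "t * t \<asymp> a" unfolding QuadRes_def by (auto simp: power2_eq_square)
  then have "\<not> t \<asymp> 0" using a mult_eqv_0_iff not_eqv_0_eqv by blast
  with t show ?thesis by (rule that)
qed

lemma chi_inverse: "a * b \<asymp> 1 \<Longrightarrow> chi b = chi a"
  using chi_cong[of "a * b" 1] chi_cases[of a] chi_cases[of b] by (auto simp: chi_mult)

lemma ex_primitive_root: obtains g where "\<not> g \<asymp> 0" "\<forall>n. g ^ n \<asymp> 1 \<longrightarrow> p - 1 dvd n"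
proof -
  obtain g where g: "residue_primroot p g"
    using prime_primitive_root_exists[OF _ prime_p] p_ge_5 by auto
  then have c: "coprime p g" and o: "ord p g = p - 1"
    using totient_prime[OF prime_p] by (auto simp: residue_primroot_def)
  have "\<not> int g \<asymp> 0"
    using c prime_p p_ge_5 by (auto simp: cong_0_iff coprime_absorb_left)
  moreover have "\<forall>n. int g ^ n \<asymp> 1 \<longrightarrow> p - 1 dvd n"
  proof (intro allI impI)
    fix n assume "int g ^ n \<asymp> 1"
    then have "[g ^ n = 1] (mod p)" by (metis cong_int_iff of_nat_1 of_nat_power)
    then show "p - 1 dvd n" using ord_divides o by metis
  qed
  ultimately show ?thesis by (rule that)
qed

lemma bij_mult_mod: assumes "\<not> g \<asymp> 0"
  shows "bij_betw (\<lambda>x. g * x mod int p) {0..<int p} {0..<int p}"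
proof -
  have "inj_on (\<lambda>x. g * x mod int p) {0..<int p}"
  proof (rule inj_onI)
    fix x y assume xy: "x \<in> {0..<int p}" "y \<in> {0..<int p}" "g * x mod int p = g * y mod int p"
    then have "g * x \<asymp> g * y" by (simp add: cong_def)
    then show "x = y" using mult_eqv_cancel assms eqv_small xy by blast
  qed
  moreover have "(\<lambda>x. g * x mod int p) ` {0..<int p} \<subseteq> {0..<int p}"
    using p_ge_5 by auto
  ultimately show ?thesis
    by (simp add: bij_betw_def endo_inj_surj)
qed

text \<open>If \<open>p - 1\<close> does not divide \<open>n\<close>, multiplication by a primitive
  root \<open>g\<close> permutes the residues, which gives \<open>(g ^ n - 1) * S \<asymp> 0\<close>
  for the sum \<open>S\<close>, with a unit in front. The exponent 0 is separated from the value - 1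
  because \<open>0 ^ 0 = 1\<close> makes the sum equal to \<open>p\<close>.\<close>

lemma power_sum: "(\<Sum>x\<in>{0..<int p}. x ^ n) \<asymp> (if n > 0 \<and> p - 1 dvd n then - 1 else 0)"
proof -
  consider "n = 0" | "n > 0" "p - 1 dvd n" | "\<not> p - 1 dvd n" by auto
  then show ?thesis
  proof cases
    case 1 then show ?thesis by (simp add: cong_0_iff)
  next
    case 2
    have "{0..<int p} = insert 0 {1..<int p}" using p_ge_5 by auto
    then have "(\<Sum>x\<in>{0..<int p}. x ^ n) = (\<Sum>x\<in>{1..<int p}. x ^ n)"
      using 2(1) by (simp add: power_0_left)
    also have "(\<Sum>x\<in>{1..<int p}. x ^ n) \<asymp> (\<Sum>x\<in>{1..<int p}. 1)"
    proof (rule cong_sum)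
      fix x assume x: "x \<in> {1..<int p}"
      obtain k where k: "n = (p - 1) * k" using 2 by (elim dvdE)
      have "\<not> x \<asymp> 0" using x by (auto simp: cong_def)
      from cong_pow[OF fermat[OF this], of k] show "x ^ n \<asymp> 1" by (simp add: k power_mult)
    qed
    also have "(\<Sum>x\<in>{1..<int p}. 1 :: int) = int p - 1" using p_ge_5 by simp
    also have "int p - 1 \<asymp> - 1" by (simp add: cong_iff_dvd_diff)
    finally show ?thesis using 2 by simp
  next
    case 3
    obtain g where g: "\<not> g \<asymp> 0" "\<forall>n. g ^ n \<asymp> 1 \<longrightarrow> p - 1 dvd n" using ex_primitive_root .
    let ?S = "\<Sum>x\<in>{0..<int p}. x ^ n"
    have "g ^ n * ?S = (\<Sum>x\<in>{0..<int p}. (g * x) ^ n)"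
      by (simp add: sum_distrib_left power_mult_distrib)
    also have "(\<Sum>x\<in>{0..<int p}. (g * x) ^ n) \<asymp> (\<Sum>x\<in>{0..<int p}. (g * x mod int p) ^ n)"
      by (intro cong_sum cong_pow) (simp add: cong_def)
    also have "(\<Sum>x\<in>{0..<int p}. (g * x mod int p) ^ n) = ?S"
      using sum.reindex_bij_betw[OF bij_mult_mod[OF g(1)], of "\<lambda>x. x ^ n"] .
    finally have "(g ^ n - 1) * ?S \<asymp> 0"
      by (simp add: cong_iff_dvd_diff left_diff_distrib)
    moreover have "\<not> g ^ n - 1 \<asymp> 0" using g(2) 3 by (auto simp: cong_iff_dvd_diff)
    ultimately show ?thesis using mult_eqv_0_iff 3 by auto
  qed
qed

text \<open>A primitive root is a nonresidue: otherwise its power with exponent \<open>m\<close>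
  would be 1, although \<open>m < p - 1\<close>.\<close>

lemma ex_nonresidue: "\<exists>n. chi n = - 1"
proof (rule ccontr)
  assume "\<nexists>n. chi n = - 1"
  then have *: "chi x = 1" if "\<not> x \<asymp> 0" for x using chi_cases'[OF that] by blast
  obtain g where g: "\<not> g \<asymp> 0" "\<forall>n. g ^ n \<asymp> 1 \<longrightarrow> p - 1 dvd n" using ex_primitive_root .
  have "g ^ m \<asymp> 1" using chi_euler[of g] *[OF g(1)] cong_sym by auto
  then have "p - 1 dvd m" using g(2) by blast
  then show False using m_ge_2 p_eq by (auto dest: dvd_imp_le)
qed

end

section \<open>Affinity of the automorphisms of the Paley relation\<close>

context prime_1_mod_4
begin

section \<open>Power sums as coefficient functionals\<close>

lemma sum_poly_values: assumes "Polynomial.degree Q \<le> p - 1"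
  shows "(\<Sum>x\<in>{0..<int p}. poly Q x) \<asymp> - Polynomial.coeff Q (p - 1)"
proof -
  let ?c = "Polynomial.coeff Q"
  have p: "poly Q x = (\<Sum>k\<le>p - 1. ?c k * x ^ k)" for x
    unfolding poly_altdef
  proof (rule sum.mono_neutral_left)
    show "{..Polynomial.degree Q} \<subseteq> {..p - 1}" using assms by simp
    show "\<forall>i\<in>{..p - 1} - {..Polynomial.degree Q}. ?c i * x ^ i = 0" by (simp add: coeff_eq_0)
  qed simp
  have "(\<Sum>x\<in>{0..<int p}. poly Q x) = (\<Sum>k\<le>p - 1. ?c k * (\<Sum>x\<in>{0..<int p}. x ^ k))"
    unfolding p sum_distrib_left by (rule sum.swap)
  also have "(\<Sum>k\<le>p - 1. ?c k * (\<Sum>x\<in>{0..<int p}. x ^ k))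
      \<asymp> (\<Sum>k\<le>p - 1. ?c k * (if k > 0 \<and> p - 1 dvd k then - 1 else 0))"
    by (intro cong_sum cong_mult power_sum cong_refl)
  also have "(\<Sum>k\<le>p - 1. ?c k * (if k > 0 \<and> p - 1 dvd k then - 1 else 0))
      = (\<Sum>k\<le>p - 1. if k = p - 1 then - ?c k else 0)"
  proof (rule sum.cong)
    fix k assume k: "k \<in> {..p - 1}"
    have "k > 0 \<and> p - 1 dvd k \<longleftrightarrow> k = p - 1"
      proof
      assume "k > 0 \<and> p - 1 dvd k"
      then show "k = p - 1" using dvd_imp_le[of "p - 1" k] k by (simp add: le_antisym)
    qed (use p_ge_5 in simp)
    then show "?c k * (if k > 0 \<and> p - 1 dvd k then - 1 else 0) = (if k = p - 1 then - ?c k else 0)"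
      by simp
  qed simp
  also have "\<dots> = - ?c (p - 1)" by simp
  finally show ?thesis .
qed

text \<open>Multiplying by \<open>x ^ (p - 1 - k)\<close> and summing over all residues moves the
  coefficient of \<open>x ^ k\<close> to the only exponent whose power sum is nonzero; the degree
  bound keeps all exponents below \<open>2 * (p - 1)\<close>.\<close>

lemma coeff_eqv_0:
  assumes "Polynomial.degree Q < p - 1" "\<And>x. x \<in> {0..<int p} \<Longrightarrow> poly Q x \<asymp> 0"
  shows "Polynomial.coeff Q k \<asymp> 0"
proof (cases "k < p - 1")
  case True
  let ?c = "Polynomial.coeff Q"
  let ?n = "p - 1 - k"
  have p: "poly Q x = (\<Sum>j<p - 1. ?c j * x ^ j)" for x
    unfolding poly_altdef
  proof (rule sum.mono_neutral_left)
    show "{..Polynomial.degree Q} \<subseteq> {..<p - 1}" using assms(1) by auto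
    show "\<forall>j\<in>{..<p - 1} - {..Polynomial.degree Q}. ?c j * x ^ j = 0" by (simp add: coeff_eq_0)
  qed simp
  have "(\<Sum>x\<in>{0..<int p}. poly Q x * x ^ ?n) = (\<Sum>x\<in>{0..<int p}. \<Sum>j<p - 1. ?c j * x ^ (j + ?n))"
    unfolding p sum_distrib_right power_add mult.assoc ..
  also have "\<dots> = (\<Sum>j<p - 1. ?c j * (\<Sum>x\<in>{0..<int p}. x ^ (j + ?n)))"
    unfolding sum_distrib_left by (rule sum.swap)
  also have "(\<Sum>j<p - 1. ?c j * (\<Sum>x\<in>{0..<int p}. x ^ (j + ?n)))
      \<asymp> (\<Sum>j<p - 1. ?c j * (if j + ?n > 0 \<and> p - 1 dvd j + ?n then - 1 else 0))"
    by (intro cong_sum cong_mult power_sum cong_refl)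
  also have "(\<Sum>j<p - 1. ?c j * (if j + ?n > 0 \<and> p - 1 dvd j + ?n then - 1 else 0))
      = (\<Sum>j<p - 1. if j = k then - ?c j else 0)"
  proof (rule sum.cong)
    fix j assume j: "j \<in> {..<p - 1}"
    have "p - 1 dvd j + ?n \<longleftrightarrow> j = k"
    proof
      assume "p - 1 dvd j + ?n"
      then obtain l where l: "j + ?n = (p - 1) * l" by (elim dvdE)
      have "l \<noteq> 0"
      proof
        assume "l = 0"
        then have "j + ?n = 0" using l by simp
        then show False using True by linarith
      qed
      moreover have "l < 2"
      proof (rule ccontr)
        assume "\<not> l < 2"
        then have "(p - 1) * 2 \<le> (p - 1) * l" by (intro mult_le_mono2) simp
        then have "2 * (p - 1) \<le> j + ?n" using l by linarith
        moreover have "j < p - 1" "?n \<le> p - 1" using j by auto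
        ultimately show False by linarith
      qed
      ultimately have "l = 1" by simp
      then show "j = k" using l True by simp
    qed (use True in auto)
    moreover have "j + ?n > 0" using True by linarith
    ultimately show "?c j * (if j + ?n > 0 \<and> p - 1 dvd j + ?n then - 1 else 0) = (if j = k then - ?c j else 0)"
      by (cases "j = k") simp_all
  qed simp
  also have "\<dots> = - ?c k" using True by simp
  finally have "(\<Sum>x\<in>{0..<int p}. poly Q x * x ^ ?n) \<asymp> - ?c k" .
  moreover have "(\<Sum>x\<in>{0..<int p}. poly Q x * x ^ ?n) \<asymp> (\<Sum>x\<in>{0..<int p}. 0 * x ^ ?n)"
    by (intro cong_sum cong_mult cong_refl assms(2))
  ultimately show ?thesis unfolding cong_iff_dvd_diff mult_zero_left sum.neutral_const
    by Groebner_Basis.algebra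
next
  case False
  then show ?thesis using assms(1) by (simp add: coeff_eq_0)
qed

lemma binomial_not_eqv_0: assumes "k \<le> n" "n < p" shows "\<not> int (n choose k) \<asymp> 0"
proof
  assume "int (n choose k) \<asymp> 0"
  then have "p dvd (n choose k)" by (simp add: cong_0_iff)
  moreover have "(n choose k) dvd fact n"
    by (metis assms(1) binomial_fact_lemma dvd_triv_right)
  ultimately have "p dvd fact n" by (rule dvd_trans)
  then show False using prime_dvd_fact_iff[OF prime_p] assms by simp
qed

lemma power_p_minus_1: "x ^ (p - 1) \<asymp> (if x \<asymp> 0 then 0 else 1)"
  using fermat[of x] power_eqv_0_iff[of "p - 1" x] p_ge_5 by auto

text \<open>As a function of \<open>z\<close>, the sum of \<open>(g x - z) ^ m * x ^ i\<close> is a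
  polynomial of degree at most \<open>m\<close>, whose coefficient at \<open>z ^ (m - j)\<close> is
  the moment times a sign and a binomial coefficient. At \<open>z = g y\<close> the hypothesis
  replaces \<open>g\<close> by the identity, and power sums give a value independent of
  \<open>y\<close>. As every residue is some \<open>g y\<close>, the polynomial is constant on
  residues and its other coefficients vanish.\<close>

lemma moment_eqv_0:
  assumes bij: "g ` {0..<int p} = {0..<int p}"
    and diff: "\<And>x y. x \<in> {0..<int p} \<Longrightarrow> y \<in> {0..<int p} \<Longrightarrow> (g x - g y) ^ m \<asymp> (x - y) ^ m"
    and ij: "i \<le> m" "j \<le> m" "i + j < 2 * m"
  shows "(\<Sum>x\<in>{0..<int p}. g x ^ j * x ^ i) \<asymp> 0"
proof -
  let ?R = "{0..<int p}"
  let ?M = "\<lambda>j. \<Sum>x\<in>?R. g x ^ j * x ^ i"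
  \<comment> \<open>For \<open>i = m\<close> the power sums give - 1 instead of 0; adding
    \<open>?e\<close> makes \<open>Q\<close> vanish at every residue. Only the constant term
    changes, which belongs to \<open>j = m\<close>, and \<open>i + j < 2 * m\<close> excludes it in
    that case.\<close>
  let ?e = "if i = m then 1 else 0 :: int"
  define Q where "Q = (\<Sum>j\<le>m. Polynomial.monom (int (m choose j) * (- 1) ^ (m - j) * ?M j) (m - j)) + [:?e:]"
  have shift: "(a - z) ^ m = (\<Sum>j\<le>m. int (m choose j) * a ^ j * (- z) ^ (m - j))" for a z :: int
    using binomial_ring[of a "- z" m] by simp
  have neg: "(- z) ^ n = (- 1) ^ n * z ^ n" for z :: int and n by (rule power_minus)
  have polyQ: "poly Q z = (\<Sum>x\<in>?R. (g x - z) ^ m * x ^ i) + ?e" for z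
  proof -
    have "(\<Sum>x\<in>?R. (g x - z) ^ m * x ^ i)
        = (\<Sum>x\<in>?R. \<Sum>j\<le>m. int (m choose j) * g x ^ j * (- z) ^ (m - j) * x ^ i)"
      unfolding shift sum_distrib_right ..
    also have "\<dots> = (\<Sum>j\<le>m. \<Sum>x\<in>?R. int (m choose j) * g x ^ j * (- z) ^ (m - j) * x ^ i)"
      by (rule sum.swap)
    also have "\<dots> = (\<Sum>j\<le>m. int (m choose j) * (- 1) ^ (m - j) * ?M j * z ^ (m - j))"
      unfolding sum_distrib_left sum_distrib_right neg[of z] by (intro sum.cong refl) (simp only: mult_ac)
    finally show ?thesis by (simp add: Q_def poly_sum poly_monom)
  qed
  have "poly Q z \<asymp> 0" if z: "z \<in> ?R" for z
  proof -
    obtain y where y: "y \<in> ?R" "z = g y" using z bij by blast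
    have "(\<Sum>x\<in>?R. (g x - z) ^ m * x ^ i) \<asymp> (\<Sum>x\<in>?R. (x - y) ^ m * x ^ i)"
      unfolding y(2) by (intro cong_sum cong_mult cong_refl diff y)
    also have "(\<Sum>x\<in>?R. (x - y) ^ m * x ^ i)
        = (\<Sum>x\<in>?R. \<Sum>j\<le>m. int (m choose j) * (- y) ^ (m - j) * x ^ (j + i))"
      unfolding shift[of _ y] sum_distrib_right power_add by (intro sum.cong refl) (simp only: mult_ac)
    also have "\<dots> = (\<Sum>j\<le>m. int (m choose j) * (- y) ^ (m - j) * (\<Sum>x\<in>?R. x ^ (j + i)))"
      unfolding sum_distrib_left by (rule sum.swap)
    also have "(\<Sum>j\<le>m. int (m choose j) * (- y) ^ (m - j) * (\<Sum>x\<in>?R. x ^ (j + i)))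
      \<asymp> (\<Sum>j\<le>m. int (m choose j) * (- y) ^ (m - j) * (if j + i > 0 \<and> p - 1 dvd j + i then - 1 else 0))"
      by (intro cong_sum cong_mult power_sum cong_refl)
    also have "(\<Sum>j\<le>m. int (m choose j) * (- y) ^ (m - j) * (if j + i > 0 \<and> p - 1 dvd j + i then - 1 else 0))
      = (\<Sum>j\<le>m. if j = m then - ?e else 0)"
    proof (rule sum.cong)
      fix j assume j: "j \<in> {..m}"
      have p1: "p - 1 = 2 * m" using p_eq by simp
      have "j + i > 0 \<and> p - 1 dvd j + i \<longleftrightarrow> j = m \<and> i = m"
      proof
        assume "j + i > 0 \<and> p - 1 dvd j + i"
        then have "2 * m \<le> j + i" using dvd_imp_le p1 by metis
        then show "j = m \<and> i = m" using j ij(1) by auto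
      next
        assume "j = m \<and> i = m"
        then show "j + i > 0 \<and> p - 1 dvd j + i" unfolding p1 using m_ge_2 by (simp add: mult_2)
      qed
      then show "int (m choose j) * (- y) ^ (m - j) * (if j + i > 0 \<and> p - 1 dvd j + i then - 1 else 0)
          = (if j = m then - ?e else 0)" by auto
    qed simp
    also have "\<dots> = - ?e" by simp
    finally show ?thesis unfolding polyQ by (simp add: cong_iff_dvd_diff)
  qed
  moreover have "Polynomial.degree Q \<le> m" unfolding Q_def
    by (intro degree_add_le degree_sum_le order_trans[OF degree_monom_le]) auto
  then have "Polynomial.degree Q < p - 1" using p_eq m_ge_2 by linarith
  ultimately have "Polynomial.coeff Q (m - j) \<asymp> 0" using coeff_eqv_0 by blast
  moreover have "Polynomial.coeff Q (m - j) = int (m choose j) * (- 1) ^ (m - j) * ?M j"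
  proof -
    have "Polynomial.coeff (\<Sum>j\<le>m. Polynomial.monom (int (m choose j) * (- 1) ^ (m - j) * ?M j) (m - j)) (m - j)
       = (\<Sum>l\<le>m. if l = j then int (m choose j) * (- 1) ^ (m - j) * ?M j else 0)"
      unfolding coeff_sum by (rule sum.cong) (use ij(2) in auto)
    then show ?thesis using ij by (auto simp: Q_def coeff_pCons split: nat.splits)
  qed
  ultimately have "int (m choose j) * (- 1) ^ (m - j) * ?M j \<asymp> 0" by simp
  moreover have "\<not> int (m choose j) \<asymp> 0" using binomial_not_eqv_0 ij p_eq by simp
  moreover have "\<not> (- 1) ^ (m - j) \<asymp> 0"
    using one_not_eqv_0 by (cases "even (m - j)") (auto simp: cong_0_iff)
  ultimately show ?thesis using mult_eqv_0_iff by blast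
qed

text \<open>By Fermat, \<open>1 - (x - y) ^ (p - 1)\<close> is the indicator of \<open>x = y\<close>
  on residues. The coefficients come from its binomial expansion; the summand 1 contributes to
  \<open>k = 0\<close> only.\<close>

lemma interpolation:
  assumes x: "x \<in> {0..<int p}"
  shows "g x \<asymp> (\<Sum>k\<le>p - 1. (\<Sum>y\<in>{0..<int p}. g y * ((if k = 0 then 1 else 0)
            - int ((p - 1) choose k) * (- y) ^ (p - 1 - k))) * x ^ k)"
proof -
  let ?R = "{0..<int p}"
  have "(\<Sum>k\<le>p - 1. (\<Sum>y\<in>?R. g y * ((if k = 0 then 1 else 0)
            - int ((p - 1) choose k) * (- y) ^ (p - 1 - k))) * x ^ k)
     = (\<Sum>y\<in>?R. g y * (\<Sum>k\<le>p - 1. (if k = 0 then 1 else 0) * x ^ k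
            - int ((p - 1) choose k) * x ^ k * (- y) ^ (p - 1 - k)))"
    unfolding sum_distrib_right sum_distrib_left
    by (subst sum.swap) (intro sum.cong refl, simp only: left_diff_distrib right_diff_distrib mult_ac)
  also have "\<dots> = (\<Sum>y\<in>?R. g y * (1 - (x - y) ^ (p - 1)))"
  proof (rule sum.cong)
    fix y
    have "(x - y) ^ (p - 1) = (\<Sum>k\<le>p - 1. int ((p - 1) choose k) * x ^ k * (- y) ^ (p - 1 - k))"
      using binomial_ring[of x "- y" "p - 1"] by simp
    moreover have "(\<Sum>k\<le>p - 1. (if k = 0 then 1 else 0) * x ^ k) = (\<Sum>k\<le>p - 1. if k = 0 then 1 else 0)"
      by (rule sum.cong) auto
    ultimately show "g y * (\<Sum>k\<le>p - 1. (if k = 0 then 1 else 0) * x ^ k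
            - int ((p - 1) choose k) * x ^ k * (- y) ^ (p - 1 - k)) = g y * (1 - (x - y) ^ (p - 1))"
      unfolding sum_subtractf by simp
  qed simp
  finally have *: "(\<Sum>k\<le>p - 1. (\<Sum>y\<in>?R. g y * ((if k = 0 then 1 else 0)
            - int ((p - 1) choose k) * (- y) ^ (p - 1 - k))) * x ^ k) = (\<Sum>y\<in>?R. g y * (1 - (x - y) ^ (p - 1)))" .
  have "(\<Sum>y\<in>?R. g y * (1 - (x - y) ^ (p - 1))) \<asymp> (\<Sum>y\<in>?R. if y = x then g y else 0)"
  proof (rule cong_sum)
    fix y assume y: "y \<in> ?R"
    have "x - y \<asymp> 0 \<longleftrightarrow> y = x"
      using eqv_small[OF _ x y] by (auto simp: cong_iff_dvd_diff)
    then have "(x - y) ^ (p - 1) \<asymp> (if y = x then 0 else 1)" using power_p_minus_1[of "x - y"] by auto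
    then have "g y * (1 - (x - y) ^ (p - 1)) \<asymp> g y * (1 - (if y = x then 0 else 1))"
      by (intro cong_mult cong_diff cong_refl)
    then show "g y * (1 - (x - y) ^ (p - 1)) \<asymp> (if y = x then g y else 0)" by (simp split: if_splits)
  qed
  moreover have "(\<Sum>y\<in>?R. if y = x then g y else 0) = g x" using x by simp
  ultimately show ?thesis unfolding * using cong_sym by simp
qed

end

context prime_1_mod_4
begin

text \<open>Carlitz' theorem.  If \<open>g\<close> had reduced degree \<open>d > 1\<close>, then \<open>d < m\<close>, and writing
  \<open>p - 1 = d q + r\<close> with \<open>r < d\<close>, the polynomial \<open>g(x)\<^sup>q x\<^sup>r\<close> would have degree exactly
  \<open>p - 1\<close>, so that its values would not sum to zero.\<close>

theorem paley_automorphism_affine: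
  assumes bij: "g ` {0..<int p} = {0..<int p}"
    and diff: "\<And>x y. x \<in> {0..<int p} \<Longrightarrow> y \<in> {0..<int p} \<Longrightarrow> chi (g x - g y) = chi (x - y)"
  shows "\<exists>a b. \<forall>x \<in> {0..<int p}. g x \<asymp> a * x + b"
proof -
  let ?R = "{0..<int p}"
  have diff': "(g x - g y) ^ m \<asymp> (x - y) ^ m" if "x \<in> ?R" "y \<in> ?R" for x y
    using cong_trans[OF cong_sym[OF chi_euler] chi_euler[of "x - y", folded diff[OF that]]] .
  note moment = moment_eqv_0[OF bij diff']
  define c where "c k = (\<Sum>y\<in>?R. g y * ((if k = 0 then 1 else 0)
            - int ((p - 1) choose k) * (- y) ^ (p - 1 - k)))" for k
  \<comment> \<open>Here \<open>c k\<close> is a multiple of the moment with exponents 1 and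
    \<open>p - 1 - k\<close>, and \<open>k \<ge> m\<close> makes the second at most
    \<open>m\<close>.\<close>
  have c0: "c k \<asymp> 0" if "k \<ge> m" "k \<le> p - 1" for k
  proof -
    have "c k = - (int ((p - 1) choose k) * (- 1) ^ (p - 1 - k)) * (\<Sum>x\<in>?R. g x ^ 1 * x ^ (p - 1 - k))"
    proof -
      have neg: "(- y) ^ n = (- 1) ^ n * y ^ n" for y :: int and n
        by (rule power_minus)
      have "k \<noteq> 0" using that(1) m_ge_2 by linarith
      then show ?thesis unfolding c_def sum_distrib_left
      proof (intro sum.cong refl)
        fix y assume "k \<noteq> 0"
        then show "g y * ((if k = 0 then 1 else 0) - int (p - 1 choose k) * (- y) ^ (p - 1 - k))
          = - (int (p - 1 choose k) * (- 1) ^ (p - 1 - k)) * (g y ^ 1 * y ^ (p - 1 - k))"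
          unfolding neg[of y "p - 1 - k"] by (simp only: if_False power_one_right diff_0 mult_minus_left mult_minus_right mult_ac)
      qed
    qed
    moreover have "(\<Sum>x\<in>?R. g x ^ 1 * x ^ (p - 1 - k)) \<asymp> 0"
      using that p_eq m_ge_2 by (intro moment) auto
    ultimately show ?thesis by (simp add: cong_0_iff)
  qed
  have rep: "g x \<asymp> (\<Sum>k\<le>p - 1. c k * x ^ k)" if "x \<in> ?R" for x
    unfolding c_def by (rule interpolation[OF that])
  \<comment> \<open>The disjunct \<open>k = 0\<close> provides a value when all coefficients vanish
    modulo \<open>p\<close>.\<close>
  define d where "d = (GREATEST k. k \<le> p - 1 \<and> (\<not> c k \<asymp> 0 \<or> k = 0))"
  have dP: "d \<le> p - 1 \<and> (\<not> c d \<asymp> 0 \<or> d = 0)" unfolding d_def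
    by (rule GreatestI_nat[of _ 0 "p - 1"]) auto
  have dmax: "c k \<asymp> 0" if "k > d" "k \<le> p - 1" for k
    using Greatest_le_nat[of "\<lambda>k. k \<le> p - 1 \<and> (\<not> c k \<asymp> 0 \<or> k = 0)" k "p - 1"] that
    unfolding d_def by fastforce
  have rep': "g x \<asymp> (\<Sum>k\<le>d. c k * x ^ k)" if x: "x \<in> ?R" for x
  proof -
    have "(\<Sum>k\<le>p - 1. c k * x ^ k) \<asymp> (\<Sum>k\<le>p - 1. if k \<le> d then c k * x ^ k else 0)"
    proof (rule cong_sum)
      fix k assume "k \<in> {..p - 1}"
      then show "c k * x ^ k \<asymp> (if k \<le> d then c k * x ^ k else 0)"
        using dmax[of k] mult_eqv_0_iff[of "c k"] by auto
    qed
    also have "(\<Sum>k\<le>p - 1. if k \<le> d then c k * x ^ k else 0) = (\<Sum>k\<le>d. c k * x ^ k)"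
      by (rule sum.mono_neutral_cong_right) (use dP in auto)
    finally show ?thesis using rep[OF x] cong_trans by blast
  qed
  have "d \<le> 1"
  proof (rule ccontr)
    assume "\<not> d \<le> 1"
    then have d2: "d \<ge> 2" by simp
    then have cd: "\<not> c d \<asymp> 0" using dP by auto
    have dm: "d < m" using cd c0[of d] dP by (meson not_le)
    define G where "G = (\<Sum>k\<le>d. Polynomial.monom (c k) k)"
    have coeffG: "Polynomial.coeff G k = (if k \<le> d then c k else 0)" for k
      by (auto simp: G_def coeff_sum)
    have degG: "Polynomial.degree G = d"
    proof (rule antisym)
      show "Polynomial.degree G \<le> d" by (rule degree_le) (simp add: coeffG)
      show "d \<le> Polynomial.degree G" by (rule le_degree) (use cd in \<open>auto simp: coeffG\<close>)
    qed
    have polyG: "poly G x = (\<Sum>k\<le>d. c k * x ^ k)" for x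
      by (simp add: G_def poly_sum poly_monom)
    \<comment> \<open>Both exponents must be admissible for the moments: \<open>q \<le> m\<close>
      follows from \<open>d \<ge> 2\<close>, and \<open>r < d < m\<close> then gives
      \<open>q + r < 2 * m\<close>.\<close>
    define q r where "q = 2 * m div d" and "r = 2 * m mod d"
    have qr: "q * d + r = 2 * m" unfolding q_def r_def by simp
    have rd: "r < d" unfolding r_def using d2 by simp
    have qm: "q \<le> m"
    proof -
      have "2 * q \<le> q * d" using d2 by (simp add: mult.commute)
      then show ?thesis using qr by linarith
    qed
    have G0: "G \<noteq> 0" using degG d2 by auto
    define Q where "Q = G ^ q * Polynomial.monom 1 r"
    have degQ: "Polynomial.degree Q = p - 1"
      using G0 qr p_eq by (simp add: Q_def degree_mult_eq degree_power_eq degree_monom_eq degG mult.commute)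
    have "Polynomial.coeff Q (Polynomial.degree Q) = c d ^ q"
      unfolding Q_def lead_coeff_mult lead_coeff_power lead_coeff_monom by (simp add: degG coeffG)
    then have 1: "(\<Sum>x\<in>?R. poly Q x) \<asymp> - (c d ^ q)" using sum_poly_values[of Q] degQ by simp
    have 2: "(\<Sum>x\<in>?R. g x ^ q * x ^ r) \<asymp> (\<Sum>x\<in>?R. poly Q x)"
      by (rule cong_sum) (simp add: Q_def poly_monom polyG cong_mult cong_pow rep')
    have 3: "(\<Sum>x\<in>?R. g x ^ q * x ^ r) \<asymp> 0"
      using qm rd dm by (intro moment) auto
    have "- (c d ^ q) \<asymp> 0" using cong_trans[OF cong_sym[OF 1] cong_trans[OF cong_sym[OF 2] 3]] .
    then have "c d ^ q \<asymp> 0" by (simp add: cong_0_iff)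
    moreover have "q > 0" using qr rd dm by (cases q) auto
    ultimately show False using cd power_eqv_0_iff[of q "c d"] by simp
  qed
  then have sum: "(\<Sum>k\<le>d. c k * x ^ k) = (if d = 0 then 0 else c 1) * x + c 0" for x
    by (cases d) auto
  show ?thesis
  proof (intro exI ballI)
    fix x assume "x \<in> ?R"
    from rep'[OF this] show "g x \<asymp> (if d = 0 then 0 else c 1) * x + c 0" by (simp only: sum)
  qed
qed

end

section \<open>Vectors over the prime field up to squares\<close>

context prime_1_mod_4
begin

text \<open>With congruences read as divisibility of differences, the \<open>algebra\<close> method
  proves them by ideal membership. An inverse modulo \<open>p\<close> enters such computations as a
  hypothesis of the form \<open>b * c \<asymp> 1\<close>.\<close>

declare cong_iff_dvd_diff [Groebner_Basis.algebra]

definition nz :: "int \<times> int \<Rightarrow> bool" where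
  "nz v \<longleftrightarrow> \<not> (fst v \<asymp> 0 \<and> snd v \<asymp> 0)"

definition vdet :: "int \<times> int \<Rightarrow> int \<times> int \<Rightarrow> int" where
  "vdet v w = fst v * snd w - snd v * fst w"

definition smul :: "int \<Rightarrow> int \<times> int \<Rightarrow> int \<times> int" where
  "smul k v = (k * fst v, k * snd v)"

definition act :: "int \<times> int \<times> int \<times> int \<Rightarrow> int \<times> int \<Rightarrow> int \<times> int" where
  "act M v = (case M of (a, b, c, d) \<Rightarrow> (a * fst v + b * snd v, c * fst v + d * snd v))"

definition mdet :: "int \<times> int \<times> int \<times> int \<Rightarrow> int" where
  "mdet M = (case M of (a, b, c, d) \<Rightarrow> a * d - b * c)"

definition veqv :: "int \<times> int \<Rightarrow> int \<times> int \<Rightarrow> bool" (infix "\<asymp>\<^sub>v" 50) where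
  "v \<asymp>\<^sub>v w \<longleftrightarrow> fst v \<asymp> fst w \<and> snd v \<asymp> snd w"

definition sim :: "int \<times> int \<Rightarrow> int \<times> int \<Rightarrow> bool" where
  "sim v w \<longleftrightarrow> (\<exists>k. chi k = 1 \<and> w \<asymp>\<^sub>v smul k v)"

definition nu :: int where "nu = (SOME n. chi n = - 1)"

lemma chi_nu [simp]: "chi nu = - 1"
  unfolding nu_def using someI_ex[OF ex_nonresidue] .

lemma veqv_refl [simp]: "v \<asymp>\<^sub>v v" by (simp add: veqv_def)

lemma veqv_sym: "v \<asymp>\<^sub>v w \<Longrightarrow> w \<asymp>\<^sub>v v" by (simp add: veqv_def cong_sym)

lemma veqv_trans: "u \<asymp>\<^sub>v v \<Longrightarrow> v \<asymp>\<^sub>v w \<Longrightarrow> u \<asymp>\<^sub>v w"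
  unfolding veqv_def using cong_trans by blast

lemma veqv_smul: "k \<asymp> l \<Longrightarrow> v \<asymp>\<^sub>v w \<Longrightarrow> smul k v \<asymp>\<^sub>v smul l w"
  by (simp add: veqv_def smul_def cong_mult)

lemma smul_smul: "smul k (smul l v) = smul (k * l) v" and smul_1 [simp]: "smul 1 v = v"
  by (simp_all add: smul_def mult.assoc)

lemma veqv_act: "v \<asymp>\<^sub>v w \<Longrightarrow> act M v \<asymp>\<^sub>v act M w"
  by (auto simp: veqv_def act_def split: prod.splits intro!: cong_add cong_mult)

lemma act_smul: "act M (smul k v) = smul k (act M v)"
  by (simp add: act_def smul_def algebra_simps split: prod.splits)

lemma vdet_cong: "v \<asymp>\<^sub>v v' \<Longrightarrow> w \<asymp>\<^sub>v w' \<Longrightarrow> vdet v w \<asymp> vdet v' w'"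
  unfolding veqv_def vdet_def by (intro cong_diff cong_mult) auto

lemma vdet_smul: "vdet (smul k v) w = k * vdet v w" "vdet v (smul k w) = k * vdet v w"
  by (simp_all add: vdet_def smul_def algebra_simps)

lemma vdet_act: "vdet (act M v) (act M w) = mdet M * vdet v w"
  by (simp add: vdet_def act_def mdet_def algebra_simps split: prod.splits)

lemma vdet_swap: "vdet w v = - vdet v w"
  by (simp add: vdet_def)

lemma chi_vdet_swap: "chi (vdet w v) = chi (vdet v w)"
  by (subst vdet_swap) simp

lemma nz_cong: "v \<asymp>\<^sub>v w \<Longrightarrow> nz v \<longleftrightarrow> nz w"
  unfolding nz_def veqv_def using not_eqv_0_eqv by blast

lemma nz_smul: "\<not> k \<asymp> 0 \<Longrightarrow> nz (smul k v) \<longleftrightarrow> nz v"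
  by (auto simp: nz_def smul_def mult_eqv_0_iff)

lemma chi_1_not_0: "chi k = 1 \<Longrightarrow> \<not> k \<asymp> 0" "chi k = - 1 \<Longrightarrow> \<not> k \<asymp> 0"
  using chi_eq_0_iff[of k] by auto

lemma nu_not_0: "\<not> nu \<asymp> 0" by (rule chi_1_not_0) simp

lemma nz_nu [simp]: "nz (smul nu v) \<longleftrightarrow> nz v" by (rule nz_smul[OF nu_not_0])

lemma sim_smul: "chi k = 1 \<Longrightarrow> sim v (smul k v)"
  unfolding sim_def using veqv_refl by blast

lemma sim_refl [simp]: "sim v v" using sim_smul[of 1 v] by simp

lemma sim_veqv: "v \<asymp>\<^sub>v w \<Longrightarrow> sim v w"
  unfolding sim_def by (rule exI[of _ 1]) (simp add: veqv_sym)

lemma sim_sym: assumes "sim v w" shows "sim w v"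
proof -
  obtain k where k: "chi k = 1" "w \<asymp>\<^sub>v smul k v" using assms unfolding sim_def by blast
  obtain l where l: "k * l \<asymp> 1" "\<not> l \<asymp> 0" using ex_inverse[OF chi_1_not_0(1)[OF k(1)]] .
  have "smul l w \<asymp>\<^sub>v smul (l * k) v"
    using veqv_smul[OF cong_refl k(2), of l] by (simp add: smul_smul)
  moreover have "smul (l * k) v \<asymp>\<^sub>v smul 1 v"
    by (rule veqv_smul) (use l(1) in \<open>simp_all add: mult.commute\<close>)
  ultimately have "v \<asymp>\<^sub>v smul l w" using veqv_trans veqv_sym by (metis smul_1)
  moreover have "chi l = 1" using chi_inverse[OF l(1)] k(1) by simp
  ultimately show ?thesis unfolding sim_def by blast
qed

lemma sim_trans: assumes "sim u v" "sim v w" shows "sim u w"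
proof -
  obtain k l where kl: "chi k = 1" "v \<asymp>\<^sub>v smul k u" "chi l = 1" "w \<asymp>\<^sub>v smul l v"
    using assms unfolding sim_def by blast
  then have "w \<asymp>\<^sub>v smul (l * k) u"
    using veqv_trans[OF kl(4) veqv_smul[OF cong_refl kl(2)]] by (simp add: smul_smul)
  moreover have "chi (l * k) = 1" using kl by (simp add: chi_mult)
  ultimately show ?thesis unfolding sim_def by blast
qed

lemma sim_cong_right: "sim v w \<Longrightarrow> sim u v \<longleftrightarrow> sim u w"
  using sim_trans sim_sym by blast

lemma sim_smul_cong: "sim v w \<Longrightarrow> sim (smul k v) (smul k w)"
  unfolding sim_def using veqv_smul[OF cong_refl] smul_smul mult.commute by metis

lemma chi_vdet_sim_right: assumes "sim v w" shows "chi (vdet u v) = chi (vdet u w)"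
proof -
  obtain k where k: "chi k = 1" "w \<asymp>\<^sub>v smul k v" using assms unfolding sim_def by blast
  have "chi (vdet u w) = chi (k * vdet u v)"
    using chi_cong[OF vdet_cong[OF veqv_refl k(2)], of u] by (simp add: vdet_smul)
  then show ?thesis using k(1) by (simp add: chi_mult)
qed

lemma chi_vdet_sim_left: assumes "sim v w" shows "chi (vdet v u) = chi (vdet w u)"
  using chi_vdet_sim_right[OF assms, of u] chi_vdet_swap by simp

lemma chi_vdet_sim: "sim v v' \<Longrightarrow> sim w w' \<Longrightarrow> chi (vdet v w) = chi (vdet v' w')"
  using chi_vdet_sim_left chi_vdet_sim_right by metis

lemma act_sim: "sim v w \<Longrightarrow> sim (act M v) (act M w)"
  unfolding sim_def using veqv_act act_smul by metis

lemma act_nz: assumes "\<not> mdet M \<asymp> 0" "nz v" shows "nz (act M v)"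
proof (rule ccontr)
  assume "\<not> nz (act M v)"
  moreover obtain a b c d where M: "M = (a, b, c, d)" by (cases M)
  ultimately have 0: "a * fst v + b * snd v \<asymp> 0" "c * fst v + d * snd v \<asymp> 0"
    by (simp_all add: nz_def act_def)
  have "(a * d - b * c) * fst v \<asymp> 0" "(a * d - b * c) * snd v \<asymp> 0"
    using 0 by Groebner_Basis.algebra+
  then show False using assms by (simp add: M mdet_def nz_def mult_eqv_0_iff)
qed

text \<open>The adjugate serves as an inverse without division: its product with \<open>M\<close> is
  the scalar \<open>mdet M\<close>, which acts trivially on classes when it is a square.\<close>

definition adj :: "int \<times> int \<times> int \<times> int \<Rightarrow> int \<times> int \<times> int \<times> int" where
  "adj M = (case M of (a, b, c, d) \<Rightarrow> (d, - b, - c, a))"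

lemma act_adj: "act (adj M) (act M v) = smul (mdet M) v" "act M (act (adj M) v) = smul (mdet M) v"
  by (simp_all add: adj_def act_def mdet_def smul_def algebra_simps split: prod.splits)

lemma mdet_adj [simp]: "mdet (adj M) = mdet M"
  by (simp add: adj_def mdet_def algebra_simps split: prod.splits)

lemma sim_act_iff: assumes "chi (mdet M) = 1" shows "sim (act M v) (act M w) \<longleftrightarrow> sim v w"
proof
  assume "sim (act M v) (act M w)"
  from act_sim[OF this, of "adj M"]
  have "sim (smul (mdet M) v) (smul (mdet M) w)" by (simp add: act_adj)
  then show "sim v w" using sim_smul[OF assms] sim_trans sim_sym by blast
qed (rule act_sim)

text \<open>The scalar is read off from a coordinate of \<open>v\<close> that is a unit.\<close>

lemma parallel: assumes "nz v" "nz w" "vdet v w \<asymp> 0"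
  obtains k where "\<not> k \<asymp> 0" "w \<asymp>\<^sub>v smul k v"
proof -
  obtain x y where v: "v = (x, y)" by (cases v)
  obtain x' y' where w: "w = (x', y')" by (cases w)
  have d: "x * y' - y * x' \<asymp> 0" using assms(3) by (simp add: vdet_def v w)
  have "\<exists>k. w \<asymp>\<^sub>v smul k v"
  proof (cases "x \<asymp> 0")
    case False
    then obtain z where z: "x * z \<asymp> 1" using ex_inverse by blast
    have "x' \<asymp> x' * z * x" "y' \<asymp> x' * z * y" using z d by Groebner_Basis.algebra+
    then show ?thesis by (auto simp: v w veqv_def smul_def intro!: exI[of _ "x' * z"])
  next
    case True
    then have "\<not> y \<asymp> 0" using assms(1) by (simp add: nz_def v)
    then obtain z where z: "y * z \<asymp> 1" using ex_inverse by blast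
    have "x' \<asymp> y' * z * x" "y' \<asymp> y' * z * y" using z d by Groebner_Basis.algebra+
    then show ?thesis by (auto simp: v w veqv_def smul_def intro!: exI[of _ "y' * z"])
  qed
  then obtain k where k: "w \<asymp>\<^sub>v smul k v" by blast
  have "\<not> k \<asymp> 0"
  proof
    assume "k \<asymp> 0"
    then have "\<not> nz (smul k v)" by (simp add: nz_def smul_def mult_eqv_0_iff)
    then show False using nz_cong[OF k] assms(2) by blast
  qed
  then show ?thesis using k that by blast
qed

lemma sim_vdet: "sim v w \<Longrightarrow> vdet v w \<asymp> 0"
  using chi_vdet_sim_right[of v w v] by (simp add: vdet_def flip: chi_eq_0_iff)

lemma not_sim_nu: assumes "nz v" shows "\<not> sim v (smul nu v)"
proof
  assume "sim v (smul nu v)"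
  then obtain k where k: "chi k = 1" "smul nu v \<asymp>\<^sub>v smul k v" unfolding sim_def by blast
  then have "(nu - k) * fst v \<asymp> 0" "(nu - k) * snd v \<asymp> 0"
    unfolding veqv_def smul_def by (simp_all add: cong_iff_dvd_diff left_diff_distrib)
  then have "nu \<asymp> k" using assms unfolding mult_eqv_0_iff nz_def by (auto simp: cong_iff_dvd_diff)
  then show False using chi_cong k(1) chi_nu by fastforce
qed

text \<open>The squares have index 2 among the units, so a punctured line splits into the classes of
  \<open>v\<close> and \<open>smul nu v\<close>.\<close>

lemma parallel_cases: assumes "nz v" "nz w" "vdet v w \<asymp> 0"
  shows "sim v w \<or> sim (smul nu v) w"
proof -
  obtain k where k: "\<not> k \<asymp> 0" "w \<asymp>\<^sub>v smul k v" using parallel[OF assms] .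
  show ?thesis
  proof (cases "chi k = 1")
    case True then show ?thesis using k(2) unfolding sim_def by blast
  next
    case False
    then have ck: "chi k = - 1" using chi_cases'[OF k(1)] by blast
    obtain l where l: "nu * l \<asymp> 1" "\<not> l \<asymp> 0" using ex_inverse[OF nu_not_0] .
    have "chi (k * l) = 1" using chi_inverse[OF l(1)] ck by (simp add: chi_mult)
    moreover have "k \<asymp> k * l * nu" using l(1) by Groebner_Basis.algebra
    then have "w \<asymp>\<^sub>v smul (k * l) (smul nu v)"
      using veqv_trans[OF k(2) veqv_smul[OF _ veqv_refl]] by (simp add: smul_smul)
    ultimately show ?thesis unfolding sim_def by blast
  qed
qed

lemma sim_nu_nu: "sim v (smul nu (smul nu v))"
  unfolding smul_smul by (rule sim_smul) (simp add: chi_mult)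

lemma vdet_nu_0: "sim (smul nu v) w \<Longrightarrow> vdet v w \<asymp> 0"
  using sim_vdet[of "smul nu v" w] nu_not_0 by (simp add: vdet_smul mult_eqv_0_iff)

lemma ex_vdet_1: assumes "nz v" obtains w where "vdet v w \<asymp> 1" "nz w"
proof -
  obtain x y where v: "v = (x, y)" by (cases v)
  have "\<exists>w. vdet v w \<asymp> 1"
  proof (cases "x \<asymp> 0")
    case False
    then obtain z where z: "x * z \<asymp> 1" using ex_inverse by blast
    then show ?thesis by (intro exI[of _ "(0, z)"]) (simp add: v vdet_def)
  next
    case True
    then have "\<not> y \<asymp> 0" using assms(1) by (simp add: nz_def v)
    then obtain z where z: "y * z \<asymp> 1" using ex_inverse by blast
    then show ?thesis by (intro exI[of _ "(- z, 0)"]) (simp add: v vdet_def)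
  qed
  then obtain w where w: "vdet v w \<asymp> 1" by blast
  have "nz w"
  proof (rule ccontr)
    assume "\<not> nz w"
    then have "w \<asymp>\<^sub>v (0, 0)" by (simp add: nz_def veqv_def)
    from vdet_cong[OF veqv_refl this, of v] have "vdet v w \<asymp> 0" by (simp add: vdet_def)
    then show False using w one_not_eqv_0 not_eqv_0_eqv by blast
  qed
  with w show ?thesis by (rule that)
qed

lemma nz_vdet: "\<not> vdet v w \<asymp> 0 \<Longrightarrow> nz v \<and> nz w"
  unfolding nz_def vdet_def using cong_diff[OF cong_mult cong_mult]
  by (metis (no_types, opaque_lifting) cong_0_iff dvd_diff dvd_mult dvd_mult2)

end

section \<open>Distances and walks\<close>

context pair_wf_digraph
begin

lemma gdist_eq_INF: "gdist G u v = (INF q\<in>{q. awalk u q v}. ereal (real (length q)))"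
proof -
  have "awalk_cost (\<lambda>_. 1) q = real (length q)" for q :: "('a \<times> 'a) list"
    by (induction q) simp_all
  then show ?thesis unfolding gdist_def \<mu>_def by simp
qed

text \<open>Relation powers replace walks from here on: they are easy to compose and to transport
  along automorphisms.\<close>

lemma awalk_iff_relpow:
  "u \<in> pverts G \<Longrightarrow> (\<exists>q. awalk u q v \<and> length q = n) \<longleftrightarrow> (u, v) \<in> parcs G ^^ n"
proof (induction n arbitrary: u)
  case 0
  then show ?case by (auto simp: awalk_Nil_iff)
next
  case (Suc n)
  have "(\<exists>q. awalk u q v \<and> length q = Suc n) \<longleftrightarrow> (\<exists>w. (u, w) \<in> parcs G \<and> (\<exists>q. awalk w q v \<and> length q = n))"
  proof
    assume "\<exists>q. awalk u q v \<and> length q = Suc n"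
    then obtain e q where "awalk u (e # q) v" "length q = n" by (auto simp: length_Suc_conv)
    then show "\<exists>w. (u, w) \<in> parcs G \<and> (\<exists>q. awalk w q v \<and> length q = n)"
      unfolding awalk_Cons_iff by (intro exI[of _ "snd e"]) (metis prod.collapse)
  next
    assume "\<exists>w. (u, w) \<in> parcs G \<and> (\<exists>q. awalk w q v \<and> length q = n)"
    then obtain w q where wq: "(u, w) \<in> parcs G" "awalk w q v" "length q = n" by (elim exE conjE)
    then have "awalk u ((u, w) # q) v" unfolding awalk_Cons_iff by simp
    then show "\<exists>q. awalk u q v \<and> length q = Suc n" using wq(3) by (metis length_Cons)
  qed
  also have "\<dots> \<longleftrightarrow> (\<exists>w. (u, w) \<in> parcs G \<and> (w, v) \<in> parcs G ^^ n)"
    using Suc.IH in_arcsD2 by blast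
  also have "\<dots> \<longleftrightarrow> (u, v) \<in> parcs G ^^ Suc n"
    by (meson relpow_Suc_D2 relpow_Suc_I2)
  finally show ?case .
qed

lemma gdist_le_relpow:
  assumes "u \<in> pverts G" "(u, v) \<in> parcs G ^^ n" shows "gdist G u v \<le> ereal (real n)"
proof -
  obtain q where "awalk u q v" "length q = n" using awalk_iff_relpow assms by blast
  then show ?thesis unfolding gdist_eq_INF by (intro INF_lower2[of q]) auto
qed

lemma gdist_eq_nat_iff:
  assumes u: "u \<in> pverts G"
  shows "gdist G u v = ereal (real n) \<longleftrightarrow> (u, v) \<in> parcs G ^^ n \<and> (\<forall>k<n. (u, v) \<notin> parcs G ^^ k)"
proof
  assume R: "(u, v) \<in> parcs G ^^ n \<and> (\<forall>k<n. (u, v) \<notin> parcs G ^^ k)"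
  have "ereal (real n) \<le> gdist G u v" unfolding gdist_eq_INF
  proof (rule INF_greatest)
    fix q assume "q \<in> {q. awalk u q v}"
    then have "(u, v) \<in> parcs G ^^ length q" using awalk_iff_relpow[OF u] by blast
    then show "ereal (real n) \<le> ereal (real (length q))" using R not_less by auto
  qed
  then show "gdist G u v = ereal (real n)" using gdist_le_relpow[OF u] R by (simp add: antisym)
next
  assume L: "gdist G u v = ereal (real n)"
  have less: "(u, v) \<notin> parcs G ^^ k" if "k < n" for k
    using gdist_le_relpow[OF u, of v k] L that by auto
  have "(u, v) \<in> parcs G ^^ n"
  proof (rule ccontr)
    assume n: "(u, v) \<notin> parcs G ^^ n"
    have "ereal (real (Suc n)) \<le> gdist G u v" unfolding gdist_eq_INF
    proof (rule INF_greatest)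
      fix q assume "q \<in> {q. awalk u q v}"
      then have q: "(u, v) \<in> parcs G ^^ length q" using awalk_iff_relpow[OF u] by blast
      then have "\<not> length q < n" "length q \<noteq> n" using less n by auto
      then show "ereal (real (Suc n)) \<le> ereal (real (length q))" by simp
    qed
    then show False using L by simp
  qed
  with less show "(u, v) \<in> parcs G ^^ n \<and> (\<forall>k<n. (u, v) \<notin> parcs G ^^ k)" by blast
qed

end

lemma relpow_2_iff: "(u, v) \<in> R ^^ 2 \<longleftrightarrow> (\<exists>w. (u, w) \<in> R \<and> (w, v) \<in> R)"
  by (auto simp: numeral_2_eq_2)

lemma relpow_3_iff: "(u, v) \<in> R ^^ 3 \<longleftrightarrow> (\<exists>w. (u, w) \<in> R \<and> (w, v) \<in> R ^^ 2)"
  by (auto simp: numeral_2_eq_2 numeral_3_eq_3)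

section \<open>Graphs parametrized by vectors\<close>

text \<open>The vertices are the nonzero vectors up to nonzero squares; the antipode of \<open>v\<close> is
  \<open>\<nu> v\<close> for a nonresidue \<open>\<nu>\<close>, and a fibre is a line.\<close>

locale vector_graph = prime_1_mod_4 p for p +
  fixes f :: "int \<times> int \<Rightarrow> 'a" and G :: "'a pair_pre_digraph"
  assumes arcs_in_verts: "parcs G \<subseteq> pverts G \<times> pverts G"
    and verts_eq: "pverts G = f ` {v. nz v}"
    and f_eq_iff: "nz v \<Longrightarrow> nz w \<Longrightarrow> f v = f w \<longleftrightarrow> sim v w"
    and adj_iff: "nz v \<Longrightarrow> nz w \<Longrightarrow> (f v, f w) \<in> parcs G \<longleftrightarrow> chi (vdet v w) = 1"
begin

lemma f_in_verts: "nz v \<Longrightarrow> f v \<in> pverts G"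
  using verts_eq by blast

lemma vert_cases: assumes "u \<in> pverts G" obtains v where "nz v" "u = f v"
  using assms verts_eq by blast

lemma finite_verts: "finite (pverts G)"
proof -
  have "pverts G \<subseteq> f ` ({0..<int p} \<times> {0..<int p})"
  proof
    fix u assume "u \<in> pverts G"
    then obtain v where v: "nz v" "u = f v" by (rule vert_cases)
    define w where "w = (fst v mod int p, snd v mod int p)"
    have vw: "v \<asymp>\<^sub>v w" by (simp add: w_def veqv_def)
    then have "f v = f w" using f_eq_iff v(1) nz_cong[OF vw] sim_veqv by blast
    moreover have "w \<in> {0..<int p} \<times> {0..<int p}" using p_ge_5 by (simp add: w_def)
    ultimately show "u \<in> f ` ({0..<int p} \<times> {0..<int p})" using v(2) by blast
  qed
  then show ?thesis by (rule finite_subset) simp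
qed

lemma pair_graph_G: "pair_graph G"
proof
  fix e assume e: "e \<in> parcs G"
  then show "fst e \<in> pverts G" "snd e \<in> pverts G" using arcs_in_verts by auto
  then obtain v w where vw: "nz v" "nz w" "e = (f v, f w)"
    by (metis prod.collapse vert_cases)
  show "fst e \<noteq> snd e"
  proof
    assume "fst e = snd e"
    then have "chi (vdet v v) = 1" using e vw f_eq_iff adj_iff by (metis fst_conv snd_conv)
    then show False by (simp add: vdet_def)
  qed
next
  show "finite (pverts G)" by (rule finite_verts)
  show "finite (parcs G)"
    using finite_verts arcs_in_verts by (meson finite_SigmaI finite_subset)
  show "symmetric (with_proj G)"
  proof (unfold symmetric_def with_proj_simps, rule symI)
    fix x y assume e: "(x, y) \<in> parcs G"
    then have "x \<in> pverts G" "y \<in> pverts G" using arcs_in_verts by auto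
    then obtain v w where vw: "nz v" "nz w" "x = f v" "y = f w" by (metis vert_cases)
    then show "(y, x) \<in> parcs G" using e adj_iff chi_vdet_swap by metis
  qed
qed

sublocale pair_graph G by (rule pair_graph_G)

text \<open>A common neighbour \<open>x\<close> of \<open>v\<close> and \<open>smul nu v\<close>
  would make \<open>vdet v x\<close> both a square and a nonsquare. All other vertices are reached,
  \<open>v\<close> itself included, so walks of length 2 single out the antipode.\<close>

lemma relpow_2:
  assumes v: "nz v" and w: "nz w"
  shows "(f v, f w) \<in> parcs G ^^ 2 \<longleftrightarrow> \<not> sim (smul nu v) w"
proof
  assume "(f v, f w) \<in> parcs G ^^ 2"
  then obtain y where y: "(f v, y) \<in> parcs G" "(y, f w) \<in> parcs G" unfolding relpow_2_iff by blast
  then obtain x where x: "nz x" "y = f x" using arcs_in_verts vert_cases by blast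
  have 1: "chi (vdet v x) = 1" "chi (vdet x w) = 1" using y x v w adj_iff by auto
  show "\<not> sim (smul nu v) w"
  proof
    assume "sim (smul nu v) w"
    from chi_vdet_sim_right[OF this, of x] 1(2) have "chi (vdet x (smul nu v)) = 1" by simp
    then show False using 1(1) chi_vdet_swap[of x v] by (simp add: vdet_smul chi_mult)
  qed
next
  assume ns: "\<not> sim (smul nu v) w"
  have "\<exists>x. chi (vdet v x) = 1 \<and> chi (vdet x w) = 1"
  proof (cases "vdet v w \<asymp> 0")
    case True
    then have s: "sim v w" using parallel_cases v w ns by blast
    obtain x where x: "vdet v x \<asymp> 1" using ex_vdet_1[OF v] .
    then have "chi (vdet v x) = 1" using chi_cong by fastforce
    then show ?thesis using chi_vdet_swap chi_vdet_sim_left[OF s] by metis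
  next
    case False
    define D where "D = vdet v w"
    \<comment> \<open>Scaling \<open>v + w\<close> by \<open>D\<close> turns both determinants into
      the square \<open>D * D\<close>, whatever the character of \<open>D\<close> is.\<close>
    define x where "x = (D * (fst v + fst w), D * (snd v + snd w))"
    have "vdet v x = D * D" "vdet x w = D * D"
      by (simp_all add: x_def D_def vdet_def algebra_simps)
    then show ?thesis using chi_square[OF False] unfolding D_def by metis
  qed
  then obtain x where x: "chi (vdet v x) = 1" "chi (vdet x w) = 1" by blast
  then have "nz x" using nz_vdet chi_1_not_0 by blast
  then show "(f v, f w) \<in> parcs G ^^ 2" unfolding relpow_2_iff using x v w adj_iff by blast
qed

lemma relpow_3:
  assumes v: "nz v" and w: "nz w"
  shows "(f v, f w) \<in> parcs G ^^ 3"
proof -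
  obtain x where x: "vdet v x \<asymp> 1" "nz x" using ex_vdet_1[OF v] .
  then have 1: "chi (vdet v x) = 1" using chi_cong by fastforce
  show ?thesis
  proof (cases "sim (smul nu x) w")
    case False
    then show ?thesis unfolding relpow_3_iff using adj_iff[OF v x(2)] 1 relpow_2[OF x(2) w] by blast
  next
    case True
    \<comment> \<open>Here the chosen neighbour \<open>x\<close> of \<open>v\<close> is the antipode
      of \<open>w\<close>. Adding \<open>v\<close> keeps \<open>vdet v x\<close> and moves
      \<open>x\<close> to another line.\<close>
    define x' where "x' = (fst x + fst v, snd x + snd v)"
    have d: "vdet v x' = vdet v x" "vdet x x' = - vdet v x" by (simp_all add: x'_def vdet_def algebra_simps)
    have nx': "nz x'" using d(1) 1 nz_vdet chi_1_not_0 by metis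
    have "\<not> sim (smul nu x') w"
    proof
      assume "sim (smul nu x') w"
      then have "sim (smul nu x) (smul nu x')" using True sim_trans sim_sym by blast
      then have "sim (smul nu (smul nu x)) (smul nu (smul nu x'))" by (rule sim_smul_cong)
      then have "sim x x'" using sim_nu_nu sim_trans sim_sym by blast
      then have "vdet x x' \<asymp> 0" by (rule sim_vdet)
      then show False using d(2) 1 chi_eq_0_iff chi_minus by (metis zero_neq_one)
    qed
    then show ?thesis unfolding relpow_3_iff
      using adj_iff[OF v nx'] 1 relpow_2[OF nx' w] d(1) by metis
  qed
qed

lemma gdist_2_iff: assumes v: "nz v" and w: "nz w"
  shows "gdist G (f v) (f w) = ereal (real 2) \<longleftrightarrow> chi (vdet v w) = - 1"
proof -
  have "gdist G (f v) (f w) = ereal (real 2) \<longleftrightarrow> \<not> sim (smul nu v) w \<and> \<not> sim v w \<and> chi (vdet v w) \<noteq> 1"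
    unfolding gdist_eq_nat_iff[OF f_in_verts[OF v]] relpow_2[OF v w]
    using f_eq_iff[OF v w] adj_iff[OF v w] by (auto simp: numeral_2_eq_2 less_Suc_eq)
  also have "\<dots> \<longleftrightarrow> chi (vdet v w) = - 1"
    using parallel_cases[OF v w] sim_vdet[of v w] vdet_nu_0[of v w] chi_cases'[of "vdet v w"]
      chi_eq_0_iff[of "vdet v w"] by auto
  finally show ?thesis .
qed

lemma gdist_3_iff: assumes v: "nz v" and w: "nz w"
  shows "gdist G (f v) (f w) = ereal (real 3) \<longleftrightarrow> sim (smul nu v) w"
proof -
  have "gdist G (f v) (f w) = ereal (real 3) \<longleftrightarrow> sim (smul nu v) w \<and> \<not> sim v w \<and> chi (vdet v w) \<noteq> 1"
    unfolding gdist_eq_nat_iff[OF f_in_verts[OF v]]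
    using relpow_3[OF v w] f_eq_iff[OF v w] adj_iff[OF v w] relpow_2[OF v w]
    by (auto simp: numeral_2_eq_2 numeral_3_eq_3 less_Suc_eq)
  also have "\<dots> \<longleftrightarrow> sim (smul nu v) w"
  proof -
    have "\<not> sim v w \<and> chi (vdet v w) \<noteq> 1" if s: "sim (smul nu v) w"
    proof
      show "\<not> sim v w" using not_sim_nu[OF v] sim_trans[OF _ sim_sym[OF s]] by blast
      show "chi (vdet v w) \<noteq> 1" using vdet_nu_0[OF s] chi_eq_0_iff[of "vdet v w"] by simp
    qed
    then show ?thesis by blast
  qed
  finally show ?thesis .
qed

lemma gdist_le_3: assumes "u \<in> pverts G" "v \<in> pverts G" shows "gdist G u v \<le> ereal (real 3)"
  using assms relpow_3 gdist_le_relpow f_in_verts vert_cases by metis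

lemma nz_10: "nz (1, 0)" using one_not_eqv_0 by (simp add: nz_def)

lemma gdiam_eq: "gdiam G = ereal (real 3)"
  unfolding gdiam_def
proof (rule antisym)
  show "(SUP (u, v)\<in>pverts G \<times> pverts G. gdist G u v) \<le> ereal (real 3)"
    by (rule SUP_least) (use gdist_le_3 in auto)
  have "gdist G (f (1, 0)) (f (smul nu (1, 0))) = ereal (real 3)"
    using gdist_3_iff nz_10 by simp
  then show "ereal (real 3) \<le> (SUP (u, v)\<in>pverts G \<times> pverts G. gdist G u v)"
    using nz_10 f_in_verts[OF nz_10] f_in_verts[of "smul nu (1, 0)"]
    by (intro SUP_upper2[of "(f (1, 0), f (smul nu (1, 0)))"]) auto
qed

lemma connected_G: "connected (with_proj G)"
proof -
  have "u \<rightarrow>\<^sup>*\<^bsub>with_proj (mk_symmetric (with_proj G))\<^esub> v" if uv: "u \<in> pverts G" "v \<in> pverts G" for u v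
  proof -
    have "(u, v) \<in> parcs G ^^ 3" using relpow_3 uv by (metis vert_cases)
    from iffD2[OF awalk_iff_relpow[OF uv(1)] this] obtain q where "awalk u q v" by (elim exE conjE)
    then have "u \<rightarrow>\<^sup>*\<^bsub>with_proj G\<^esub> v" by (rule reachable_awalkI)
    then show ?thesis by (rule reachable_mk_symmetricI)
  qed
  then show ?thesis unfolding connected_def strongly_connected_def
    using f_in_verts[OF nz_10] by (auto simp: mk_symmetric_def)
qed

lemma not_bipartite_G: "\<not> bipartite_graph G"
proof
  assume "bipartite_graph G"
  then obtain S T where ST: "pverts G = S \<union> T" "S \<inter> T = {}" "parcs G \<subseteq> S \<times> T \<union> T \<times> S"
    unfolding bipartite_graph_def by (elim exE conjE)
  have n: "nz (0, 1)" "nz (1, 1)" using one_not_eqv_0 by (simp_all add: nz_def)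
  \<comment> \<open>A triangle: its determinants are 1 or - 1, and - 1 is a square.\<close>
  have "(f (1, 0), f (0, 1)) \<in> parcs G" "(f (0, 1), f (1, 1)) \<in> parcs G" "(f (1, 0), f (1, 1)) \<in> parcs G"
    using adj_iff n nz_10 by (simp_all add: vdet_def)
  then show False using ST by blast
qed

lemma antipodal_rel_iff: assumes "nz v" "nz w"
  shows "(f v, f w) \<in> antipodal_rel G \<longleftrightarrow> vdet v w \<asymp> 0"
proof -
  have "(f v, f w) \<in> antipodal_rel G \<longleftrightarrow> sim v w \<or> sim (smul nu v) w"
    unfolding antipodal_rel_def gdiam_eq
    using gdist_3_iff[OF assms] f_eq_iff[OF assms] f_in_verts[OF assms(1)] f_in_verts[OF assms(2)] by simp
  also have "\<dots> \<longleftrightarrow> vdet v w \<asymp> 0"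
    using parallel_cases[OF assms] sim_vdet[of v w] vdet_nu_0[of v w] by blast
  finally show ?thesis .
qed

end

section \<open>The antipodal quotient\<close>

text \<open>Each coordinate of \<open>v\<close> times \<open>vdet u w\<close> lies in the ideal of
  the two given determinants, and one of these coordinates is a unit.\<close>

lemma (in prime_1_mod_4) vdet_eqv_0_trans:
  assumes "nz v" "vdet u v \<asymp> 0" "vdet v w \<asymp> 0" shows "vdet u w \<asymp> 0"
proof -
  obtain a b where v: "v = (a, b)" by (cases v)
  obtain a1 b1 where u: "u = (a1, b1)" by (cases u)
  obtain a2 b2 where w: "w = (a2, b2)" by (cases w)
  have "a1 * b - b1 * a \<asymp> 0" "a * b2 - b * a2 \<asymp> 0"
    using assms(2,3) by (simp_all add: u v w vdet_def)
  then have "a * (a1 * b2 - b1 * a2) \<asymp> 0" "b * (a1 * b2 - b1 * a2) \<asymp> 0"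
    by Groebner_Basis.algebra+
  then show ?thesis using assms(1) unfolding mult_eqv_0_iff by (auto simp: u v w nz_def vdet_def)
qed

lemma (in prime_1_mod_4) vdet_eqv_0_swap: "vdet u v \<asymp> 0 \<longleftrightarrow> vdet v u \<asymp> 0"
  unfolding vdet_swap[of u v] by (simp add: cong_0_iff)

context vector_graph
begin

definition fibre :: "int \<times> int \<Rightarrow> 'a set" where
  "fibre v = {f v, f (smul nu v)}"

lemma equiv_antipodal: "equiv (pverts G) (antipodal_rel G)"
proof (rule equivI)
  show "antipodal_rel G \<subseteq> pverts G \<times> pverts G" unfolding antipodal_rel_def by auto
  show "refl_on (pverts G) (antipodal_rel G)"
    unfolding refl_on_def by (auto simp: antipodal_rel_def)
  show "sym (antipodal_rel G)"
  proof (rule symI)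
    fix x y assume xy: "(x, y) \<in> antipodal_rel G"
    then have "x \<in> pverts G" "y \<in> pverts G" by (auto simp: antipodal_rel_def)
    then obtain v w where vw: "nz v" "nz w" "x = f v" "y = f w" by (metis vert_cases)
    then show "(y, x) \<in> antipodal_rel G"
      using xy antipodal_rel_iff[of v w] antipodal_rel_iff[of w v] vdet_eqv_0_swap[of v w] by simp
  qed
  show "trans (antipodal_rel G)"
  proof (rule transI)
    fix x y z assume xy: "(x, y) \<in> antipodal_rel G" and yz: "(y, z) \<in> antipodal_rel G"
    then have "x \<in> pverts G" "y \<in> pverts G" "z \<in> pverts G" by (auto simp: antipodal_rel_def)
    then obtain u v w where vw: "nz v" "nz w" "nz u" "x = f u" "y = f v" "z = f w" by (metis vert_cases)
    then show "(x, z) \<in> antipodal_rel G"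
      using xy yz antipodal_rel_iff[of u v] antipodal_rel_iff[of v w] antipodal_rel_iff[of u w]
        vdet_eqv_0_trans[of v u w] by simp
  qed
qed

lemma antipodal_G: "antipodal G"
  unfolding antipodal_def gdiam_eq using equiv_antipodal by (intro conjI exI[of _ 3]) auto

lemma antipodal_class: assumes v: "nz v" shows "antipodal_rel G `` {f v} = fibre v"
proof (rule Set.set_eqI)
  fix x
  show "x \<in> antipodal_rel G `` {f v} \<longleftrightarrow> x \<in> fibre v"
  proof (cases "x \<in> pverts G")
    case True
    then obtain w where w: "nz w" "x = f w" by (rule vert_cases)
    have "x \<in> antipodal_rel G `` {f v} \<longleftrightarrow> vdet v w \<asymp> 0"
      using antipodal_rel_iff[OF v w(1)] w(2) by simp
    also have "\<dots> \<longleftrightarrow> sim v w \<or> sim (smul nu v) w"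
      using parallel_cases[OF v w(1)] sim_vdet[of v w] vdet_nu_0[of v w] by blast
    also have "\<dots> \<longleftrightarrow> x \<in> fibre v"
      unfolding fibre_def w(2) using f_eq_iff[OF v w(1)] f_eq_iff[of "smul nu v" w] v w(1) by auto
    finally show ?thesis .
  next
    case False
    moreover have "f v \<in> pverts G" "f (smul nu v) \<in> pverts G" using f_in_verts v by auto
    ultimately show ?thesis by (auto simp: fibre_def antipodal_rel_def)
  qed
qed

lemma fibre_eq_iff: assumes "nz v" "nz w" shows "fibre v = fibre w \<longleftrightarrow> vdet v w \<asymp> 0"
  using eq_equiv_class_iff[OF equiv_antipodal f_in_verts[OF assms(1)] f_in_verts[OF assms(2)]]
    antipodal_rel_iff[OF assms] by (simp add: antipodal_class assms)

lemma quotient_verts: "pverts (antipodal_quotient G) = fibre ` {v. nz v}"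
proof -
  have "pverts G // antipodal_rel G = (\<lambda>v. antipodal_rel G `` {f v}) ` {v. nz v}"
    unfolding quotient_def verts_eq by auto
  also have "\<dots> = fibre ` {v. nz v}" using antipodal_class by (intro image_cong) auto
  finally show ?thesis by (simp add: antipodal_quotient_def Let_def)
qed

text \<open>Multiplying \<open>w\<close> by \<open>nu\<close> flips the character of the
  determinant, so exactly one point of the fibre has the right character.\<close>

lemma fibre_adj:
  assumes v: "nz v" and w: "nz w" and n: "\<not> vdet v w \<asymp> 0"
  shows "\<exists>!y. y \<in> fibre w \<and> (f v, y) \<in> parcs G"
proof -
  have a1: "(f v, f w) \<in> parcs G \<longleftrightarrow> chi (vdet v w) = 1" using adj_iff[OF v w] .
  have a2: "(f v, f (smul nu w)) \<in> parcs G \<longleftrightarrow> chi (vdet v w) = - 1"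
    using adj_iff[OF v, of "smul nu w"] w chi_cases'[OF n] by (auto simp: vdet_smul chi_mult)
  show ?thesis
  proof (cases "chi (vdet v w) = 1")
    case True
    then show ?thesis using a1 a2 by (intro ex1I[of _ "f w"]) (auto simp: fibre_def)
  next
    case False
    then have "chi (vdet v w) = - 1" using chi_cases'[OF n] by simp
    then show ?thesis using a1 a2 by (intro ex1I[of _ "f (smul nu w)"]) (auto simp: fibre_def)
  qed
qed

lemma fibre_member: assumes "nz v" "x \<in> fibre v" obtains u where "nz u" "x = f u" "fibre u = fibre v"
proof (cases "x = f v")
  case True then show ?thesis using that[of v] assms by simp
next
  case False
  then have "x = f (smul nu v)" using assms by (simp add: fibre_def)
  moreover have "vdet (smul nu v) v \<asymp> 0" by (simp add: vdet_def smul_def)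
  ultimately show ?thesis using that[of "smul nu v"] assms fibre_eq_iff[of "smul nu v" v] by simp
qed

lemma quotient_arcs:
  "parcs (antipodal_quotient G) =
    {(B, B'). (B, B') \<in> pverts (antipodal_quotient G) \<times> pverts (antipodal_quotient G) \<and> B \<noteq> B'}"
proof -
  have "\<exists>x\<in>B. \<exists>y\<in>B'. (x, y) \<in> parcs G" if BB: "B \<in> fibre ` {v. nz v}" "B' \<in> fibre ` {v. nz v}" "B \<noteq> B'" for B B'
  proof -
    obtain v w where vw: "nz v" "nz w" "B = fibre v" "B' = fibre w" using BB by blast
    then have "\<not> vdet v w \<asymp> 0" using BB(3) fibre_eq_iff by blast
    from fibre_adj[OF vw(1,2) this] obtain y where "y \<in> fibre w \<and> (f v, y) \<in> parcs G" by (elim ex1E)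
    then show ?thesis unfolding vw by (intro bexI[of _ "f v"] bexI[of _ y]) (simp_all add: fibre_def)
  qed
  then have *: "\<exists>x\<in>B. \<exists>y\<in>B'. (x, y) \<in> parcs G"
    if "B \<in> pverts (antipodal_quotient G)" "B' \<in> pverts (antipodal_quotient G)" "B \<noteq> B'" for B B'
    using that unfolding quotient_verts by blast
  have "parcs (antipodal_quotient G) = {(B, B') \<in> pverts (antipodal_quotient G) \<times> pverts (antipodal_quotient G).
      B \<noteq> B' \<and> (\<exists>x\<in>B. \<exists>y\<in>B'. (x, y) \<in> parcs G)}"
    by (simp add: antipodal_quotient_def Let_def)
  with * show ?thesis by blast
qed

lemma antipodal_double_cover_G: "antipodal_double_cover G"
proof -
  have "\<exists>!y. y \<in> B' \<and> (x, y) \<in> parcs G"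
    if BB: "(B, B') \<in> parcs (antipodal_quotient G)" and x: "x \<in> B" for B B' x
  proof -
    obtain v w where vw: "nz v" "nz w" "B = fibre v" "B' = fibre w"
      using BB unfolding quotient_arcs quotient_verts by blast
    obtain u where u: "nz u" "x = f u" "fibre u = fibre v" using fibre_member[OF vw(1)] x vw(3) by metis
    have "fibre u \<noteq> fibre w" using BB vw u unfolding quotient_arcs by simp
    then have "\<not> vdet u w \<asymp> 0" using fibre_eq_iff[OF u(1) vw(2)] by blast
    from fibre_adj[OF u(1) vw(2) this] show ?thesis using u vw by simp
  qed
  moreover have "card B = 2" if B: "B \<in> pverts (antipodal_quotient G)" for B
  proof -
    obtain v where v: "nz v" "B = fibre v" using B unfolding quotient_verts by blast
    then have "f v \<noteq> f (smul nu v)" using not_sim_nu f_eq_iff by simp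
    then show ?thesis unfolding v(2) fibre_def by simp
  qed
  ultimately show ?thesis unfolding antipodal_double_cover_def antipodal_cover_def
    using antipodal_G by blast
qed

lemma card_quotient: "finite (pverts (antipodal_quotient G)) \<and> card (pverts (antipodal_quotient G)) = p + 1"
proof -
  \<comment> \<open>One vector for each point of the projective line: the point at infinity and the
    \<open>p\<close> affine points.\<close>
  define L where "L = insert (1, 0) ((\<lambda>x. (x, 1 :: int)) ` {0..<int p})"
  have nzL: "nz v" if "v \<in> L" for v using that one_not_eqv_0 by (auto simp: L_def nz_def)
  have "fibre ` {v. nz v} = fibre ` L"
  proof
    show "fibre ` {v. nz v} \<subseteq> fibre ` L"
    proof
      fix B assume "B \<in> fibre ` {v. nz v}"
      then obtain v where v: "nz v" "B = fibre v" by blast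
      obtain a b where ab: "v = (a, b)" by (cases v)
      show "B \<in> fibre ` L"
      proof (cases "b \<asymp> 0")
        case True
        then have "vdet v (1, 0) \<asymp> 0" by (simp add: vdet_def ab cong_0_iff)
        then have "B = fibre (1, 0)" using fibre_eq_iff[OF v(1) nz_10] v(2) by blast
        then show ?thesis by (simp add: L_def)
      next
        case False
        then obtain c where c: "b * c \<asymp> 1" using ex_inverse by blast
        define x where "x = a * c mod int p"
        have x: "x \<asymp> a * c" "x \<in> {0..<int p}" using p_ge_5 by (simp_all add: x_def)
        then have xL: "(x, 1) \<in> L" by (simp add: L_def)
        have "a * 1 - b * x \<asymp> 0" using x(1) c by Groebner_Basis.algebra
        then have "vdet v (x, 1) \<asymp> 0" by (simp add: vdet_def ab)
        then have "B = fibre (x, 1)" using fibre_eq_iff[OF v(1) nzL[OF xL]] v(2) by blast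
        then show ?thesis using xL by blast
      qed
    qed
  qed (use nzL in blast)
  moreover have "inj_on fibre L"
  proof (rule inj_onI)
    fix v w assume vw: "v \<in> L" "w \<in> L" "fibre v = fibre w"
    then have d: "vdet v w \<asymp> 0" using fibre_eq_iff nzL by blast
    have s: "x = y" if "x - y \<asymp> 0" "x \<in> {0..<int p}" "y \<in> {0..<int p}" for x y
      using eqv_small[OF _ that(2,3)] that(1) by (simp add: cong_iff_dvd_diff)
    have m1: "\<not> - 1 \<asymp> 0" using one_not_eqv_0 by (simp add: cong_0_iff)
    show "v = w" using d s vw(1,2) one_not_eqv_0 m1 unfolding L_def vdet_def by auto
  qed
  moreover have "card L = p + 1"
  proof -
    have "(1, 0) \<notin> (\<lambda>x. (x, 1 :: int)) ` {0..<int p}" by auto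
    then show ?thesis unfolding L_def by (simp add: card_image inj_on_def)
  qed
  moreover have "finite L" by (simp add: L_def)
  ultimately show ?thesis unfolding quotient_verts by (simp add: card_image)
qed

lemma complete_quotient: "complete_digraph (p + 1) (with_proj (antipodal_quotient G))"
  unfolding complete_digraph_pair_def using card_quotient quotient_arcs by blast

end

section \<open>Linear automorphisms and geodesic transitivity\<close>

context prime_1_mod_4
begin

definition mmul :: "int \<times> int \<times> int \<times> int \<Rightarrow> int \<times> int \<times> int \<times> int \<Rightarrow> int \<times> int \<times> int \<times> int" where
  "mmul M N = (case M of (a, b, c, d) \<Rightarrow> case N of (a', b', c', d') \<Rightarrow>
     (a * a' + b * c', a * b' + b * d', c * a' + d * c', c * b' + d * d'))"

lemma act_mmul: "act (mmul M N) v = act M (act N v)"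
  by (simp add: act_def mmul_def algebra_simps split: prod.splits)

lemma mdet_mmul: "mdet (mmul M N) = mdet M * mdet N"
  by (simp add: mdet_def mmul_def algebra_simps split: prod.splits)

definition mu :: int where "mu = (SOME x. nu * x \<asymp> 1)"

lemma nu_mu: "nu * mu \<asymp> 1"
  unfolding mu_def using someI_ex[of "\<lambda>x. nu * x \<asymp> 1"] ex_inverse[OF nu_not_0] by blast

text \<open>The three characters say that \<open>u\<close>, \<open>v\<close>, \<open>w\<close> is a
  2-geodesic. Cramer's relation, \<open>vdet u v\<close> times \<open>w\<close> equals
  \<open>vdet w v\<close> times \<open>u\<close> plus \<open>vdet u w\<close> times
  \<open>v\<close>, gives a matrix whose columns are multiples of \<open>u\<close> and
  \<open>v\<close>. The standard end point is \<open>(1, mu)\<close> because the inverse nonresidue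
  leaves the factor \<open>vdet u w * nu\<close> for the second column, which is a square.\<close>

lemma standard_triple:
  assumes uv: "chi (vdet u v) = 1" and vw: "chi (vdet v w) = 1" and uw: "chi (vdet u w) = - 1"
  obtains L where "chi (mdet L) = 1" "sim (act L (1, 0)) u" "sim (act L (0, 1)) v" "sim (act L (1, mu)) w"
proof -
  define D where "D = vdet u v"
  define a where "a = vdet w v"
  define b where "b = vdet u w * nu"
  define L where "L = (a * fst u, b * fst v, a * snd u, b * snd v)"
  have cD: "chi D = 1" and ca: "chi a = 1" and cb: "chi b = 1"
    using assms chi_vdet_swap[of w v] by (simp_all add: D_def a_def b_def chi_mult)
  have "mdet L = a * b * D" by (simp add: L_def mdet_def D_def vdet_def algebra_simps)
  then have "chi (mdet L) = 1" by (simp add: chi_mult cD ca cb)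
  moreover have "act L (1, 0) = smul a u" "act L (0, 1) = smul b v"
    by (simp_all add: L_def act_def smul_def)
  then have "sim (act L (1, 0)) u" "sim (act L (0, 1)) v" using sim_smul ca cb sim_sym by metis+
  moreover have "act L (1, mu) \<asymp>\<^sub>v smul D w"
  proof -
    obtain u1 u2 where u: "u = (u1, u2)" by (cases u)
    obtain v1 v2 where v: "v = (v1, v2)" by (cases v)
    obtain w1 w2 where w: "w = (w1, w2)" by (cases w)
    have "(w1 * v2 - w2 * v1) * u1 + (u1 * w2 - u2 * w1) * nu * v1 * mu \<asymp> (u1 * v2 - u2 * v1) * w1"
      "(w1 * v2 - w2 * v1) * u2 + (u1 * w2 - u2 * w1) * nu * v2 * mu \<asymp> (u1 * v2 - u2 * v1) * w2"
      using nu_mu by Groebner_Basis.algebra+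
    then show ?thesis by (simp add: L_def act_def veqv_def smul_def D_def a_def b_def vdet_def u v w)
  qed
  then have "sim (act L (1, mu)) w" using sim_veqv sim_smul[OF cD] sim_trans sim_sym by blast
  ultimately show ?thesis by (rule that)
qed

end

lemma carrier_aut_group: "carrier (aut_group G) = {h \<in> Bij (pverts G). \<forall>u \<in> pverts G. \<forall>v \<in> pverts G.
    (h u, h v) \<in> parcs G \<longleftrightarrow> (u, v) \<in> parcs G}"
  by (simp add: aut_group_def)

context vector_graph
begin

definition param_inv :: "'a \<Rightarrow> int \<times> int" where
  "param_inv u = (SOME v. nz v \<and> f v = u)"

text \<open>Restricted to the vertex set because the elements of \<open>Bij\<close> are extensional
  functions.\<close>

definition lin_aut :: "int \<times> int \<times> int \<times> int \<Rightarrow> 'a \<Rightarrow> 'a" where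
  "lin_aut L = (\<lambda>u\<in>pverts G. f (act L (param_inv u)))"

lemma param_inv: assumes "nz v" shows "nz (param_inv (f v))" "sim (param_inv (f v)) v"
proof -
  have "nz (param_inv (f v)) \<and> f (param_inv (f v)) = f v"
    unfolding param_inv_def by (rule someI[of _ v]) (simp add: assms)
  then show "nz (param_inv (f v))" "sim (param_inv (f v)) v" using f_eq_iff[of "param_inv (f v)" v] assms by auto
qed

lemma nz_act: "chi (mdet L) = 1 \<Longrightarrow> nz v \<Longrightarrow> nz (act L v)"
  using act_nz chi_1_not_0 by blast

lemma lin_aut_f: assumes "chi (mdet L) = 1" "nz v" shows "lin_aut L (f v) = f (act L v)"
proof -
  have "lin_aut L (f v) = f (act L (param_inv (f v)))" using f_in_verts assms(2) by (simp add: lin_aut_def)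
  also have "\<dots> = f (act L v)"
    using f_eq_iff[OF nz_act[OF assms(1) param_inv(1)[OF assms(2)]] nz_act[OF assms]]
      act_sim[OF param_inv(2)[OF assms(2)]] by blast
  finally show ?thesis .
qed

lemma lin_aut_adj: assumes L: "chi (mdet L) = 1" and u: "u \<in> pverts G"
  shows "lin_aut (adj L) (lin_aut L u) = u" "lin_aut L (lin_aut (adj L) u) = u"
proof -
  obtain v where v: "nz v" "u = f v" using vert_cases[OF u] .
  have "f (smul (mdet L) v) = f v"
    using f_eq_iff[of "smul (mdet L) v" v] sim_sym[OF sim_smul[OF L, of v]] nz_smul[OF chi_1_not_0(1)[OF L]] v(1) by blast
  then show "lin_aut (adj L) (lin_aut L u) = u" "lin_aut L (lin_aut (adj L) u) = u"
    unfolding v(2) using L v(1) nz_act by (simp_all add: lin_aut_f act_adj)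
qed

lemma lin_aut_in_verts: assumes L: "chi (mdet L) = 1" and u: "u \<in> pverts G"
  shows "lin_aut L u \<in> pverts G"
  using vert_cases[OF u] lin_aut_f[OF L] nz_act[OF L] f_in_verts by metis

lemma lin_aut_carrier: assumes L: "chi (mdet L) = 1"
  shows "lin_aut L \<in> carrier (aut_group G)"
proof -
  have L': "chi (mdet (adj L)) = 1" using L by simp
  have "bij_betw (lin_aut L) (pverts G) (pverts G)"
    by (rule bij_betw_byWitness[where f' = "lin_aut (adj L)"])
      (use lin_aut_adj[OF L] lin_aut_in_verts[OF L] lin_aut_in_verts[OF L'] in auto)
  then have "lin_aut L \<in> Bij (pverts G)" by (simp add: Bij_def lin_aut_def)
  moreover have "(lin_aut L u, lin_aut L v) \<in> parcs G \<longleftrightarrow> (u, v) \<in> parcs G"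
    if uv: "u \<in> pverts G" "v \<in> pverts G" for u v
  proof -
    obtain x y where xy: "nz x" "nz y" "u = f x" "v = f y" using uv by (metis vert_cases)
    then have "(lin_aut L u, lin_aut L v) \<in> parcs G \<longleftrightarrow> chi (vdet (act L x) (act L y)) = 1"
      using adj_iff nz_act[OF L] lin_aut_f[OF L] by simp
    then show ?thesis using adj_iff xy L by (simp add: vdet_act chi_mult)
  qed
  ultimately show ?thesis unfolding carrier_aut_group by blast
qed

text \<open>The map is induced by \<open>L'\<close> times the adjugate of \<open>L\<close>; the
  surplus factor \<open>mdet L\<close> is a square and disappears in the classes.\<close>

lemma lin_aut_map:
  assumes L: "chi (mdet L) = 1" and L': "chi (mdet L') = 1"
  obtains h where "h \<in> carrier (aut_group G)" "\<And>e. nz e \<Longrightarrow> h (f (act L e)) = f (act L' e)"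
proof
  let ?M = "mmul L' (adj L)"
  have M: "chi (mdet ?M) = 1" using L L' by (simp add: mdet_mmul chi_mult)
  show "lin_aut ?M \<in> carrier (aut_group G)" by (rule lin_aut_carrier[OF M])
  fix e assume e: "nz e"
  have n: "nz (smul (mdet L) e)" using e nz_smul[OF chi_1_not_0(1)[OF L]] by simp
  have "lin_aut ?M (f (act L e)) = f (act L' (smul (mdet L) e))"
    using lin_aut_f[OF M] nz_act[OF L e] by (simp add: act_mmul act_adj)
  also have "\<dots> = f (act L' e)"
    using f_eq_iff[OF nz_act[OF L' n] nz_act[OF L' e]] act_sim[OF sim_sym[OF sim_smul[OF L, of e]]] by blast
  finally show "lin_aut ?M (f (act L e)) = f (act L' e)" .
qed

text \<open>Only 2-geodesics need a matrix: a single arc is first prolonged to one, and the end of a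
  3-geodesic is the antipode of its start. All geodesics of one length become images of the same
  list.\<close>

lemma standard_geodesic:
  assumes g: "geodesic G i xs" and i: "i = 1 \<or> i = 2 \<or> i = 3"
  obtains L where "chi (mdet L) = 1"
    "xs = map (\<lambda>e. f (act L e)) (take (Suc i) [(1, 0), (0, 1), (1, mu), smul nu (1, 0)])"
proof -
  have w: "set xs \<subseteq> pverts G" "set (vwalk_arcs xs) \<subseteq> parcs G" "length xs = Suc i"
    and d: "gdist G (hd xs) (last xs) = ereal (real i)"
    using g i unfolding geodesic_def vwalk_def by auto
  obtain x0 x1 xs' where xs: "xs = x0 # x1 # xs'" using w(3) i by (auto simp: length_Suc_conv numeral_2_eq_2 numeral_3_eq_3)
  obtain u v where uv: "nz u" "nz v" "x0 = f u" "x1 = f v" using w(1) xs by (metis list.set_intros subsetD vert_cases)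
  have cuv: "chi (vdet u v) = 1" using w(2) xs adj_iff uv by simp
  have n01: "nz (0, 1)" "nz (1, mu)" using one_not_eqv_0 by (simp_all add: nz_def)
  have std: "f (act L e) = f z" if "chi (mdet L) = 1" "nz e" "nz z" "sim (act L e) z" for L e z
    using that f_eq_iff nz_act by blast
  consider "i = 1" | "i = 2" | "i = 3" using i by blast
  then show ?thesis
  proof cases
    case 1
    \<comment> \<open>The vector \<open>u + nu * v\<close> prolongs the arc: its determinants with
      \<open>v\<close> and \<open>u\<close> have characters 1 and - 1.\<close>
    define w0 where "w0 = (fst u + nu * fst v, snd u + nu * snd v)"
    have "vdet v w0 = - vdet u v" "vdet u w0 = nu * vdet u v"
      by (simp_all add: w0_def vdet_def algebra_simps)
    then have "chi (vdet v w0) = 1" "chi (vdet u w0) = - 1" by (simp_all add: cuv chi_mult)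
    from standard_triple[OF cuv this] obtain L where L: "chi (mdet L) = 1" "sim (act L (1, 0)) u" "sim (act L (0, 1)) v" .
    have "xs = [f u, f v]" using w(3) 1 xs uv by simp
    then show ?thesis using that[OF L(1)] 1 std[OF L(1) nz_10 uv(1) L(2)] std[OF L(1) n01(1) uv(2) L(3)] by simp
  next
    case 2
    then obtain x2 where x2: "xs = [x0, x1, x2]" using w(3) xs by (auto simp: length_Suc_conv)
    obtain z where z: "nz z" "x2 = f z" using w(1) x2 vert_cases by auto
    have "chi (vdet v z) = 1" using w(2) x2 adj_iff uv z by simp
    moreover have "chi (vdet u z) = - 1" using d 2 x2 gdist_2_iff[OF uv(1) z(1)] uv z by simp
    ultimately obtain L where L: "chi (mdet L) = 1" "sim (act L (1, 0)) u" "sim (act L (0, 1)) v" "sim (act L (1, mu)) z"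
      using standard_triple[OF cuv] by metis
    have "xs = [f u, f v, f z]" using x2 uv z by simp
    then show ?thesis using that[OF L(1)] 2 std[OF L(1) nz_10 uv(1) L(2)] std[OF L(1) n01(1) uv(2) L(3)]
        std[OF L(1) n01(2) z(1) L(4)] by simp
  next
    case 3
    then obtain x2 x3 where x2: "xs = [x0, x1, x2, x3]" using w(3) xs by (auto simp: length_Suc_conv numeral_3_eq_3)
    obtain z t where z: "nz z" "x2 = f z" "nz t" "x3 = f t" using w(1) x2 by (metis list.set_intros subsetD vert_cases)
    have cvz: "chi (vdet v z) = 1" and czt: "chi (vdet z t) = 1" using w(2) x2 adj_iff uv z by simp_all
    have ut: "sim (smul nu u) t" using d 3 x2 gdist_3_iff[OF uv(1) z(3)] uv z by simp
    \<comment> \<open>Since \<open>t\<close> is the antipode of \<open>u\<close>, adjacency of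
      \<open>z\<close> and \<open>t\<close> says that \<open>vdet u z\<close> is a
      nonresidue.\<close>
    from chi_vdet_sim_right[OF ut, of z] czt have "chi (vdet u z) = - 1"
      using chi_vdet_swap[of z u] by (simp add: vdet_smul chi_mult)
    with cvz obtain L where L: "chi (mdet L) = 1" "sim (act L (1, 0)) u" "sim (act L (0, 1)) v" "sim (act L (1, mu)) z"
      using standard_triple[OF cuv] by metis
    have "sim (act L (smul nu (1, 0))) t"
      unfolding act_smul using sim_trans[OF sim_smul_cong[OF L(2)] ut] .
    then have "f (act L (smul nu (1, 0))) = f t" using std[OF L(1) _ z(3)] nz_10 by simp
    moreover have "xs = [f u, f v, f z, f t]" using x2 uv z by simp
    ultimately show ?thesis using that[OF L(1)] 3 std[OF L(1) nz_10 uv(1) L(2)] std[OF L(1) n01(1) uv(2) L(3)]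
        std[OF L(1) n01(2) z(1) L(4)] by (simp add: numeral_3_eq_3)
  qed
qed

lemma geodesic_transitive_G: "geodesic_transitive G"
  unfolding geodesic_transitive_def
proof (intro allI impI)
  fix i xs ys assume i: "1 \<le> i \<and> ereal (real i) \<le> gdiam G" and g: "geodesic G i xs \<and> geodesic G i ys"
  then have i': "i = 1 \<or> i = 2 \<or> i = 3" unfolding gdiam_eq by auto
  let ?es = "take (Suc i) [(1, 0), (0, 1), (1, mu), smul nu (1, 0)]"
  obtain L where L: "chi (mdet L) = 1" "xs = map (\<lambda>e. f (act L e)) ?es" using standard_geodesic i' g by metis
  obtain L' where L': "chi (mdet L') = 1" "ys = map (\<lambda>e. f (act L' e)) ?es" using standard_geodesic i' g by metis
  obtain h where h: "h \<in> carrier (aut_group G)" "\<And>e. nz e \<Longrightarrow> h (f (act L e)) = f (act L' e)"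
    using lin_aut_map[OF L(1) L'(1)] by metis
  have "nz e" if "e \<in> set ?es" for e
    using that set_take_subset[of "Suc i" "[(1, 0), (0, 1), (1, mu), smul nu (1, 0)]"] one_not_eqv_0 nz_10
    by (auto simp: nz_def[of "(0, 1)"] nz_def[of "(1, mu)"])
  then have "map h xs = ys" unfolding L(2) L'(2) using h(2) by simp
  then show "\<exists>f\<in>carrier (aut_group G). map f xs = ys" using h(1) by blast
qed

end

section \<open>The group PSL(2,p)\<close>

lemma carrier_PSL2_eq_image: "carrier (PSL2 p) = (\<lambda>x. {(\<one>\<^bsub>residue_ring (int p)\<^esub>, \<zero>\<^bsub>residue_ring (int p)\<^esub>, \<zero>\<^bsub>residue_ring (int p)\<^esub>, \<one>\<^bsub>residue_ring (int p)\<^esub>),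
     (\<ominus>\<^bsub>residue_ring (int p)\<^esub> \<one>\<^bsub>residue_ring (int p)\<^esub>, \<zero>\<^bsub>residue_ring (int p)\<^esub>, \<zero>\<^bsub>residue_ring (int p)\<^esub>, \<ominus>\<^bsub>residue_ring (int p)\<^esub> \<one>\<^bsub>residue_ring (int p)\<^esub>)}
       #>\<^bsub>SL2 (residue_ring (int p))\<^esub> x) ` carrier (SL2 (residue_ring (int p)))"
  unfolding PSL2_def Let_def carrier_FactGroup ..

context prime_1_mod_4
begin

definition red :: "int \<times> int \<times> int \<times> int \<Rightarrow> int \<times> int \<times> int \<times> int" where
  "red M = (case M of (a, b, c, d) \<Rightarrow> (a mod int p, b mod int p, c mod int p, d mod int p))"

definition smat :: "int \<Rightarrow> int \<times> int \<times> int \<times> int \<Rightarrow> int \<times> int \<times> int \<times> int" where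
  "smat k M = (case M of (a, b, c, d) \<Rightarrow> (k * a, k * b, k * c, k * d))"

text \<open>The element of \<open>PSL(2,p)\<close> given by an integer matrix, as a coset of \<open>{I, - I}\<close>.\<close>

definition pr :: "int \<times> int \<times> int \<times> int \<Rightarrow> (int \<times> int \<times> int \<times> int) set" where
  "pr M = {red M, red (smat (- 1) M)}"

definition meqv :: "int \<times> int \<times> int \<times> int \<Rightarrow> int \<times> int \<times> int \<times> int \<Rightarrow> bool" (infix "\<asymp>\<^sub>m" 50) where
  "M \<asymp>\<^sub>m N \<longleftrightarrow> red M = red N"

lemma meqv_iff: "(a, b, c, d) \<asymp>\<^sub>m (a', b', c', d') \<longleftrightarrow> a \<asymp> a' \<and> b \<asymp> b' \<and> c \<asymp> c' \<and> d \<asymp> d'"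
  by (simp add: meqv_def red_def cong_def)

lemma meqv_refl [simp]: "M \<asymp>\<^sub>m M" by (simp add: meqv_def)

lemma meqv_sym: "M \<asymp>\<^sub>m N \<Longrightarrow> N \<asymp>\<^sub>m M" by (simp add: meqv_def)

lemma meqv_trans [trans]: "M \<asymp>\<^sub>m N \<Longrightarrow> N \<asymp>\<^sub>m K \<Longrightarrow> M \<asymp>\<^sub>m K" by (simp add: meqv_def)

lemma meqv_smat: "M \<asymp>\<^sub>m N \<Longrightarrow> k \<asymp> l \<Longrightarrow> smat k M \<asymp>\<^sub>m smat l N"
  by (cases M; cases N) (simp add: smat_def meqv_iff cong_mult)

lemma meqv_mmul: "M \<asymp>\<^sub>m M' \<Longrightarrow> N \<asymp>\<^sub>m N' \<Longrightarrow> mmul M N \<asymp>\<^sub>m mmul M' N'"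
  by (cases M; cases N; cases M'; cases N') (auto simp: mmul_def meqv_iff intro!: cong_add cong_mult)

lemma meqv_mdet: "M \<asymp>\<^sub>m N \<Longrightarrow> mdet M \<asymp> mdet N"
  by (cases M; cases N) (auto simp: mdet_def meqv_iff intro!: cong_diff cong_mult)

lemma meqv_act: "M \<asymp>\<^sub>m N \<Longrightarrow> act M v \<asymp>\<^sub>v act N v"
  by (cases M; cases N) (auto simp: act_def veqv_def meqv_iff intro!: cong_add cong_mult)

lemma red_red [simp]: "red (red M) = red M"
  by (simp add: red_def split: prod.splits)

lemma red_meqv: "red M \<asymp>\<^sub>m M" by (simp add: meqv_def)

lemma smat_smat: "smat k (smat l M) = smat (k * l) M"
  by (simp add: smat_def mult.assoc split: prod.splits)

lemma smat_1 [simp]: "smat 1 M = M"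
  by (simp add: smat_def split: prod.splits)

lemma mmul_smat: "mmul (smat k M) N = smat k (mmul M N)" "mmul M (smat k N) = smat k (mmul M N)"
  by (simp_all add: smat_def mmul_def algebra_simps split: prod.splits)

lemma mdet_smat: "mdet (smat k M) = k * k * mdet M"
  by (simp add: smat_def mdet_def algebra_simps split: prod.splits)

lemma act_smat: "act (smat k M) v = smul k (act M v)"
  by (simp add: smat_def act_def smul_def algebra_simps split: prod.splits)

lemma mmul_assoc: "mmul (mmul K M) N = mmul K (mmul M N)"
  by (simp add: mmul_def algebra_simps split: prod.splits)

lemma mmul_1 [simp]: "mmul (1, 0, 0, 1) M = M" "mmul M (1, 0, 0, 1) = M"
  by (simp_all add: mmul_def split: prod.splits)

lemma mdet_1 [simp]: "mdet (1, 0, 0, 1) = 1"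
  by (simp add: mdet_def)

lemma mmul_adj: "mmul (adj M) M = smat (mdet M) (1, 0, 0, 1)" "mmul M (adj M) = smat (mdet M) (1, 0, 0, 1)"
  by (simp_all add: mmul_def adj_def smat_def mdet_def algebra_simps split: prod.splits)

lemma pr_eq_iff: "pr M = pr N \<longleftrightarrow> M \<asymp>\<^sub>m N \<or> M \<asymp>\<^sub>m smat (- 1) N"
proof -
  have "smat (- 1) M \<asymp>\<^sub>m N \<longleftrightarrow> M \<asymp>\<^sub>m smat (- 1) N"
    using meqv_smat[of "smat (- 1) M" N "- 1" "- 1"] meqv_smat[of M "smat (- 1) N" "- 1" "- 1"]
    by (auto simp: smat_smat)
  moreover have "smat (- 1) M \<asymp>\<^sub>m smat (- 1) N \<longleftrightarrow> M \<asymp>\<^sub>m N"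
    using meqv_smat[of "smat (- 1) M" "smat (- 1) N" "- 1" "- 1"] meqv_smat[of M N "- 1" "- 1"]
    by (auto simp: smat_smat)
  ultimately show ?thesis unfolding pr_def meqv_def by auto
qed

lemma pr_smat_minus [simp]: "pr (smat (- 1) M) = pr M"
  by (simp add: pr_eq_iff)

lemma pr_red [simp]: "pr (red M) = pr M"
  by (simp add: pr_eq_iff red_meqv)

lemma residues_p: "residues (int p)"
  using p_ge_5 by unfold_locales simp

lemma carrier_SL2: "carrier (SL2 (residue_ring (int p))) = {M. red M = M \<and> mdet M \<asymp> 1}"
proof -
  interpret residues "int p" "residue_ring (int p)" by (rule residues_p) simp
  have "int p > 1" using p_ge_5 by simp
  then have r: "x \<in> carrier (residue_ring (int p)) \<longleftrightarrow> x mod int p = x" for x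
    unfolding res_carrier_eq by (auto simp: mod_pos_pos_trivial) (metis pos_mod_sign pos_mod_bound of_nat_0_less_iff
      p_ge_5 zle_diff1_eq less_le_trans zero_less_numeral)+
  have "a \<otimes>\<^bsub>residue_ring (int p)\<^esub> d \<ominus>\<^bsub>residue_ring (int p)\<^esub> b \<otimes>\<^bsub>residue_ring (int p)\<^esub> c = \<one>\<^bsub>residue_ring (int p)\<^esub>
     \<longleftrightarrow> a * d - b * c \<asymp> 1" for a b c d
    unfolding a_minus_def res_mult_eq res_neg_eq res_add_eq res_one_eq cong_def
    using \<open>int p > 1\<close> by (simp add: mod_simps)
  then show ?thesis by (auto simp: SL2_def red_def mdet_def r split: prod.splits)
qed

lemma mult_SL2: "red M \<otimes>\<^bsub>SL2 (residue_ring (int p))\<^esub> red N = red (mmul M N)"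
proof -
  interpret residues "int p" "residue_ring (int p)" by (rule residues_p) simp
  show ?thesis
    by (cases M; cases N) (auto simp: SL2_def red_def mmul_def res_mult_eq res_add_eq mod_simps
        simp flip: cong_def intro!: cong_add cong_mult)
qed

lemma red_SL2: "mdet M \<asymp> 1 \<Longrightarrow> red M \<in> carrier (SL2 (residue_ring (int p)))"
  unfolding carrier_SL2 using meqv_mdet[OF red_meqv, of M] cong_trans by auto

lemma coset_SL2: "{(\<one>\<^bsub>residue_ring (int p)\<^esub>, \<zero>\<^bsub>residue_ring (int p)\<^esub>, \<zero>\<^bsub>residue_ring (int p)\<^esub>, \<one>\<^bsub>residue_ring (int p)\<^esub>),
     (\<ominus>\<^bsub>residue_ring (int p)\<^esub> \<one>\<^bsub>residue_ring (int p)\<^esub>, \<zero>\<^bsub>residue_ring (int p)\<^esub>, \<zero>\<^bsub>residue_ring (int p)\<^esub>, \<ominus>\<^bsub>residue_ring (int p)\<^esub> \<one>\<^bsub>residue_ring (int p)\<^esub>)}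
     = pr (1, 0, 0, 1)"
proof -
  interpret residues "int p" "residue_ring (int p)" by (rule residues_p) simp
  show ?thesis
    using p_ge_5 by (simp add: pr_def red_def smat_def res_neg_eq res_one_eq res_zero_eq)
qed

text \<open>Group elements may thus be given by any integer matrix of determinant 1 modulo
  \<open>p\<close>, with unreduced entries.\<close>

lemma carrier_PSL2: "carrier (PSL2 p) = pr ` {M. mdet M \<asymp> 1}"
proof -
  have "pr (1, 0, 0, 1) #>\<^bsub>SL2 (residue_ring (int p))\<^esub> red M = pr M" for M
    unfolding r_coset_def pr_def by (simp add: mult_SL2 mmul_smat insert_commute)
  then have "(\<lambda>x. pr (1, 0, 0, 1) #>\<^bsub>SL2 (residue_ring (int p))\<^esub> x) ` carrier (SL2 (residue_ring (int p)))
      = pr ` carrier (SL2 (residue_ring (int p)))"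
    by (intro image_cong refl) (metis (mono_tags, lifting) carrier_SL2 mem_Collect_eq)
  also have "\<dots> = pr ` {M. mdet M \<asymp> 1}"
  proof
    show "pr ` {M. mdet M \<asymp> 1} \<subseteq> pr ` carrier (SL2 (residue_ring (int p)))"
    proof (rule image_subsetI)
      fix M assume "M \<in> {M. mdet M \<asymp> 1}"
      then have "red M \<in> carrier (SL2 (residue_ring (int p)))" using red_SL2 by blast
      then show "pr M \<in> pr ` carrier (SL2 (residue_ring (int p)))" using pr_red imageI by metis
    qed
  qed (auto simp: carrier_SL2)
  finally show ?thesis unfolding carrier_PSL2_eq_image coset_SL2 .
qed

lemma pr_in_PSL2: "mdet M \<asymp> 1 \<Longrightarrow> pr M \<in> carrier (PSL2 p)"
  unfolding carrier_PSL2 by blast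

lemma one_PSL2: "\<one>\<^bsub>PSL2 p\<^esub> = pr (1, 0, 0, 1)"
  unfolding coset_SL2[symmetric] by (simp add: PSL2_def Let_def)

lemma mult_PSL2: "pr M \<otimes>\<^bsub>PSL2 p\<^esub> pr N = pr (mmul M N)"
proof -
  have "pr M \<otimes>\<^bsub>PSL2 p\<^esub> pr N = pr M <#>\<^bsub>SL2 (residue_ring (int p))\<^esub> pr N"
    by (simp add: PSL2_def Let_def)
  also have "\<dots> = pr (mmul M N)"
    unfolding set_mult_def pr_def by (auto simp: mult_SL2 mmul_smat smat_smat)
  finally show ?thesis .
qed

lemma group_PSL2: "group (PSL2 p)"
proof (rule groupI)
  fix x y z assume "x \<in> carrier (PSL2 p)" "y \<in> carrier (PSL2 p)" "z \<in> carrier (PSL2 p)"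
  then obtain M N K where M: "mdet M \<asymp> 1" "x = pr M" and N: "mdet N \<asymp> 1" "y = pr N" and K: "z = pr K"
    unfolding carrier_PSL2 by blast
  have "mdet (mmul M N) \<asymp> 1 * 1" unfolding mdet_mmul by (rule cong_mult[OF M(1) N(1)])
  then show "x \<otimes>\<^bsub>PSL2 p\<^esub> y \<in> carrier (PSL2 p)" unfolding M(2) N(2) mult_PSL2 by (intro pr_in_PSL2) simp
  show "x \<otimes>\<^bsub>PSL2 p\<^esub> y \<otimes>\<^bsub>PSL2 p\<^esub> z = x \<otimes>\<^bsub>PSL2 p\<^esub> (y \<otimes>\<^bsub>PSL2 p\<^esub> z)"
    unfolding M(2) N(2) K mult_PSL2 mmul_assoc ..
next
  show "\<one>\<^bsub>PSL2 p\<^esub> \<in> carrier (PSL2 p)" unfolding one_PSL2 by (rule pr_in_PSL2) simp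
next
  fix x assume "x \<in> carrier (PSL2 p)"
  then obtain M where M: "mdet M \<asymp> 1" "x = pr M" unfolding carrier_PSL2 by blast
  show "\<one>\<^bsub>PSL2 p\<^esub> \<otimes>\<^bsub>PSL2 p\<^esub> x = x" unfolding one_PSL2 M(2) mult_PSL2 by simp
  have "pr (adj M) \<otimes>\<^bsub>PSL2 p\<^esub> x = \<one>\<^bsub>PSL2 p\<^esub>"
    unfolding one_PSL2 M(2) mult_PSL2 mmul_adj pr_eq_iff
    using meqv_smat[OF meqv_refl M(1), of "(1, 0, 0, 1)"] by simp
  moreover have "pr (adj M) \<in> carrier (PSL2 p)" using M by (intro pr_in_PSL2) simp
  ultimately show "\<exists>y\<in>carrier (PSL2 p). y \<otimes>\<^bsub>PSL2 p\<^esub> x = \<one>\<^bsub>PSL2 p\<^esub>" by blast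
qed

lemma inv_PSL2: assumes "mdet M \<asymp> 1" shows "inv\<^bsub>PSL2 p\<^esub> (pr M) = pr (adj M)"
proof (rule group.inv_equality[OF group_PSL2])
  show "pr (adj M) \<otimes>\<^bsub>PSL2 p\<^esub> pr M = \<one>\<^bsub>PSL2 p\<^esub>"
    unfolding one_PSL2 mult_PSL2 mmul_adj pr_eq_iff
    using meqv_smat[OF meqv_refl assms, of "(1, 0, 0, 1)"] by simp
qed (use assms in \<open>simp_all add: pr_in_PSL2\<close>)

lemma finite_PSL2: "finite (carrier (PSL2 p))"
proof -
  have "carrier (PSL2 p) \<subseteq> Pow ({0..<int p} \<times> {0..<int p} \<times> {0..<int p} \<times> {0..<int p})"
    using p_ge_5 by (auto simp: carrier_PSL2 pr_def red_def split: prod.splits)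
  then show ?thesis by (rule finite_subset) simp
qed

lemma PSL2_cases: assumes "x \<in> carrier (PSL2 p)" obtains M where "mdet M \<asymp> 1" "x = pr M"
  using assms unfolding carrier_PSL2 by blast

end

section \<open>The automorphism group\<close>

context prime_1_mod_4
begin

lemma sim_10: "sim (1, 0) w \<longleftrightarrow> chi (fst w) = 1 \<and> snd w \<asymp> 0"
proof
  assume "sim (1, 0) w"
  then obtain k where "chi k = 1" "fst w \<asymp> k" "snd w \<asymp> 0" by (auto simp: sim_def veqv_def smul_def)
  then show "chi (fst w) = 1 \<and> snd w \<asymp> 0" using chi_cong by metis
next
  assume "chi (fst w) = 1 \<and> snd w \<asymp> 0"
  then show "sim (1, 0) w" unfolding sim_def by (intro exI[of _ "fst w"]) (simp add: veqv_def smul_def)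
qed

text \<open>The quotient \<open>K\<close> of the two matrices, formed with the adjugate, has every
  vector as an eigenvector. The vectors \<open>(1, 0)\<close>, \<open>(0, 1)\<close> and
  \<open>(1, 1)\<close> force it to be scalar, and \<open>(1, 0)\<close> shows that the scalar is a
  square.\<close>

lemma lin_sim_imp_scalar:
  assumes L: "chi (mdet L) = 1" and L': "chi (mdet L') = 1"
    and s: "\<And>v. nz v \<Longrightarrow> sim (act L v) (act L' v)"
  obtains x where "chi x = 1" "L' \<asymp>\<^sub>m smat x L"
proof -
  define K where "K = mmul (adj L) L'"
  define D where "D = mdet L"
  have sK: "sim v (act K v)" if "nz v" for v
  proof -
    have "sim (act (adj L) (act L v)) (act (adj L) (act L' v))" by (rule act_sim[OF s[OF that]])
    then have "sim (smul D v) (act K v)" by (simp add: act_adj K_def act_mmul D_def)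
    moreover have "sim v (smul D v)" using sim_smul L D_def by blast
    ultimately show ?thesis using sim_trans by blast
  qed
  obtain a b c d where K: "K = (a, b, c, d)" by (cases K)
  have n: "nz (1, 0)" "nz (0, 1)" "nz (1, 1)" using one_not_eqv_0 by (simp_all add: nz_def)
  have 1: "chi a = 1" "c \<asymp> 0" using sK[OF n(1)] unfolding sim_10 by (simp_all add: K act_def)
  have 2: "b \<asymp> 0" using sim_vdet[OF sK[OF n(2)]] by (simp add: K act_def vdet_def cong_0_iff)
  have "c + d - (a + b) \<asymp> 0" using sim_vdet[OF sK[OF n(3)]] by (simp add: K act_def vdet_def)
  then have 3: "d \<asymp> a" using 1(2) 2 by Groebner_Basis.algebra
  have K': "K \<asymp>\<^sub>m smat a (1, 0, 0, 1)" using 1 2 3 by (simp add: K smat_def meqv_iff)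
  have "smat D L' = mmul L K" by (simp add: K_def D_def mmul_assoc[symmetric] mmul_adj mmul_smat)
  moreover have "mmul L K \<asymp>\<^sub>m smat a L"
    using meqv_mmul[OF meqv_refl K', of L] by (simp add: mmul_smat)
  ultimately have e: "smat D L' \<asymp>\<^sub>m smat a L" by simp
  obtain E where E: "D * E \<asymp> 1" "\<not> E \<asymp> 0" using ex_inverse chi_1_not_0(1) L D_def by metis
  have "L' \<asymp>\<^sub>m smat (E * D) L'" using meqv_smat[OF meqv_refl, of "E * D" 1 L'] E(1) meqv_sym
    by (simp add: mult.commute)
  also have "smat (E * D) L' \<asymp>\<^sub>m smat (E * a) L"
    using meqv_smat[OF e cong_refl, of E] by (simp add: smat_smat)
  finally have "L' \<asymp>\<^sub>m smat (E * a) L" .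
  moreover have "chi (E * a) = 1" using 1(1) chi_inverse[OF E(1)] L D_def by (simp add: chi_mult)
  ultimately show ?thesis using that by blast
qed

lemma square_eqv_1: assumes "x * x \<asymp> 1" shows "x \<asymp> 1 \<or> x \<asymp> - 1"
proof -
  have "(x - 1) * (x + 1) \<asymp> 0" using assms by Groebner_Basis.algebra
  then show ?thesis unfolding mult_eqv_0_iff by (auto simp: cong_iff_dvd_diff)
qed

end

context vector_graph
begin

lemma lin_aut_eq_iff: assumes L: "chi (mdet L) = 1" and L': "chi (mdet L') = 1"
  shows "lin_aut L = lin_aut L' \<longleftrightarrow> (\<forall>v. nz v \<longrightarrow> sim (act L v) (act L' v))"
proof
  assume e: "lin_aut L = lin_aut L'"
  show "\<forall>v. nz v \<longrightarrow> sim (act L v) (act L' v)"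
  proof (intro allI impI)
    fix v assume v: "nz v"
    then have "f (act L v) = f (act L' v)" using e lin_aut_f[OF L v] lin_aut_f[OF L' v] by simp
    then show "sim (act L v) (act L' v)" using f_eq_iff[OF nz_act[OF L v] nz_act[OF L' v]] by simp
  qed
next
  assume s: "\<forall>v. nz v \<longrightarrow> sim (act L v) (act L' v)"
  show "lin_aut L = lin_aut L'"
  proof
    fix u
    show "lin_aut L u = lin_aut L' u"
    proof (cases "u \<in> pverts G")
      case True
      then obtain v where v: "nz v" "u = f v" by (rule vert_cases)
      then show ?thesis
        using s[rule_format, OF v(1)] f_eq_iff[OF nz_act[OF L v(1)] nz_act[OF L' v(1)]] lin_aut_f[OF L v(1)] lin_aut_f[OF L' v(1)] by simp
    qed (simp add: lin_aut_def)
  qed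
qed

lemma lin_aut_cong: assumes L: "chi (mdet L) = 1" and k: "chi k = 1" and L': "L' \<asymp>\<^sub>m smat k L"
  shows "lin_aut L' = lin_aut L"
proof -
  have "chi (mdet L') = 1" using chi_cong[OF meqv_mdet[OF L']] L k by (simp add: mdet_smat chi_mult)
  moreover have "sim (act L v) (act L' v)" for v
  proof -
    have "act L' v \<asymp>\<^sub>v smul k (act L v)" using meqv_act[OF L', of v] by (simp add: act_smat)
    then show ?thesis using sim_trans[OF sim_smul[OF k] sim_veqv[OF veqv_sym]] by blast
  qed
  ultimately show ?thesis using lin_aut_eq_iff[OF L] by metis
qed

lemma mult_lin_aut: assumes L: "chi (mdet L) = 1" and L': "chi (mdet L') = 1"
  shows "lin_aut L \<otimes>\<^bsub>aut_group G\<^esub> lin_aut L' = lin_aut (mmul L L')"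
proof -
  have B: "lin_aut L \<in> Bij (pverts G)" "lin_aut L' \<in> Bij (pverts G)"
    using lin_aut_carrier[OF L] lin_aut_carrier[OF L'] unfolding carrier_aut_group by auto
  have M: "chi (mdet (mmul L L')) = 1" using L L' by (simp add: mdet_mmul chi_mult)
  have "compose (pverts G) (lin_aut L) (lin_aut L') u = lin_aut (mmul L L') u" for u
  proof (cases "u \<in> pverts G")
    case True
    then obtain v where v: "nz v" "u = f v" by (rule vert_cases)
    then show ?thesis using True lin_aut_f[OF L' v(1)] lin_aut_f[OF L nz_act[OF L' v(1)]] lin_aut_f[OF M v(1)]
      by (simp add: compose_def act_mmul)
  qed (simp add: lin_aut_def compose_def)
  then have "compose (pverts G) (lin_aut L) (lin_aut L') = lin_aut (mmul L L')" by blast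
  then show ?thesis using B by (simp add: aut_group_def BijGroup_def)
qed

text \<open>The antipode is the only vertex not reached by a walk of length 2, and automorphisms
  preserve this property.\<close>

lemma aut_antipode:
  assumes h: "h \<in> carrier (aut_group G)" and v: "nz v" and w: "nz w" "h (f v) = f w"
  shows "h (f (smul nu v)) = f (smul nu w)"
proof -
  have hB: "bij_betw h (pverts G) (pverts G)"
    and ha: "\<And>x y. x \<in> pverts G \<Longrightarrow> y \<in> pverts G \<Longrightarrow> (h x, h y) \<in> parcs G \<longleftrightarrow> (x, y) \<in> parcs G"
    using h unfolding carrier_aut_group Bij_def by auto
  have nv: "nz (smul nu v)" using v by simp
  have "h (f (smul nu v)) \<in> pverts G" using hB f_in_verts[OF nv] by (auto simp: bij_betw_def)
  then obtain z where z: "nz z" "h (f (smul nu v)) = f z" by (rule vert_cases)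
  have "(f w, f z) \<notin> parcs G ^^ 2"
  proof
    assume "(f w, f z) \<in> parcs G ^^ 2"
    then obtain y where y: "(f w, y) \<in> parcs G" "(y, f z) \<in> parcs G" unfolding relpow_2_iff by blast
    have "y \<in> h ` pverts G" using y(1) arcs_in_verts hB by (auto simp: bij_betw_def)
    then obtain x where x: "x \<in> pverts G" "y = h x" by blast
    have "(f v, x) \<in> parcs G" "(x, f (smul nu v)) \<in> parcs G"
      using y ha[OF f_in_verts[OF v] x(1)] ha[OF x(1) f_in_verts[OF nv]] unfolding w(2) z(2) x(2) by simp_all
    then have "(f v, f (smul nu v)) \<in> parcs G ^^ 2" unfolding relpow_2_iff by blast
    then show False using relpow_2[OF v nv] by simp
  qed
  then have "sim (smul nu w) z" using relpow_2[OF w(1) z(1)] by blast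
  then show ?thesis using z f_eq_iff[of "smul nu w" z] w(1) by simp
qed

text \<open>The tested vertices meet every fibre once, and antipodes go to antipodes, so they
  determine \<open>h\<close>.\<close>

lemma lin_aut_eqI:
  assumes h: "h \<in> carrier (aut_group G)" and L: "chi (mdet L) = 1"
    and e: "h (f (1, 0)) = f (act L (1, 0))"
    and x: "\<And>x. x \<in> {0..<int p} \<Longrightarrow> h (f (x, 1)) = f (act L (x, 1))"
  shows "h = lin_aut L"
proof
  fix u
  show "h u = lin_aut L u"
  proof (cases "u \<in> pverts G")
    case False
    moreover have "h \<in> extensional (pverts G)" using h unfolding carrier_aut_group Bij_def by auto
    ultimately show ?thesis by (simp add: lin_aut_def extensional_def)
  next
    case True
    then obtain v where v: "nz v" "u = f v" by (rule vert_cases)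
    have "\<exists>z. nz z \<and> vdet z v \<asymp> 0 \<and> h (f z) = f (act L z)"
    proof (cases "snd v \<asymp> 0")
      case True
      then show ?thesis using e nz_10 by (intro exI[of _ "(1, 0)"]) (simp add: vdet_def)
    next
      case False
      then obtain c where c: "snd v * c \<asymp> 1" using ex_inverse by blast
      define x where "x = fst v * c mod int p"
      have xx: "x \<asymp> fst v * c" "x \<in> {0..<int p}" using p_ge_5 by (simp_all add: x_def)
      have "x * snd v - fst v \<asymp> 0" using xx(1) c by Groebner_Basis.algebra
      moreover have "nz (x, 1)" using one_not_eqv_0 by (simp add: nz_def)
      ultimately show ?thesis using assms(4)[OF xx(2)] by (intro exI[of _ "(x, 1)"]) (simp add: vdet_def)
    qed
    then obtain z where z: "nz z" "vdet z v \<asymp> 0" "h (f z) = f (act L z)" by blast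
    have "h (f (smul nu z)) = f (act L (smul nu z))"
      using aut_antipode[OF h z(1) nz_act[OF L z(1)] z(3)] by (simp add: act_smul)
    moreover have "f v = f z \<or> f v = f (smul nu z)"
      using parallel_cases[OF z(1) v(1) z(2)] f_eq_iff[OF z(1) v(1)] f_eq_iff[of "smul nu z" v] z(1) v(1) by auto
    ultimately have "h u = f (act L v)"
      using z v(2) lin_aut_f[OF L] v(1) by (metis nz_nu)
    then show ?thesis using lin_aut_f[OF L v(1)] v(2) by simp
  qed
qed

text \<open>The neighbours of \<open>(1, 0)\<close> are the classes of \<open>(x, 1)\<close>, and
  \<open>vdet (x, 1) (y, 1) = x - y\<close>, so \<open>h\<close> permutes them preserving
  \<open>chi\<close> of differences. Carlitz' theorem makes this permutation affine, with a slope
  \<open>a\<close> of character 1, and it is then induced by \<open>(a, b, 0, 1)\<close>.\<close>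

lemma aut_stabilizer_linear:
  assumes h: "h \<in> carrier (aut_group G)" and e: "h (f (1, 0)) = f (1, 0)"
  obtains L where "chi (mdet L) = 1" "h = lin_aut L"
proof -
  let ?R = "{0..<int p}"
  have hB: "bij_betw h (pverts G) (pverts G)"
    and ha: "\<And>x y. x \<in> pverts G \<Longrightarrow> y \<in> pverts G \<Longrightarrow> (h x, h y) \<in> parcs G \<longleftrightarrow> (x, y) \<in> parcs G"
    using h unfolding carrier_aut_group Bij_def by auto
  have nx: "nz (x, 1)" for x using one_not_eqv_0 by (simp add: nz_def)
  have "\<exists>y\<in>?R. h (f (x, 1)) = f (y, 1)" if x: "x \<in> ?R" for x
  proof -
    have "(f (1, 0), f (x, 1)) \<in> parcs G" using adj_iff[OF nz_10 nx] by (simp add: vdet_def)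
    then have 1: "(f (1, 0), h (f (x, 1))) \<in> parcs G" using ha[OF f_in_verts[OF nz_10] f_in_verts[OF nx]] e by simp
    then have "h (f (x, 1)) \<in> pverts G" using arcs_in_verts by blast
    then obtain w where w: "nz w" "h (f (x, 1)) = f w" by (rule vert_cases)
    have c: "chi (snd w) = 1" using 1 adj_iff[OF nz_10 w(1)] w(2) by (simp add: vdet_def)
    obtain k where k: "snd w * k \<asymp> 1" "\<not> k \<asymp> 0" using ex_inverse[OF chi_1_not_0(1)[OF c]] .
    define y where "y = k * fst w mod int p"
    have y: "y \<asymp> k * fst w" "y \<in> ?R" using p_ge_5 by (simp_all add: y_def)
    have "(y, 1) \<asymp>\<^sub>v smul k w" using y(1) k(1) by (simp add: veqv_def smul_def cong_sym mult.commute)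
    then have "sim w (y, 1)" unfolding sim_def using chi_inverse[OF k(1)] c by metis
    then show ?thesis using y(2) w f_eq_iff[OF w(1) nx] by metis
  qed
  then obtain g where g: "\<And>x. x \<in> ?R \<Longrightarrow> g x \<in> ?R" "\<And>x. x \<in> ?R \<Longrightarrow> h (f (x, 1)) = f (g x, 1)" by metis
  have d: "vdet (x, 1) (y, 1) = x - y" for x y by (simp add: vdet_def)
  have inj: "inj_on g ?R"
  proof (rule inj_onI)
    fix x y assume xy: "x \<in> ?R" "y \<in> ?R" "g x = g y"
    then have "h (f (x, 1)) = h (f (y, 1))" using g(2) by metis
    then have "f (x, 1) = f (y, 1)" using hB f_in_verts[OF nx] unfolding bij_betw_def inj_on_def by blast
    then have "vdet (x, 1) (y, 1) \<asymp> 0" using f_eq_iff[OF nx nx] sim_vdet by blast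
    then show "x = y" using eqv_small[OF _ xy(1,2)] unfolding d by (simp add: cong_iff_dvd_diff)
  qed
  then have img: "g ` ?R = ?R" using g(1) by (intro endo_inj_surj) auto
  have chig: "chi (g x - g y) = chi (x - y)" if xy: "x \<in> ?R" "y \<in> ?R" for x y
  proof (cases "x = y")
    case False
    have "\<not> x - y \<asymp> 0" using eqv_small[OF _ xy] False by (auto simp: cong_iff_dvd_diff)
    moreover have "g x \<noteq> g y" using inj xy False by (meson inj_onD)
    then have "\<not> g x - g y \<asymp> 0" using eqv_small[OF _ g(1)[OF xy(1)] g(1)[OF xy(2)]] by (auto simp: cong_iff_dvd_diff)
    \<comment> \<open>Adjacency detects only the value 1; the value 0 is excluded because
      \<open>g\<close> is injective, and so - 1 is preserved as well.\<close>
    moreover have "chi (g x - g y) = 1 \<longleftrightarrow> chi (x - y) = 1"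
      using ha[OF f_in_verts[OF nx] f_in_verts[OF nx], of x y] adj_iff[OF nx nx, of "g x" "g y"]
        adj_iff[OF nx nx, of x y] g(2)[OF xy(1)] g(2)[OF xy(2)] unfolding d by simp
    ultimately show ?thesis using chi_cases'[of "x - y"] chi_cases'[of "g x - g y"] by auto
  qed simp
  obtain a b where ab: "\<And>x. x \<in> ?R \<Longrightarrow> g x \<asymp> a * x + b"
    using paley_automorphism_affine[OF img chig] by blast
  have 01: "0 \<in> ?R" "1 \<in> ?R" using p_ge_5 by auto
  have "g 1 - g 0 \<asymp> a" using cong_diff[OF ab[OF 01(2)] ab[OF 01(1)]] by simp
  then have ca: "chi a = 1" using chig[OF 01(2) 01(1)] chi_cong by fastforce
  let ?L = "(a, b, 0, 1)"
  have L: "chi (mdet ?L) = 1" using ca by (simp add: mdet_def)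
  have "h = lin_aut ?L"
  proof (rule lin_aut_eqI[OF h L])
    have "sim (1, 0) (a, 0)" unfolding sim_10 using ca by simp
    then show "h (f (1, 0)) = f (act ?L (1, 0))"
      using e f_eq_iff[OF nz_10 nz_act[OF L nz_10]] by (simp add: act_def)
    fix x assume x: "x \<in> ?R"
    have "(g x, 1) \<asymp>\<^sub>v act ?L (x, 1)" using ab[OF x] by (simp add: act_def veqv_def)
    then show "h (f (x, 1)) = f (act ?L (x, 1))"
      using g(2)[OF x] f_eq_iff[OF nx nz_act[OF L nx]] sim_veqv by metis
  qed
  then show ?thesis using that L by blast
qed

lemma aut_linear: assumes h: "h \<in> carrier (aut_group G)"
  obtains L where "chi (mdet L) = 1" "h = lin_aut L"
proof -
  have hB: "bij_betw h (pverts G) (pverts G)" and hBij: "h \<in> Bij (pverts G)"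
    and ha: "\<And>x y. x \<in> pverts G \<Longrightarrow> y \<in> pverts G \<Longrightarrow> (h x, h y) \<in> parcs G \<longleftrightarrow> (x, y) \<in> parcs G"
    using h unfolding carrier_aut_group Bij_def by auto
  have "h (f (1, 0)) \<in> pverts G" using hB f_in_verts[OF nz_10] by (auto simp: bij_betw_def)
  then obtain u where u: "nz u" "h (f (1, 0)) = f u" by (rule vert_cases)
  obtain w where w: "vdet u w \<asymp> 1" using ex_vdet_1[OF u(1)] .
  \<comment> \<open>A matrix of determinant 1 modulo \<open>p\<close> with first column
    \<open>u\<close>; undoing it after \<open>h\<close> reduces to the stabilizer of
    \<open>(1, 0)\<close>.\<close>
  define L0 where "L0 = (fst u, fst w, snd u, snd w)"
  have "mdet L0 = vdet u w" by (simp add: L0_def mdet_def vdet_def algebra_simps)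
  then have L0: "chi (mdet L0) = 1" using w chi_cong chi_1 by metis
  have a0: "act L0 (1, 0) = u" by (simp add: L0_def act_def)
  have L0': "chi (mdet (adj L0)) = 1" using L0 by simp
  have cB: "lin_aut (adj L0) \<in> Bij (pverts G)" using lin_aut_carrier[OF L0'] unfolding carrier_aut_group by auto
  define h' where "h' = compose (pverts G) (lin_aut (adj L0)) h"
  have hv: "h x \<in> pverts G" if "x \<in> pverts G" for x using that hB by (auto simp: bij_betw_def)
  have "h' \<in> Bij (pverts G)" unfolding h'_def using cB hBij by (rule compose_Bij)
  moreover have "(h' x, h' y) \<in> parcs G \<longleftrightarrow> (x, y) \<in> parcs G" if "x \<in> pverts G" "y \<in> pverts G" for x y
    using that ha hv lin_aut_carrier[OF L0'] unfolding carrier_aut_group by (simp add: h'_def compose_def)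
  ultimately have h': "h' \<in> carrier (aut_group G)" unfolding carrier_aut_group by blast
  have "lin_aut (adj L0) (lin_aut L0 (f (1, 0))) = f (1, 0)"
    by (rule lin_aut_adj(1)[OF L0 f_in_verts[OF nz_10]])
  then have "h' (f (1, 0)) = f (1, 0)"
    using u lin_aut_f[OF L0 nz_10] f_in_verts[OF nz_10] by (simp add: h'_def compose_def a0)
  from aut_stabilizer_linear[OF h' this] obtain L1 where L1: "chi (mdet L1) = 1" "h' = lin_aut L1" .
  have M: "chi (mdet (mmul L0 L1)) = 1" using L0 L1(1) by (simp add: mdet_mmul chi_mult)
  have eq: "h x = f (act (mmul L0 L1) v)" if x: "x = f v" "nz v" for x v
  proof -
    have xv: "x \<in> pverts G" using x f_in_verts by blast
    have "h x = lin_aut L0 (lin_aut (adj L0) (h x))" using lin_aut_adj(2)[OF L0 hv[OF xv]] by simp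
    also have "\<dots> = lin_aut L0 (h' x)" using xv by (simp add: h'_def compose_def)
    also have "\<dots> = f (act (mmul L0 L1) v)"
      unfolding L1(2) x(1) lin_aut_f[OF L1(1) x(2)] lin_aut_f[OF L0 nz_act[OF L1(1) x(2)]] act_mmul ..
    finally show ?thesis .
  qed
  have "h = lin_aut (mmul L0 L1)"
    by (rule lin_aut_eqI[OF h M]) (use eq nz_10 one_not_eqv_0 in \<open>auto simp: nz_def\<close>)
  then show ?thesis using that M by blast
qed

text \<open>The cyclic factor is generated by multiplication with \<open>nu\<close>, the antipodal
  map. Either representative of the coset gives the same map, since - 1 is a square.\<close>

definition aut_of :: "(int \<times> int \<times> int \<times> int) set \<times> int \<Rightarrow> 'a \<Rightarrow> 'a" where
  "aut_of x = lin_aut (smat (if snd x = 0 then 1 else nu) (SOME M. mdet M \<asymp> 1 \<and> fst x = pr M))"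

lemma chi_mdet_smat_nu: "mdet M \<asymp> 1 \<Longrightarrow> chi (mdet (smat (if e = 0 then 1 else nu) M)) = 1"
  using chi_cong[of "mdet M" 1] by (simp add: mdet_smat chi_mult)

lemma aut_of_pr: assumes M: "mdet M \<asymp> 1"
  shows "aut_of (pr M, e) = lin_aut (smat (if e = 0 then 1 else nu) M)"
proof -
  define N where "N = (SOME N. mdet N \<asymp> 1 \<and> pr M = pr N)"
  have N: "mdet N \<asymp> 1 \<and> pr M = pr N" unfolding N_def by (rule someI[of _ M]) (use M in simp)
  let ?k = "if e = 0 then 1 else nu"
  have "N \<asymp>\<^sub>m smat 1 M \<or> N \<asymp>\<^sub>m smat (- 1) M" using N pr_eq_iff[of N M] by auto
  then obtain s where s: "chi s = 1" "N \<asymp>\<^sub>m smat s M" by (metis chi_1 chi_minus_1)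
  have "smat ?k N \<asymp>\<^sub>m smat s (smat ?k M)"
    using meqv_smat[OF s(2) cong_refl, of ?k] by (simp add: smat_smat mult.commute)
  from lin_aut_cong[OF chi_mdet_smat_nu[OF M] s(1) this]
  show ?thesis by (simp add: aut_of_def N_def)
qed

lemma aut_of_mult:
  assumes M: "mdet M \<asymp> 1" and N: "mdet N \<asymp> 1" and e: "e \<in> {0, 1}" "e' \<in> {0, 1 :: int}"
  shows "aut_of (pr (mmul M N), (e + e') mod 2) = aut_of (pr M, e) \<otimes>\<^bsub>aut_group G\<^esub> aut_of (pr N, e')"
proof -
  define k where "k e = (if e = 0 then 1 else nu)" for e :: int
  have MN: "mdet (mmul M N) \<asymp> 1" unfolding mdet_mmul using cong_mult[OF M N] by simp
  have c: "chi (mdet (smat (k e) M)) = 1" if "mdet M \<asymp> 1" for e M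
    using chi_mdet_smat_nu[OF that, of e] unfolding k_def .
  have "lin_aut (smat (k e) M) \<otimes>\<^bsub>aut_group G\<^esub> lin_aut (smat (k e') N) = lin_aut (smat (k e * k e') (mmul M N))"
    using mult_lin_aut[OF c[OF M] c[OF N]] by (simp add: mmul_smat smat_smat mult.commute)
  also have "\<dots> = lin_aut (smat (k ((e + e') mod 2)) (mmul M N))"
  proof (cases "e = 1 \<and> e' = 1")
    case True
    \<comment> \<open>The scalar is now \<open>nu * nu\<close>, a square, which acts trivially; this
      matches 1 + 1 = 0 in the cyclic factor.\<close>
    have "chi (mdet (mmul M N)) = 1" using c[OF MN, of 0] by (simp add: k_def)
    from lin_aut_cong[OF this, of "nu * nu"] True show ?thesis by (simp add: k_def chi_mult)
  next
    case False
    then show ?thesis using e by (auto simp: k_def)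
  qed
  finally show ?thesis unfolding aut_of_pr[OF M] aut_of_pr[OF N] aut_of_pr[OF MN] k_def by simp
qed

lemma aut_of_inj:
  assumes M: "mdet M \<asymp> 1" and N: "mdet N \<asymp> 1" and e: "e \<in> {0, 1}" "e' \<in> {0, 1 :: int}"
    and eq: "aut_of (pr M, e) = aut_of (pr N, e')"
  shows "pr M = pr N \<and> e = e'"
proof -
  define k where "k e = (if e = 0 then 1 else nu)" for e :: int
  have c: "chi (mdet (smat (k e) M)) = 1" if "mdet M \<asymp> 1" for e M
    using chi_mdet_smat_nu[OF that, of e] unfolding k_def .
  have "lin_aut (smat (k e) M) = lin_aut (smat (k e') N)"
    using eq unfolding aut_of_pr[OF M] aut_of_pr[OF N] k_def .
  then have "sim (act (smat (k e) M) v) (act (smat (k e') N) v)" if "nz v" for v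
    using lin_aut_eq_iff[OF c[OF M] c[OF N]] that by blast
  from lin_sim_imp_scalar[OF c[OF M] c[OF N] this] obtain x
    where x: "chi x = 1" "smat (k e') N \<asymp>\<^sub>m smat x (smat (k e) M)" by blast
  \<comment> \<open>Comparing determinants gives \<open>k e'\<close> as plus or minus
    \<open>x * k e\<close>. As - 1 and \<open>x\<close> are squares, \<open>k e\<close> and
    \<open>k e'\<close> have the same character, so \<open>e = e'\<close>.\<close>
  have "k e' * k e' * mdet N \<asymp> x * x * (k e * k e * mdet M)"
    using meqv_mdet[OF x(2)] by (simp add: mdet_smat)
  then have k2: "k e' * k e' \<asymp> x * x * (k e * k e)" using M N by Groebner_Basis.algebra
  have k0: "\<not> k e \<asymp> 0" for e using nu_not_0 one_not_eqv_0 by (simp add: k_def)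
  have "k e' - x * k e \<asymp> 0 \<or> k e' + x * k e \<asymp> 0"
    unfolding mult_eqv_0_iff[symmetric] using k2 by Groebner_Basis.algebra
  then have "k e' \<asymp> x * k e \<or> k e' \<asymp> - (x * k e)" by (auto simp: cong_iff_dvd_diff)
  then have "chi (k e') = chi (k e)" using chi_cong x(1) chi_minus by (metis chi_mult mult_1)
  then have ee: "e = e'" using e by (auto simp: k_def split: if_splits)
  obtain l where l: "k e * l \<asymp> 1" using ex_inverse[OF k0] by blast
  have "x * x \<asymp> 1" using k2 l unfolding ee by Groebner_Basis.algebra
  then have xx: "x \<asymp> 1 \<or> x \<asymp> - 1" by (rule square_eqv_1)
  have "smat (l * k e) N \<asymp>\<^sub>m smat (l * (x * k e)) M"
    using meqv_smat[OF x(2) cong_refl, of l] ee by (simp add: smat_smat)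
  moreover have "smat (l * k e) N \<asymp>\<^sub>m smat 1 N" using l by (intro meqv_smat) (simp_all add: mult.commute)
  moreover have "l * (x * k e) \<asymp> x" using l by Groebner_Basis.algebra
  then have "smat (l * (x * k e)) M \<asymp>\<^sub>m smat x M" by (intro meqv_smat) simp_all
  ultimately have "N \<asymp>\<^sub>m smat x M" using meqv_trans meqv_sym by (metis smat_1)
  moreover have "smat x M \<asymp>\<^sub>m smat 1 M \<or> smat x M \<asymp>\<^sub>m smat (- 1) M" using xx meqv_smat[OF meqv_refl] by blast
  ultimately have "pr N = pr M" unfolding pr_eq_iff using meqv_trans by (metis smat_1)
  then show ?thesis using ee by simp
qed

text \<open>With \<open>mdet L\<close> the square of \<open>t\<close>, the matrix \<open>L\<close>
  is \<open>t\<close> times a matrix of determinant 1, and the scalar \<open>t\<close> matters only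
  through its character.\<close>

lemma aut_of_surj: assumes h: "h \<in> carrier (aut_group G)"
  obtains M e where "mdet M \<asymp> 1" "e \<in> {0, 1}" "h = aut_of (pr M, e)"
proof -
  obtain L where L: "chi (mdet L) = 1" "h = lin_aut L" using aut_linear[OF h] .
  obtain t where t: "t * t \<asymp> mdet L" "\<not> t \<asymp> 0" using chi_eq_1D[OF L(1)] .
  obtain s where s: "t * s \<asymp> 1" "\<not> s \<asymp> 0" using ex_inverse[OF t(2)] .
  define M where "M = smat s L"
  have "s * s * mdet L \<asymp> 1" using s(1) t(1) by Groebner_Basis.algebra
  then have M: "mdet M \<asymp> 1" by (simp add: M_def mdet_smat)
  define e :: int where "e = (if chi t = 1 then 0 else 1)"
  define k where "k = (if e = 0 then 1 else nu)"
  have ck: "chi (k * s) = 1" using chi_cases'[OF t(2)] chi_inverse[OF s(1)] by (auto simp: k_def e_def chi_mult)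
  have "lin_aut (smat k M) = lin_aut L"
    by (rule lin_aut_cong[OF L(1) ck]) (simp add: M_def smat_smat)
  then have "h = aut_of (pr M, e)" unfolding aut_of_pr[OF M] L(2) k_def by simp
  then show ?thesis using that[of M e] M by (simp add: e_def)
qed

theorem aut_group_iso: "aut_group G \<cong> PSL2 p \<times>\<times> integer_mod_group 2"
proof -
  have Z: "carrier (integer_mod_group 2) = {0, 1 :: int}"
    unfolding carrier_integer_mod_group by auto
  have Zm: "e \<otimes>\<^bsub>integer_mod_group 2\<^esub> e' = (e + e') mod 2" for e e'
    by (simp add: integer_mod_group_def)
  have "aut_of \<in> iso (PSL2 p \<times>\<times> integer_mod_group 2) (aut_group G)"
  proof (rule isoI)
    show "aut_of \<in> hom (PSL2 p \<times>\<times> integer_mod_group 2) (aut_group G)"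
    proof (rule homI)
      fix x assume "x \<in> carrier (PSL2 p \<times>\<times> integer_mod_group 2)"
      then obtain M e where M: "mdet M \<asymp> 1" "x = (pr M, e)" by (auto simp: DirProd_def carrier_PSL2)
      then show "aut_of x \<in> carrier (aut_group G)"
        using aut_of_pr[OF M(1), of e] lin_aut_carrier[OF chi_mdet_smat_nu[OF M(1), of e]] by metis
    next
      fix x y assume "x \<in> carrier (PSL2 p \<times>\<times> integer_mod_group 2)" "y \<in> carrier (PSL2 p \<times>\<times> integer_mod_group 2)"
      then obtain M e N e' where M: "mdet M \<asymp> 1" "x = (pr M, e)" "e \<in> {0, 1}"
        and N: "mdet N \<asymp> 1" "y = (pr N, e')" "e' \<in> {0, 1}" by (auto simp: DirProd_def carrier_PSL2 Z)
      have "x \<otimes>\<^bsub>PSL2 p \<times>\<times> integer_mod_group 2\<^esub> y = (pr (mmul M N), (e + e') mod 2)"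
        unfolding M(2) N(2) by (simp add: mult_PSL2 Zm)
      then show "aut_of (x \<otimes>\<^bsub>PSL2 p \<times>\<times> integer_mod_group 2\<^esub> y) = aut_of x \<otimes>\<^bsub>aut_group G\<^esub> aut_of y"
        using aut_of_mult[OF M(1) N(1) M(3) N(3)] M(2) N(2) by simp
    qed
    show "bij_betw aut_of (carrier (PSL2 p \<times>\<times> integer_mod_group 2)) (carrier (aut_group G))"
    proof (rule bij_betw_imageI)
      show "inj_on aut_of (carrier (PSL2 p \<times>\<times> integer_mod_group 2))"
      proof (rule inj_onI)
        fix x y assume xy: "x \<in> carrier (PSL2 p \<times>\<times> integer_mod_group 2)" "y \<in> carrier (PSL2 p \<times>\<times> integer_mod_group 2)"
          and eq: "aut_of x = aut_of y"
        from xy obtain M e N e' where M: "mdet M \<asymp> 1" "x = (pr M, e)" "e \<in> {0, 1}"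
          and N: "mdet N \<asymp> 1" "y = (pr N, e')" "e' \<in> {0, 1}" by (auto simp: DirProd_def carrier_PSL2 Z)
        show "x = y" using aut_of_inj[OF M(1) N(1) M(3) N(3)] eq unfolding M(2) N(2) by simp
      qed
      show "aut_of ` carrier (PSL2 p \<times>\<times> integer_mod_group 2) = carrier (aut_group G)"
      proof
        show "aut_of ` carrier (PSL2 p \<times>\<times> integer_mod_group 2) \<subseteq> carrier (aut_group G)"
        proof (rule image_subsetI)
          fix x assume "x \<in> carrier (PSL2 p \<times>\<times> integer_mod_group 2)"
          then obtain M e where M: "mdet M \<asymp> 1" "x = (pr M, e)" by (auto simp: DirProd_def carrier_PSL2)
          then show "aut_of x \<in> carrier (aut_group G)"
            using aut_of_pr[OF M(1), of e] lin_aut_carrier[OF chi_mdet_smat_nu[OF M(1), of e]] by metis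
        qed
        show "carrier (aut_group G) \<subseteq> aut_of ` carrier (PSL2 p \<times>\<times> integer_mod_group 2)"
        proof
          fix h assume "h \<in> carrier (aut_group G)"
          then obtain M e where M: "mdet M \<asymp> 1" "e \<in> {0, 1}" "h = aut_of (pr M, e)" by (rule aut_of_surj)
          then have "(pr M, e) \<in> carrier (PSL2 p \<times>\<times> integer_mod_group 2)"
            using pr_in_PSL2 by (simp add: DirProd_def Z)
          then show "h \<in> aut_of ` carrier (PSL2 p \<times>\<times> integer_mod_group 2)" using M(3) by blast
        qed
      qed
    qed
  qed
  then have "PSL2 p \<times>\<times> integer_mod_group 2 \<cong> aut_group G" by (auto simp: is_iso_def)
  then show ?thesis
    by (rule group.iso_sym[OF DirProd_group[OF group_PSL2 group_integer_mod_group]])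
qed

end

section \<open>Isomorphisms and a criterion\<close>

text \<open>Arcs are pairs of vertices, so the vertex map forces the arc component of an
  isomorphism. The inclusion expresses that \<open>G\<close> is well-formed.\<close>

lemma digraph_iso_pair_iff:
  "digraph_iso (with_proj G) (with_proj D) \<longleftrightarrow> parcs G \<subseteq> pverts G \<times> pverts G \<and>
     (\<exists>h. inj_on h (pverts G) \<and> pverts D = h ` pverts G \<and> parcs D = map_prod h h ` parcs G)"
proof
  assume "digraph_iso (with_proj G) (with_proj D)"
  then obtain f where f: "pre_digraph.digraph_isomorphism (with_proj G) f" "with_proj D = app_iso f (with_proj G)"
    unfolding digraph_iso_def by blast
  have wf: "wf_digraph (with_proj G)" and inj: "inj_on (iso_verts f) (pverts G)"
    and ends: "\<And>a. a \<in> parcs G \<Longrightarrow> iso_verts f (fst a) = iso_tail f (iso_arcs f a)"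
      "\<And>a. a \<in> parcs G \<Longrightarrow> iso_verts f (snd a) = iso_head f (iso_arcs f a)"
    using f(1) unfolding pre_digraph.digraph_isomorphism_def by auto
  have D: "pverts D = iso_verts f ` pverts G" "parcs D = iso_arcs f ` parcs G" "iso_tail f = fst" "iso_head f = snd"
    using f(2) by (auto simp: with_proj_def app_iso_def)
  have "iso_arcs f a = map_prod (iso_verts f) (iso_verts f) a" if "a \<in> parcs G" for a
    using ends[OF that] D(3,4) by (simp add: prod_eq_iff)
  then have "parcs D = map_prod (iso_verts f) (iso_verts f) ` parcs G" using D(2) by (auto intro: image_cong)
  moreover have "parcs G \<subseteq> pverts G \<times> pverts G"
    using wf_digraph.tail_in_verts[OF wf] wf_digraph.head_in_verts[OF wf] by fastforce
  ultimately show "parcs G \<subseteq> pverts G \<times> pverts G \<and>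
     (\<exists>h. inj_on h (pverts G) \<and> pverts D = h ` pverts G \<and> parcs D = map_prod h h ` parcs G)"
    using inj D(1) by blast
next
  assume "parcs G \<subseteq> pverts G \<times> pverts G \<and>
     (\<exists>h. inj_on h (pverts G) \<and> pverts D = h ` pverts G \<and> parcs D = map_prod h h ` parcs G)"
  then obtain h where arcs: "parcs G \<subseteq> pverts G \<times> pverts G" and inj: "inj_on h (pverts G)"
    and D: "pverts D = h ` pverts G" "parcs D = map_prod h h ` parcs G" by blast
  let ?f = "\<lparr>iso_verts = h, iso_arcs = map_prod h h, iso_head = snd, iso_tail = fst\<rparr>"
  have "wf_digraph (with_proj G)" using arcs by unfold_locales auto
  moreover have "inj_on (map_prod h h) (parcs G)"
    by (rule inj_on_subset[OF map_prod_inj_on[OF inj inj] arcs])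
  ultimately have "pre_digraph.digraph_isomorphism (with_proj G) ?f"
    using inj by (auto simp: pre_digraph.digraph_isomorphism_def)
  moreover have "with_proj D = app_iso ?f (with_proj G)"
    using D by (simp add: with_proj_def app_iso_def)
  ultimately show "digraph_iso (with_proj G) (with_proj D)" unfolding digraph_iso_def by blast
qed

lemma vector_graph_transport:
  assumes G: "vector_graph p f G" and iso: "digraph_iso (with_proj G) (with_proj D)"
  shows "\<exists>f'. vector_graph p f' D"
proof -
  interpret vector_graph p f G by (rule G)
  obtain h where inj: "inj_on h (pverts G)" and D: "pverts D = h ` pverts G" "parcs D = map_prod h h ` parcs G"
    using iso unfolding digraph_iso_pair_iff by blast
  have "vector_graph p (h \<circ> f) D"
  proof
    show "parcs D \<subseteq> pverts D \<times> pverts D" using arcs_in_verts unfolding D by auto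
    show "pverts D = (h \<circ> f) ` {v. nz v}" unfolding D verts_eq by (simp add: image_comp)
    fix v w assume v: "nz v" and w: "nz w"
    show "(h \<circ> f) v = (h \<circ> f) w \<longleftrightarrow> sim v w"
      using inj_on_eq_iff[OF inj f_in_verts[OF v] f_in_verts[OF w]] f_eq_iff[OF v w] by simp
    have "(h (f v), h (f w)) \<in> map_prod h h ` parcs G \<longleftrightarrow> (f v, f w) \<in> parcs G"
    proof
      assume "(h (f v), h (f w)) \<in> map_prod h h ` parcs G"
      then obtain x y where xy: "(x, y) \<in> parcs G" "h (f v) = h x" "h (f w) = h y" by auto
      then have "x \<in> pverts G" "y \<in> pverts G" using arcs_in_verts by auto
      then have "f v = x" "f w = y"
        using inj_onD[OF inj xy(2) f_in_verts[OF v]] inj_onD[OF inj xy(3) f_in_verts[OF w]] by auto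
      then show "(f v, f w) \<in> parcs G" using xy(1) by simp
    qed (auto intro: rev_image_eqI)
    then show "((h \<circ> f) v, (h \<circ> f) w) \<in> parcs D \<longleftrightarrow> chi (vdet v w) = 1"
      unfolding D(2) using adj_iff[OF v w] by simp
  qed
  then show ?thesis by blast
qed

text \<open>Equality and adjacency of vertices are conditions on the vectors alone, so matching the
  two parametrizations is an isomorphism.\<close>

lemma vector_graphs_isomorphic:
  assumes G: "vector_graph p f G" and D: "vector_graph p g D"
  shows "digraph_iso (with_proj G) (with_proj D)"
proof -
  interpret G: vector_graph p f G by (rule G)
  interpret D: vector_graph p g D by (rule D)
  define h where "h u = g (G.param_inv u)" for u
  have h: "h (f v) = g v" if v: "G.nz v" for v
    using D.f_eq_iff[OF G.param_inv(1)[OF v] v] G.param_inv(2)[OF v] by (simp add: h_def)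
  have eq: "h u = h u' \<longleftrightarrow> u = u'" if u: "u \<in> pverts G" "u' \<in> pverts G" for u u'
  proof -
    obtain v w where vw: "G.nz v" "G.nz w" "u = f v" "u' = f w" using u by (metis G.vert_cases)
    then show ?thesis using h D.f_eq_iff[of v w] G.f_eq_iff[of v w] by simp
  qed
  have "parcs D = map_prod h h ` parcs G"
  proof (rule Set.set_eqI)
    fix e :: "'b \<times> 'b"
    show "e \<in> parcs D \<longleftrightarrow> e \<in> map_prod h h ` parcs G"
    proof
      assume e: "e \<in> parcs D"
      then have "fst e \<in> pverts D" "snd e \<in> pverts D" using D.arcs_in_verts by auto
      then obtain v w where vw: "G.nz v" "G.nz w" "fst e = g v" "snd e = g w" by (metis D.vert_cases)
      then have ev: "e = map_prod h h (f v, f w)" using h by (simp add: prod_eq_iff)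
      have "(f v, f w) \<in> parcs G" using e vw G.adj_iff[of v w] D.adj_iff[of v w] by (metis prod.collapse)
      then show "e \<in> map_prod h h ` parcs G" using ev by blast
    next
      assume "e \<in> map_prod h h ` parcs G"
      then obtain x y where xy: "(x, y) \<in> parcs G" "e = (h x, h y)" by auto
      then have "x \<in> pverts G" "y \<in> pverts G" using G.arcs_in_verts by auto
      then obtain v w where vw: "G.nz v" "G.nz w" "x = f v" "y = f w" by (metis G.vert_cases)
      then show "e \<in> parcs D" using xy h G.adj_iff[of v w] D.adj_iff[of v w] by simp
    qed
  qed
  moreover have "pverts D = h ` pverts G"
    unfolding G.verts_eq D.verts_eq image_image using h by (intro image_cong) auto
  moreover have "inj_on h (pverts G)" using eq by (auto simp: inj_on_def)
  ultimately show ?thesis unfolding digraph_iso_pair_iff using G.arcs_in_verts by blast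
qed

section \<open>The projective line as an index set\<close>

context prime_1_mod_4
begin

text \<open>\<open>None\<close> is the point at infinity and \<open>Some x\<close> the affine point
  \<open>x\<close>.\<close>

definition line_rep :: "int option \<Rightarrow> int \<times> int" where
  "line_rep l = (case l of None \<Rightarrow> (1, 0) | Some x \<Rightarrow> (x, 1))"

definition line_of :: "int \<times> int \<Rightarrow> int option" where
  "line_of v = (if snd v \<asymp> 0 then None else Some (fst v * (SOME c. snd v * c \<asymp> 1) mod int p))"

definition line_indices :: "int option set" where
  "line_indices = insert None (Some ` {0..<int p})"

lemma nz_line_rep: "nz (line_rep l)"
  using one_not_eqv_0 by (simp add: line_rep_def nz_def split: option.split)

lemma line_of_in: "line_of v \<in> line_indices"
  using p_ge_5 by (simp add: line_of_def line_indices_def)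

lemma line_rep_line_of: "vdet (line_rep (line_of v)) v \<asymp> 0"
proof (cases "snd v \<asymp> 0")
  case True
  then show ?thesis by (simp add: line_of_def line_rep_def vdet_def)
next
  case False
  define c where "c = (SOME c. snd v * c \<asymp> 1)"
  have c: "snd v * c \<asymp> 1" unfolding c_def using ex_inverse[OF False] by (metis (mono_tags, lifting) someI_ex)
  have "fst v * c mod int p \<asymp> fst v * c" by simp
  then have "(fst v * c mod int p) * snd v - fst v \<asymp> 0" using c by Groebner_Basis.algebra
  then show ?thesis using False by (simp add: line_of_def line_rep_def vdet_def c_def)
qed

lemma line_rep_eqv_iff: assumes "l \<in> line_indices" "l' \<in> line_indices"
  shows "vdet (line_rep l) (line_rep l') \<asymp> 0 \<longleftrightarrow> l = l'"
proof -
  have s: "x - y \<asymp> 0 \<longleftrightarrow> x = y" if "x \<in> {0..<int p}" "y \<in> {0..<int p}" for x y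
    using eqv_small[OF _ that] by (auto simp: cong_iff_dvd_diff)
  have "\<not> - 1 \<asymp> 0" using one_not_eqv_0 by (simp add: cong_0_iff)
  then show ?thesis using assms s one_not_eqv_0
    by (auto simp: line_indices_def line_rep_def vdet_def)
qed

lemma line_of_eq_iff: assumes "nz v" "nz w" shows "line_of v = line_of w \<longleftrightarrow> vdet v w \<asymp> 0"
proof -
  let ?r = "\<lambda>v. line_rep (line_of v)"
  have r: "vdet (?r u) u \<asymp> 0" "vdet u (?r u) \<asymp> 0" for u
    using line_rep_line_of vdet_eqv_0_swap by simp_all
  have "vdet v w \<asymp> 0 \<longleftrightarrow> vdet (?r v) (?r w) \<asymp> 0"
  proof
    assume "vdet v w \<asymp> 0"
    from vdet_eqv_0_trans[OF assms(1) r(1) this] show "vdet (?r v) (?r w) \<asymp> 0"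
      by (rule vdet_eqv_0_trans[OF assms(2) _ r(2)])
  next
    assume "vdet (?r v) (?r w) \<asymp> 0"
    from vdet_eqv_0_trans[OF nz_line_rep r(2) this] show "vdet v w \<asymp> 0"
      by (rule vdet_eqv_0_trans[OF nz_line_rep _ r(1)])
  qed
  then show ?thesis using line_rep_eqv_iff[OF line_of_in line_of_in, of v w] by simp
qed

lemma line_rep_sim: "nz v \<Longrightarrow> sim (line_rep (line_of v)) v \<or> sim (smul nu (line_rep (line_of v))) v"
  using parallel_cases[OF nz_line_rep _ line_rep_line_of] .

text \<open>In \<open>c l b\<close> the index \<open>l\<close> is a point of the projective line and \<open>b\<close> tells the two vertices
  of its fibre apart.\<close>

lemma vector_graphI:
  fixes c :: "int option \<Rightarrow> bool \<Rightarrow> 'a"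
  assumes arcs: "parcs G \<subseteq> pverts G \<times> pverts G"
    and verts: "pverts G = {c l b | l b. l \<in> line_indices}"
    and inj: "\<And>l l' b b'. l \<in> line_indices \<Longrightarrow> l' \<in> line_indices \<Longrightarrow> c l b = c l' b' \<Longrightarrow> l = l' \<and> b = b'"
    and adj: "\<And>l l' b b'. l \<in> line_indices \<Longrightarrow> l' \<in> line_indices \<Longrightarrow> (c l b, c l' b') \<in> parcs G \<longleftrightarrow>
        chi (vdet (line_rep l) (line_rep l')) = (if b = b' then 1 else - 1)"
  shows "\<exists>f. vector_graph p f G"
proof -
  define B where "B v = sim (line_rep (line_of v)) v" for v
  define f where "f v = c (line_of v) (B v)" for v
  have simB: "sim (if B v then line_rep (line_of v) else smul nu (line_rep (line_of v))) v" if "nz v" for v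
    using line_rep_sim[OF that] by (cases "sim (line_rep (line_of v)) v") (simp_all add: B_def)
  have "vector_graph p f G"
  proof
    show "parcs G \<subseteq> pverts G \<times> pverts G" by (rule arcs)
    show "pverts G = f ` {v. nz v}"
    proof
      show "f ` {v. nz v} \<subseteq> pverts G" unfolding verts f_def using line_of_in by blast
      show "pverts G \<subseteq> f ` {v. nz v}"
      proof
        fix x assume "x \<in> pverts G"
        then obtain l b where l: "l \<in> line_indices" "x = c l b" unfolding verts by blast
        define v where "v = (if b then line_rep l else smul nu (line_rep l))"
        have v: "nz v" using nz_line_rep by (simp add: v_def)
        have "vdet (line_rep l) v \<asymp> 0"
          unfolding v_def by (simp add: vdet_smul) (simp add: vdet_def)
        moreover have "vdet v (line_rep (line_of v)) \<asymp> 0"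
          using line_rep_line_of vdet_eqv_0_swap by blast
        ultimately have "vdet (line_rep l) (line_rep (line_of v)) \<asymp> 0" using vdet_eqv_0_trans[OF v] by blast
        then have lv: "line_of v = l" using line_rep_eqv_iff[OF l(1) line_of_in] by simp
        then have "B v = b" using not_sim_nu[OF nz_line_rep] by (simp add: B_def v_def)
        then show "x \<in> f ` {v. nz v}" using l(2) lv v unfolding f_def by blast
      qed
    qed
    fix v w assume v: "nz v" and w: "nz w"
    show "f v = f w \<longleftrightarrow> sim v w"
    proof
      assume "f v = f w"
      then have e: "line_of v = line_of w" "B v = B w" using inj[OF line_of_in line_of_in] unfolding f_def by blast+
      have "sim (if B v then line_rep (line_of v) else smul nu (line_rep (line_of v))) w"
        using simB[OF w] unfolding e .
      then show "sim v w" by (rule sim_trans[OF sim_sym[OF simB[OF v]]])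
    next
      assume s: "sim v w"
      then have "line_of v = line_of w" using line_of_eq_iff[OF v w] sim_vdet by blast
      then show "f v = f w" unfolding f_def B_def using sim_cong_right[OF s] by simp
    qed
    have "chi (vdet v w) = chi (vdet (if B v then line_rep (line_of v) else smul nu (line_rep (line_of v)))
        (if B w then line_rep (line_of w) else smul nu (line_rep (line_of w))))"
      using chi_vdet_sim[OF simB[OF v] simB[OF w]] by simp
    also have "\<dots> = (if B v = B w then 1 else - 1) * chi (vdet (line_rep (line_of v)) (line_rep (line_of w)))"
      by (simp add: vdet_smul chi_mult)
    finally show "(f v, f w) \<in> parcs G \<longleftrightarrow> chi (vdet v w) = 1"
      unfolding f_def adj[OF line_of_in line_of_in] by auto
  qed
  then show ?thesis by blast
qed

end

section \<open>Double covers with automorphism group \<open>PSL(2,p) \<times> Z\<^sub>2\<close>\<close>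

lemma aut_group_apply:
  assumes "g \<in> carrier (aut_group G)" "h \<in> carrier (aut_group G)"
  shows "g \<otimes>\<^bsub>aut_group G\<^esub> h \<in> carrier (aut_group G)"
    and "u \<in> pverts G \<Longrightarrow> (g \<otimes>\<^bsub>aut_group G\<^esub> h) u = g (h u)"
    and "u \<in> pverts G \<Longrightarrow> h u \<in> pverts G"
proof -
  have B: "g \<in> Bij (pverts G)" "h \<in> Bij (pverts G)" using assms unfolding carrier_aut_group by auto
  have m: "g \<otimes>\<^bsub>aut_group G\<^esub> h = compose (pverts G) g h" using B by (simp add: aut_group_def BijGroup_def)
  show hv: "u \<in> pverts G \<Longrightarrow> h u \<in> pverts G" for u using Bij_imp_funcset[OF B(2)] by blast
  show "u \<in> pverts G \<Longrightarrow> (g \<otimes>\<^bsub>aut_group G\<^esub> h) u = g (h u)" unfolding m by (simp add: compose_def)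
  show "g \<otimes>\<^bsub>aut_group G\<^esub> h \<in> carrier (aut_group G)"
    unfolding m carrier_aut_group
  proof (intro CollectI conjI ballI)
    show "compose (pverts G) g h \<in> Bij (pverts G)" by (rule compose_Bij[OF B])
    fix u v assume uv: "u \<in> pverts G" "v \<in> pverts G"
    then show "(compose (pverts G) g h u, compose (pverts G) g h v) \<in> parcs G \<longleftrightarrow> (u, v) \<in> parcs G"
      using assms hv[OF uv(1)] hv[OF uv(2)] unfolding carrier_aut_group by (simp add: compose_def)
  qed
qed

lemma (in pair_wf_digraph) aut_relpow:
  assumes h: "h \<in> carrier (aut_group G)"
  shows "u \<in> pverts G \<Longrightarrow> v \<in> pverts G \<Longrightarrow> (h u, h v) \<in> parcs G ^^ n \<longleftrightarrow> (u, v) \<in> parcs G ^^ n"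
proof (induction n arbitrary: u)
  case 0
  then show ?case using h unfolding carrier_aut_group Bij_def bij_betw_def inj_on_def by auto
next
  case (Suc n)
  have ha: "\<And>x y. x \<in> pverts G \<Longrightarrow> y \<in> pverts G \<Longrightarrow> (h x, h y) \<in> parcs G \<longleftrightarrow> (x, y) \<in> parcs G"
    and im: "h ` pverts G = pverts G"
    using h unfolding carrier_aut_group Bij_def bij_betw_def by auto
  show ?case
  proof
    assume "(h u, h v) \<in> parcs G ^^ Suc n"
    then obtain y where y: "(h u, y) \<in> parcs G" "(y, h v) \<in> parcs G ^^ n" by (meson relpow_Suc_D2)
    then obtain x where x: "x \<in> pverts G" "y = h x" using in_arcsD2[OF y(1)] im by blast
    then have "(u, x) \<in> parcs G" "(x, v) \<in> parcs G ^^ n" using y ha[OF Suc.prems(1) x(1)] Suc.IH[OF x(1) Suc.prems(2)] by auto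
    then show "(u, v) \<in> parcs G ^^ Suc n" by (rule relpow_Suc_I2)
  next
    assume "(u, v) \<in> parcs G ^^ Suc n"
    then obtain x where x: "(u, x) \<in> parcs G" "(x, v) \<in> parcs G ^^ n" by (meson relpow_Suc_D2)
    have xV: "x \<in> pverts G" using in_arcsD2[OF x(1)] .
    then have "(h u, h x) \<in> parcs G" "(h x, h v) \<in> parcs G ^^ n"
      using x ha[OF Suc.prems(1) xV] Suc.IH[OF xV Suc.prems(2)] by auto
    then show "(h u, h v) \<in> parcs G ^^ Suc n" by (rule relpow_Suc_I2)
  qed
qed

text \<open>Here \<open>\<tau>\<close> exchanges the two points of a fibre. They are not adjacent
  because the diameter is at least 2; completeness of the quotient gives exactly one neighbour in
  each other fibre; automorphisms preserve distances and hence antipodes.\<close>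

lemma double_cover_structure:
  assumes pg: "pair_graph G" and dc: "antipodal_double_cover G"
    and K: "complete_digraph n (with_proj (antipodal_quotient G))"
  obtains \<tau> where
    "\<And>u. u \<in> pverts G \<Longrightarrow> \<tau> u \<in> pverts G \<and> \<tau> u \<noteq> u \<and> \<tau> (\<tau> u) = u \<and> (u, \<tau> u) \<notin> parcs G"
    "\<And>u v. u \<in> pverts G \<Longrightarrow> v \<in> pverts G \<Longrightarrow> v \<noteq> u \<Longrightarrow> v \<noteq> \<tau> u \<Longrightarrow> (u, \<tau> v) \<in> parcs G \<longleftrightarrow> (u, v) \<notin> parcs G"
    "\<And>h u. h \<in> carrier (aut_group G) \<Longrightarrow> u \<in> pverts G \<Longrightarrow> h (\<tau> u) = \<tau> (h u)"
    "card (pverts G) = 2 * n"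
proof -
  interpret pair_graph G by (rule pg)
  let ?r = "antipodal_rel G" and ?V = "pverts G" and ?Q = "antipodal_quotient G"
  have ap: "antipodal G" and all: "\<forall>(B, B') \<in> parcs ?Q. \<forall>v \<in> B. \<exists>!w. w \<in> B' \<and> (v, w) \<in> parcs G"
    and c2: "\<And>B. B \<in> pverts ?Q \<Longrightarrow> card B = 2"
    using dc unfolding antipodal_double_cover_def antipodal_cover_def by simp_all
  have cov: "\<exists>!w. w \<in> B' \<and> (v, w) \<in> parcs G" if "(B, B') \<in> parcs ?Q" "v \<in> B" for B B' v
    using bspec[OF all that(1)] that(2) by simp
  obtain d :: nat where d: "d \<ge> 2" "gdiam G = ereal (real d)" and eq: "equiv ?V ?r"
    using ap unfolding antipodal_def by blast
  have Q: "pverts ?Q = ?V // ?r" by (simp add: antipodal_quotient_def Let_def)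
  have Qf: "finite (pverts ?Q)" "card (pverts ?Q) = n"
    and Qa: "parcs ?Q = {(u, v). (u, v) \<in> pverts ?Q \<times> pverts ?Q \<and> u \<noteq> v}"
    using K unfolding complete_digraph_pair_def by auto
  have cl: "?r `` {u} \<in> pverts ?Q" "u \<in> ?r `` {u}" if "u \<in> ?V" for u
    using quotientI[OF that, of ?r] equiv_class_self[OF eq that] unfolding Q by simp_all
  have "\<exists>x. ?r `` {u} = {u, x} \<and> x \<noteq> u" if u: "u \<in> ?V" for u
  proof -
    obtain x y where "?r `` {u} = {x, y}" "x \<noteq> y" using c2[OF cl(1)[OF u]] card_2_iff by metis
    then show ?thesis using cl(2)[OF u] by auto
  qed
  then obtain \<tau> where \<tau>: "\<And>u. u \<in> ?V \<Longrightarrow> ?r `` {u} = {u, \<tau> u} \<and> \<tau> u \<noteq> u" by metis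
  have rV: "x \<in> ?V" "y \<in> ?V" if "(x, y) \<in> ?r" for x y using that unfolding antipodal_rel_def by auto
  have t0: "(u, \<tau> u) \<in> ?r" "\<tau> u \<in> ?V" if u: "u \<in> ?V" for u
  proof -
    have "\<tau> u \<in> ?r `` {u}" using \<tau>[OF u] by simp
    then show "(u, \<tau> u) \<in> ?r" by simp
    then show "\<tau> u \<in> ?V" by (rule rV)
  qed
  have gd: "gdist G u (\<tau> u) = ereal (real d)" if u: "u \<in> ?V" for u
    using t0[OF u] \<tau>[OF u] unfolding antipodal_rel_def d(2) by auto
  have t1: "\<tau> u \<in> ?V \<and> \<tau> u \<noteq> u \<and> \<tau> (\<tau> u) = u \<and> (u, \<tau> u) \<notin> parcs G" if u: "u \<in> ?V" for u
  proof (intro conjI)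
    show "\<tau> u \<in> ?V" "\<tau> u \<noteq> u" using t0[OF u] \<tau>[OF u] by auto
    have "?r `` {u} = ?r `` {\<tau> u}" using equiv_class_eq[OF eq t0(1)[OF u]] .
    then have "{u, \<tau> u} = {\<tau> u, \<tau> (\<tau> u)}" using \<tau>[OF u] \<tau>[OF t0(2)[OF u]] by simp
    then have "u \<in> {\<tau> u, \<tau> (\<tau> u)}" by blast
    then show "\<tau> (\<tau> u) = u" using \<tau>[OF u] by auto
    show "(u, \<tau> u) \<notin> parcs G"
    proof
      assume "(u, \<tau> u) \<in> parcs G"
      then have "(u, \<tau> u) \<in> parcs G ^^ 1" by simp
      moreover have "\<forall>k<d. (u, \<tau> u) \<notin> parcs G ^^ k" using gd[OF u] gdist_eq_nat_iff[OF u, of "\<tau> u" d] by blast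
      ultimately show False using d(1) by (metis Suc_1 Suc_le_lessD)
    qed
  qed
  have t3: "(u, \<tau> v) \<in> parcs G \<longleftrightarrow> (u, v) \<notin> parcs G"
    if uv: "u \<in> ?V" "v \<in> ?V" "v \<noteq> u" "v \<noteq> \<tau> u" for u v
  proof -
    have "?r `` {u} \<noteq> ?r `` {v}" using cl(2)[OF uv(2)] \<tau>[OF uv(1)] uv(3,4) by auto
    then have "(?r `` {u}, ?r `` {v}) \<in> parcs ?Q" unfolding Qa using cl uv(1,2) by simp
    from cov[OF this cl(2)[OF uv(1)]] have "\<exists>!w. w \<in> {v, \<tau> v} \<and> (u, w) \<in> parcs G" using \<tau>[OF uv(2)] by simp
    then show ?thesis using \<tau>[OF uv(2)] by auto
  qed
  have t5: "h (\<tau> u) = \<tau> (h u)" if h: "h \<in> carrier (aut_group G)" and u: "u \<in> ?V" for h u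
  proof -
    have hV: "h u \<in> ?V" "h (\<tau> u) \<in> ?V" using aut_group_apply(3)[OF h h] u t0(2)[OF u] by auto
    have "gdist G (h u) (h (\<tau> u)) = ereal (real d)"
      using gd[OF u] unfolding gdist_eq_nat_iff[OF u] gdist_eq_nat_iff[OF hV(1)]
      using aut_relpow[OF h u t0(2)[OF u]] by blast
    then have "(h u, h (\<tau> u)) \<in> ?r" using hV d(2) unfolding antipodal_rel_def by simp
    then have "h (\<tau> u) \<in> {h u, \<tau> (h u)}" using \<tau>[OF hV(1)] by blast
    moreover have "h (\<tau> u) \<noteq> h u"
      using h \<tau>[OF u] u t0(2)[OF u] unfolding carrier_aut_group Bij_def bij_betw_def inj_on_def by blast
    ultimately show ?thesis by blast
  qed
  have "2 * card (?V // ?r) = card (\<Union> (?V // ?r))"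
  proof (rule card_partition)
    show "finite (?V // ?r)" using Qf(1) Q by simp
    show "finite (\<Union> (?V // ?r))" unfolding Union_quotient[OF eq] by (rule pair_finite_verts)
    show "card c = 2" if "c \<in> ?V // ?r" for c using that c2 Q by simp
    show "c1 \<inter> c2 = {}" if "c1 \<in> ?V // ?r" "c2 \<in> ?V // ?r" "c1 \<noteq> c2" for c1 c2
      using quotient_disj[OF eq that(1,2)] that(3) by blast
  qed
  then have "card ?V = 2 * n" using Qf(2) Q Union_quotient[OF eq] by simp
  from that[OF t1 t3 t5 this] show ?thesis .
qed

context prime_1_mod_4
begin

text \<open>The inverse isomorphism is restricted to the first factor and pulled back to integer
  matrices. The last fact is faithfulness, up to sign.\<close>

lemma PSL2_action:
  assumes iso: "aut_group G \<cong> PSL2 p \<times>\<times> integer_mod_group 2"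
  obtains \<phi> where
    "\<And>M. mdet M \<asymp> 1 \<Longrightarrow> \<phi> M \<in> carrier (aut_group G)"
    "\<And>M N u. mdet M \<asymp> 1 \<Longrightarrow> mdet N \<asymp> 1 \<Longrightarrow> u \<in> pverts G \<Longrightarrow> \<phi> (mmul M N) u = \<phi> M (\<phi> N u)"
    "\<And>M N. pr M = pr N \<Longrightarrow> \<phi> M = \<phi> N"
    "\<And>u. u \<in> pverts G \<Longrightarrow> \<phi> (1, 0, 0, 1) u = u"
    "\<And>M. mdet M \<asymp> 1 \<Longrightarrow> (\<And>u. u \<in> pverts G \<Longrightarrow> \<phi> M u = u) \<Longrightarrow> pr M = pr (1, 0, 0, 1)"
proof -
  let ?A = "carrier (aut_group G)" and ?P = "PSL2 p \<times>\<times> integer_mod_group 2"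
  obtain \<theta> where \<theta>: "\<theta> \<in> iso (aut_group G) ?P" using iso unfolding is_iso_def by blast
  have bij: "bij_betw \<theta> ?A (carrier ?P)" and hom: "\<And>x y. x \<in> ?A \<Longrightarrow> y \<in> ?A \<Longrightarrow>
      \<theta> (x \<otimes>\<^bsub>aut_group G\<^esub> y) = \<theta> x \<otimes>\<^bsub>?P\<^esub> \<theta> y"
    using \<theta> unfolding iso_def hom_def by auto
  define \<phi> where "\<phi> M = inv_into ?A \<theta> (pr M, 0)" for M
  have P: "(pr M, 0) \<in> carrier ?P" if "mdet M \<asymp> 1" for M
    using pr_in_PSL2[OF that] by (simp add: DirProd_def carrier_integer_mod_group)
  have a1: "\<phi> M \<in> ?A" "\<theta> (\<phi> M) = (pr M, 0)" if "mdet M \<asymp> 1" for M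
  proof -
    have "(pr M, 0) \<in> \<theta> ` ?A" using P[OF that] bij unfolding bij_betw_def by simp
    then show "\<phi> M \<in> ?A" "\<theta> (\<phi> M) = (pr M, 0)"
      unfolding \<phi>_def by (rule inv_into_into, rule f_inv_into_f)
  qed
  have inj: "x = y" if "x \<in> ?A" "y \<in> ?A" "\<theta> x = \<theta> y" for x y
    using that bij unfolding bij_betw_def inj_on_def by blast
  have a2: "\<phi> (mmul M N) = \<phi> M \<otimes>\<^bsub>aut_group G\<^esub> \<phi> N" if M: "mdet M \<asymp> 1" and N: "mdet N \<asymp> 1" for M N
  proof (rule inj)
    have MN: "mdet (mmul M N) \<asymp> 1" unfolding mdet_mmul using cong_mult[OF M N] by simp
    show "\<phi> (mmul M N) \<in> ?A" using a1[OF MN] by blast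
    show "\<phi> M \<otimes>\<^bsub>aut_group G\<^esub> \<phi> N \<in> ?A" using aut_group_apply(1)[OF a1(1)[OF M] a1(1)[OF N]] .
    show "\<theta> (\<phi> (mmul M N)) = \<theta> (\<phi> M \<otimes>\<^bsub>aut_group G\<^esub> \<phi> N)"
      unfolding hom[OF a1(1)[OF M] a1(1)[OF N]] a1(2)[OF M] a1(2)[OF N] a1(2)[OF MN]
      by (simp add: mult_PSL2 integer_mod_group_def)
  qed
  have d1: "mdet (1, 0, 0, 1) \<asymp> 1" by simp
  have a4: "\<phi> (1, 0, 0, 1) u = u" if u: "u \<in> pverts G" for u
  proof -
    have "\<phi> (1, 0, 0, 1) (\<phi> (1, 0, 0, 1) u) = \<phi> (1, 0, 0, 1) u"
      using a2[OF d1 d1] aut_group_apply(2)[OF a1(1)[OF d1] a1(1)[OF d1] u] by simp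
    moreover have "inj_on (\<phi> (1, 0, 0, 1)) (pverts G)"
      using a1(1)[OF d1] unfolding carrier_aut_group Bij_def bij_betw_def by blast
    ultimately show ?thesis using u aut_group_apply(3)[OF a1(1)[OF d1] a1(1)[OF d1] u] by (meson inj_onD)
  qed
  show ?thesis
  proof (rule that[of \<phi>])
    show "\<phi> M \<in> ?A" if "mdet M \<asymp> 1" for M using a1(1)[OF that] .
    show "\<phi> (mmul M N) u = \<phi> M (\<phi> N u)" if "mdet M \<asymp> 1" "mdet N \<asymp> 1" "u \<in> pverts G" for M N u
      unfolding a2[OF that(1,2)] using aut_group_apply(2)[OF a1(1)[OF that(1)] a1(1)[OF that(2)] that(3)] .
    show "\<phi> M = \<phi> N" if "pr M = pr N" for M N by (simp add: \<phi>_def that)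
    show "\<phi> (1, 0, 0, 1) u = u" if "u \<in> pverts G" for u using a4[OF that] .
    show "pr M = pr (1, 0, 0, 1)" if M: "mdet M \<asymp> 1" and id: "\<And>u. u \<in> pverts G \<Longrightarrow> \<phi> M u = u" for M
    proof -
      have "\<phi> M = \<phi> (1, 0, 0, 1)"
      proof (rule extensionalityI)
        show "\<phi> M \<in> extensional (pverts G)" "\<phi> (1, 0, 0, 1) \<in> extensional (pverts G)"
          using a1(1)[OF M] a1(1)[OF d1] unfolding carrier_aut_group Bij_def by auto
      qed (use id a4 in simp)
      then show ?thesis using a1(2)[OF M] a1(2)[OF d1] by simp
    qed
  qed
qed

end

context prime_1_mod_4
begin

text \<open>The unipotent elements move \<open>2p\<close> vertices in two regular orbits and fix the remaining
  fibre pointwise.  Relative to a base point in that fibre, the graph is given by the set \<open>S\<close> of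
  differences of adjacent points in an orbit, and the diagonal elements make \<open>S\<close> invariant under
  squares.\<close>

theorem cover_imp_vector_graph:
  assumes pg: "pair_graph G" and con: "connected (with_proj G)" and nb: "\<not> bipartite_graph G"
    and dc: "antipodal_double_cover G"
    and K: "complete_digraph (p + 1) (with_proj (antipodal_quotient G))"
    and iso: "aut_group G \<cong> PSL2 p \<times>\<times> integer_mod_group 2"
  shows "\<exists>f. vector_graph p f G"
proof -
  interpret pair_graph G by (rule pg)
  let ?V = "pverts G" and ?A = "parcs G" and ?R = "{0..<int p}"
  obtain \<tau> where \<tau>: "\<And>u. u \<in> ?V \<Longrightarrow> \<tau> u \<in> ?V \<and> \<tau> u \<noteq> u \<and> \<tau> (\<tau> u) = u \<and> (u, \<tau> u) \<notin> ?A"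
    and adj_tau: "\<And>u v. u \<in> ?V \<Longrightarrow> v \<in> ?V \<Longrightarrow> v \<noteq> u \<Longrightarrow> v \<noteq> \<tau> u \<Longrightarrow> (u, \<tau> v) \<in> ?A \<longleftrightarrow> (u, v) \<notin> ?A"
    and aut_tau: "\<And>h u. h \<in> carrier (aut_group G) \<Longrightarrow> u \<in> ?V \<Longrightarrow> h (\<tau> u) = \<tau> (h u)"
    and cardV: "card ?V = 2 * (p + 1)"
    using double_cover_structure[OF pg dc K] by blast
  obtain \<phi> where \<phi>c: "\<And>M. mdet M \<asymp> 1 \<Longrightarrow> \<phi> M \<in> carrier (aut_group G)"
    and \<phi>m: "\<And>M N u. mdet M \<asymp> 1 \<Longrightarrow> mdet N \<asymp> 1 \<Longrightarrow> u \<in> ?V \<Longrightarrow> \<phi> (mmul M N) u = \<phi> M (\<phi> N u)"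
    and \<phi>pr: "\<And>M N. pr M = pr N \<Longrightarrow> \<phi> M = \<phi> N"
    and \<phi>1: "\<And>u. u \<in> ?V \<Longrightarrow> \<phi> (1, 0, 0, 1) u = u"
    and \<phi>f: "\<And>M. mdet M \<asymp> 1 \<Longrightarrow> (\<And>u. u \<in> ?V \<Longrightarrow> \<phi> M u = u) \<Longrightarrow> pr M = pr (1, 0, 0, 1)"
    using PSL2_action[OF iso] by blast
  have symA: "(u, v) \<in> ?A \<longleftrightarrow> (v, u) \<in> ?A" for u v
    using pair_sym_arcs unfolding symmetric_def by (auto dest: symD)
  have noloop: "(u, u) \<notin> ?A" for u using pair_no_loops[of "(u, u)"] by auto
  have arcsV: "u \<in> ?V" "v \<in> ?V" if "(u, v) \<in> ?A" for u v using in_arcsD1[OF that] in_arcsD2[OF that] .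
  have \<phi>V: "\<phi> M u \<in> ?V" and \<phi>A: "(\<phi> M u, \<phi> M v) \<in> ?A \<longleftrightarrow> (u, v) \<in> ?A" and \<phi>\<tau>: "\<phi> M (\<tau> u) = \<tau> (\<phi> M u)"
    if "mdet M \<asymp> 1" "u \<in> ?V" "v \<in> ?V" for M u v
    using aut_group_apply(3)[OF \<phi>c[OF that(1)] \<phi>c[OF that(1)] that(2)] \<phi>c[OF that(1)] that aut_tau
    unfolding carrier_aut_group by auto
  have tau_inj: "\<tau> u = \<tau> v \<longleftrightarrow> u = v" if "u \<in> ?V" "v \<in> ?V" for u v using \<tau> that by metis
  \<comment> \<open>Replacing one end of an arc between different fibres by its antipode negates
    adjacency, so replacing both ends preserves it.\<close>
  have adj_tau_tau: "(\<tau> u, \<tau> v) \<in> ?A \<longleftrightarrow> (u, v) \<in> ?A" if u: "u \<in> ?V" and v: "v \<in> ?V" for u v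
  proof (cases "v = u \<or> v = \<tau> u")
    case True
    then show ?thesis using \<tau>[OF u] noloop symA by metis
  next
    case False
    then have "(\<tau> u, \<tau> v) \<in> ?A \<longleftrightarrow> (\<tau> u, v) \<notin> ?A" using \<tau>[OF u] by (intro adj_tau v) auto
    also have "(\<tau> u, v) \<in> ?A \<longleftrightarrow> (v, \<tau> u) \<in> ?A" by (rule symA)
    also have "(v, \<tau> u) \<in> ?A \<longleftrightarrow> (v, u) \<notin> ?A" using False \<tau>[OF u] \<tau>[OF v] by (intro adj_tau u v) auto
    finally show ?thesis using symA by blast
  qed
  \<comment> \<open>The unipotent upper triangular matrices, a copy of the additive group of
    residues.\<close>
  define al where "al x = \<phi> (1, x, 0, 1)" for x
  have dT: "mdet (1, x, 0, 1) \<asymp> 1" for x by (simp add: mdet_def)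
  have alV: "al x u \<in> ?V" and al_tau: "al x (\<tau> u) = \<tau> (al x u)" if "u \<in> ?V" for x u
    unfolding al_def using \<phi>V[OF dT that that] \<phi>\<tau>[OF dT that that] by auto
  have alA: "(al x u, al x v) \<in> ?A \<longleftrightarrow> (u, v) \<in> ?A" if "u \<in> ?V" "v \<in> ?V" for x u v
    unfolding al_def using \<phi>A[OF dT that] .
  have al_add: "al x (al y u) = al (x + y) u" if "u \<in> ?V" for x y u
    unfolding al_def using \<phi>m[OF dT dT that, of x y] by (simp add: mmul_def add.commute)
  have al_cong: "al x = al y" if "x \<asymp> y" for x y
    unfolding al_def by (rule \<phi>pr) (use that in \<open>simp add: pr_eq_iff meqv_iff\<close>)
  have al_0: "al x u = u" if "x \<asymp> 0" "u \<in> ?V" for x u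
    using al_cong[OF that(1)] \<phi>1[OF that(2)] by (simp add: al_def)
  have al_iter: "al (int n * x) u = u" if "al x u = u" "u \<in> ?V" for n x u
  proof (induction n)
    case 0 show ?case using al_0 that by simp
  next
    case (Suc n)
    have "al (int (Suc n) * x) u = al x (al (int n * x) u)" by (simp add: al_add[OF that(2)] distrib_right)
    then show ?case using Suc that(1) by simp
  qed
  \<comment> \<open>If \<open>al z\<close> preserves the fibre of \<open>u\<close>, then
    \<open>al (2 * z)\<close> fixes \<open>u\<close>. As \<open>2 * z\<close> is a unit modulo
    \<open>p\<close>, its multiples give every residue, so all unipotent elements fix
    \<open>u\<close>.\<close>
  have fixed: "al x u = u" if z: "al z u \<in> {u, \<tau> u}" "\<not> z \<asymp> 0" "u \<in> ?V" for x z u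
  proof -
    have "al z (al z u) = u" using z al_tau[OF z(3), of z] \<tau>[OF z(3)] by auto
    then have 2: "al (2 * z) u = u" using al_add[OF z(3), of z z] by simp
    have "\<not> 2 * z \<asymp> 0" using z(2) two_not_eqv_0 mult_eqv_0_iff by blast
    then obtain k where k: "2 * z * k \<asymp> 1" using ex_inverse by blast
    define n where "n = nat (x * k mod int p)"
    have "int n \<asymp> x * k" using p_ge_5 by (simp add: n_def)
    then have "int n * (2 * z) \<asymp> x" using k by Groebner_Basis.algebra
    then show ?thesis using al_cong al_iter[OF 2 z(3), of n] by metis
  qed
  have moved: "\<exists>u\<in>?V. al 1 u \<noteq> u"
  proof (rule ccontr)
    assume "\<not> (\<exists>u\<in>?V. al 1 u \<noteq> u)"
    then have "pr (1, 1, 0, 1) = pr (1, 0, 0, 1)" unfolding al_def by (intro \<phi>f[OF dT]) blast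
    then show False using one_not_eqv_0 by (auto simp: pr_eq_iff meqv_iff smat_def)
  qed
  define Orb where "Orb u = (\<lambda>x. al x u) ` ?R" for u
  \<comment> \<open>For a moved vertex \<open>u\<close> the set \<open>Orb u\<close> has
    \<open>p\<close> elements and is disjoint from its set of antipodes, so \<open>W u\<close> takes
    up \<open>2 * p\<close> of the \<open>2 * p + 2\<close> vertices and leaves exactly one
    fibre.\<close>
  define W where "W u = Orb u \<union> \<tau> ` Orb u" for u
  have Orb_mem: "al x u \<in> Orb u" for x u
  proof -
    have "al x = al (x mod int p)" by (rule al_cong) simp
    moreover have "x mod int p \<in> ?R" using p_ge_5 by simp
    ultimately show ?thesis unfolding Orb_def by (metis imageI)
  qed
  have OV: "Orb u \<subseteq> ?V" if "u \<in> ?V" for u unfolding Orb_def using alV[OF that] by blast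
  have free: "x \<asymp> y" if u: "u \<in> ?V" "al 1 u \<noteq> u" and xy: "al x u \<in> {al y u, \<tau> (al y u)}" for x y u
  proof (rule ccontr)
    assume "\<not> x \<asymp> y"
    then have n: "\<not> - y + x \<asymp> 0" by (simp add: cong_iff_dvd_diff)
    have "al (- y) (al x u) \<in> {al (- y) (al y u), al (- y) (\<tau> (al y u))}" using xy by auto
    then have "al (- y + x) u \<in> {u, \<tau> u}"
      using al_tau[OF alV[OF u(1)], of "- y" y] by (simp add: al_add[OF u(1)] al_0[OF _ u(1)])
    from fixed[OF this n u(1)] show False using u(2) by blast
  qed
  have cardW: "card (W u) = 2 * p" if u: "u \<in> ?V" "al 1 u \<noteq> u" for u
  proof -
    have "inj_on (\<lambda>x. al x u) ?R"
      by (rule inj_onI) (use free[OF u] eqv_small in blast)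
    then have cOrb: "card (Orb u) = p" unfolding Orb_def by (simp add: card_image)
    have "inj_on \<tau> (Orb u)" using tau_inj OV[OF u(1)] by (intro inj_onI) blast
    then have "card (\<tau> ` Orb u) = p" using cOrb by (simp add: card_image)
    moreover have "Orb u \<inter> \<tau> ` Orb u = {}"
    proof (rule ccontr)
      assume "Orb u \<inter> \<tau> ` Orb u \<noteq> {}"
      then obtain x y where xy: "al x u = \<tau> (al y u)" unfolding Orb_def by blast
      then have "x \<asymp> y" using free[OF u] by blast
      then have "al x u = al y u" using al_cong by metis
      then show False using xy \<tau>[OF alV[OF u(1), of y]] by simp
    qed
    ultimately show ?thesis unfolding W_def using cOrb by (subst card_Un_disjoint) (auto simp: Orb_def)
  qed
  have W_moved: "al 1 w \<noteq> w" if u: "u \<in> ?V" "al 1 u \<noteq> u" and w: "w \<in> W u" for u w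
  proof -
    have o: "al 1 (al x u) \<noteq> al x u" for x
    proof
      assume "al 1 (al x u) = al x u"
      then have "al (1 + x) u = al x u" by (simp add: al_add[OF u(1)])
      then have "1 + x \<asymp> x" using free[OF u] by blast
      then show False using one_not_eqv_0 by (simp add: cong_iff_dvd_diff cong_0_iff)
    qed
    show ?thesis
    proof (cases "w \<in> Orb u")
      case True then show ?thesis using o unfolding Orb_def by blast
    next
      case False
      then obtain x where x: "w = \<tau> (al x u)" using w unfolding W_def Orb_def by blast
      then show ?thesis using o[of x] tau_inj[OF alV[OF alV[OF u(1)]] alV[OF u(1)]] al_tau[OF alV[OF u(1)]] by simp
    qed
  qed
  have WV: "W u \<subseteq> ?V" if "u \<in> ?V" for u unfolding W_def using OV[OF that] \<tau> by blast
  have tauW: "\<tau> w \<in> W u" if "w \<in> W u" "u \<in> ?V" for w u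
    using that \<tau> OV[OF that(2)] unfolding W_def by auto
  have finW: "finite (W u)" for u unfolding W_def Orb_def by simp
  have rest: "?V = W u \<union> {v, \<tau> v}" if u: "u \<in> ?V" "al 1 u \<noteq> u" and v: "v \<in> ?V" "v \<notin> W u" for u v
  proof -
    have t: "\<tau> v \<notin> W u" using tauW[OF _ u(1), of "\<tau> v"] \<tau>[OF v(1)] v(2) by auto
    have "card (W u \<union> {v, \<tau> v}) = 2 * p + 2"
      using t v \<tau>[OF v(1)] finW cardW[OF u] by (subst card_Un_disjoint) auto
    then show ?thesis using cardV WV[OF u(1)] v(1) \<tau>[OF v(1)] pair_finite_verts
      by (intro card_subset_eq[symmetric]) auto
  qed
  obtain u0 where u0: "u0 \<in> ?V" "al 1 u0 \<noteq> u0" using moved by blast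
  obtain u1 where u1: "u1 \<in> ?V" "u1 \<notin> W u0"
  proof -
    have "\<not> ?V \<subseteq> W u0" using card_mono[OF finW, of ?V u0] cardV cardW[OF u0] by auto
    then show ?thesis using that by blast
  qed
  \<comment> \<open>Since \<open>W u0\<close> is invariant under the unipotent elements,
    \<open>al 1\<close> keeps \<open>u1\<close> in the remaining fibre, and by \<open>fixed\<close>
    it cannot move it there.\<close>
  have u1fix: "al x u1 = u1" for x
  proof -
    have "al 1 u1 \<notin> W u0"
    proof
      assume w: "al 1 u1 \<in> W u0"
      have "al (- 1) w \<in> W u0" if w: "w \<in> W u0" for w
      proof (cases "w \<in> Orb u0")
        case True
        then obtain x where "w = al x u0" unfolding Orb_def by blast
        then show ?thesis using Orb_mem by (simp add: W_def al_add[OF u0(1)])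
      next
        case False
        then obtain x where "w = \<tau> (al x u0)" using w unfolding W_def Orb_def by blast
        then show ?thesis using Orb_mem by (simp add: W_def al_tau[OF alV[OF u0(1)]] al_add[OF u0(1)])
      qed
      from this[OF w] have "u1 \<in> W u0" by (simp add: al_add[OF u1(1)] al_0[OF _ u1(1)])
      then show False using u1(2) by blast
    qed
    then have "al 1 u1 \<in> {u1, \<tau> u1}" using rest[OF u0 u1] alV[OF u1(1), of 1] by blast
    then show ?thesis by (rule fixed[OF _ one_not_eqv_0 u1(1)])
  qed
  have tu1: "\<tau> u1 \<in> ?V" "al x (\<tau> u1) = \<tau> u1" for x using \<tau>[OF u1(1)] al_tau[OF u1(1)] u1fix by auto
  \<comment> \<open>One of \<open>u0\<close> and its antipode is adjacent to \<open>u1\<close>, and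
    both are moved.\<close>
  obtain n0 where n0: "n0 \<in> ?V" "al 1 n0 \<noteq> n0" "(u1, n0) \<in> ?A"
  proof (cases "(u1, u0) \<in> ?A")
    case True then show ?thesis using that u0 by blast
  next
    case False
    have "u0 \<in> W u0" using Orb_mem[of 0 u0] al_0[OF _ u0(1), of 0] by (simp add: W_def)
    then have "u0 \<noteq> u1" "u0 \<noteq> \<tau> u1" using u1 u0(2) tu1(2)[of 1] by auto
    then have "(u1, \<tau> u0) \<in> ?A" using adj_tau[OF u1(1) u0(1)] False by simp
    moreover have "al 1 (\<tau> u0) \<noteq> \<tau> u0"
      unfolding al_tau[OF u0(1)] using tau_inj[OF alV[OF u0(1)] u0(1), of 1] u0(2) by simp
    ultimately show ?thesis using that[of "\<tau> u0"] \<tau>[OF u0(1)] by blast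
  qed
  have u1W: "u1 \<notin> W n0" using W_moved[OF n0(1,2)] u1fix by blast
  have V_eq: "?V = W n0 \<union> {u1, \<tau> u1}" by (rule rest[OF n0(1,2) u1(1) u1W])
  define n where "n x = al x n0" for x
  have nV: "n x \<in> ?V" for x unfolding n_def by (rule alV[OF n0(1)])
  have n_eq: "n x = n y \<longleftrightarrow> x \<asymp> y" for x y
  proof
    assume "n x = n y"
    then show "x \<asymp> y" using free[OF n0(1,2), of x y] unfolding n_def by simp
  qed (simp add: n_def al_cong)
  have n_tau: "n x \<noteq> \<tau> (n y)" for x y
  proof
    assume e: "n x = \<tau> (n y)"
    then have "x \<asymp> y" using free[OF n0(1,2), of x y] unfolding n_def by blast
    then show False using e n_eq[of x y] \<tau>[OF nV, of y] by simp
  qed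
  have n_u1: "n x \<noteq> u1" "n x \<noteq> \<tau> u1" "\<tau> (n x) \<noteq> u1" "\<tau> (n x) \<noteq> \<tau> u1" for x
  proof -
    have w: "n x \<in> W n0" using Orb_mem unfolding W_def n_def by blast
    have w': "\<tau> (n x) \<in> W n0" using tauW[OF w n0(1)] .
    have tu: "\<tau> u1 \<notin> W n0" using W_moved[OF n0(1,2)] tu1(2) by blast
    show "n x \<noteq> u1" "n x \<noteq> \<tau> u1" "\<tau> (n x) \<noteq> u1" "\<tau> (n x) \<noteq> \<tau> u1" using w w' tu u1W by auto
  qed
  have V_cases: "(\<exists>x\<in>?R. v = n x) \<or> (\<exists>x\<in>?R. v = \<tau> (n x)) \<or> v = u1 \<or> v = \<tau> u1" if "v \<in> ?V" for v
    using that unfolding V_eq W_def Orb_def n_def by blast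
  have u1n: "(u1, n x) \<in> ?A" for x
    using alA[OF u1(1) n0(1), of x] n0(3) u1fix unfolding n_def by simp
  have u1tn: "(u1, \<tau> (n x)) \<notin> ?A" for x
    using adj_tau[OF u1(1) nV, of x] n_u1 u1n by simp
  have nbr_u1: "\<exists>c. v = n c" if "(u1, v) \<in> ?A" for v
    using V_cases[OF arcsV(2)[OF that]] that u1tn noloop \<tau>[OF u1(1)] by blast
  define S where "S z \<longleftrightarrow> (n 0, n z) \<in> ?A" for z
  have nn: "(n x, n y) \<in> ?A \<longleftrightarrow> S (y - x)" for x y
    using alA[OF nV[of 0] nV[of "y - x"], of x] unfolding S_def by (simp add: n_def al_add[OF n0(1)])
  have S_cong: "S x \<longleftrightarrow> S y" if "x \<asymp> y" for x y using n_eq that unfolding S_def by metis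
  have ntn: "(n x, \<tau> (n y)) \<in> ?A \<longleftrightarrow> \<not> x \<asymp> y \<and> \<not> S (y - x)" for x y
  proof (cases "x \<asymp> y")
    case True
    then have "n y = n x" using n_eq[of x y] by simp
    then show ?thesis using True \<tau>[OF nV] by simp
  next
    case False
    then have "n y \<noteq> n x" using n_eq[of x y] by auto
    then show ?thesis using adj_tau[OF nV nV, of y x] n_tau[of y x] nn[of x y] False by simp
  qed
  have S_square: "S (t * t * z) \<longleftrightarrow> S z" if t: "\<not> t \<asymp> 0" for t z
  proof -
    obtain s where s: "t * s \<asymp> 1" using ex_inverse[OF t] by blast
    let ?D = "(t, 0, 0, s)"
    have dD: "mdet ?D \<asymp> 1" using s by (simp add: mdet_def)
    \<comment> \<open>Conjugation by the diagonal matrix multiplies the unipotent parameter by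
      \<open>t * t\<close>. Hence the diagonal element maps \<open>u1\<close> to a vertex that is
      again fixed by the unipotent ones, that is, into the same fibre.\<close>
    have comm: "\<phi> ?D (al x u) = al (t * t * x) (\<phi> ?D u)" if u: "u \<in> ?V" for x u
    proof -
      have "t * x \<asymp> t * t * x * s" using s by Groebner_Basis.algebra
      then have "\<phi> (mmul ?D (1, x, 0, 1)) = \<phi> (mmul (1, t * t * x, 0, 1) ?D)"
        by (intro \<phi>pr) (simp add: pr_eq_iff mmul_def meqv_iff)
      then show ?thesis unfolding al_def using \<phi>m[OF dD dT u, of x] \<phi>m[OF dT dD u, of "t * t * x"] by simp
    qed
    have DV: "\<phi> ?D u \<in> ?V" if "u \<in> ?V" for u using \<phi>V[OF dD that that] .
    have "t * t * (s * s) \<asymp> 1" using s by Groebner_Basis.algebra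
    then have "al 1 (\<phi> ?D u1) = \<phi> ?D u1" using comm[OF u1(1), of "s * s"] u1fix al_cong by metis
    then have Du1: "\<phi> ?D u1 = u1 \<or> \<phi> ?D u1 = \<tau> u1"
      using W_moved[OF n0(1,2)] DV[OF u1(1)] unfolding V_eq by blast
    \<comment> \<open>The diagonal element may exchange \<open>u1\<close> with its antipode.
      Correcting by \<open>\<tau>\<close> in that case yields a map that fixes \<open>u1\<close> and
      so permutes its neighbours \<open>n x\<close>.\<close>
    define \<sigma> where "\<sigma> v = (if \<phi> ?D u1 = u1 then v else \<tau> v)" for v
    have \<sigma>A: "(\<sigma> u, \<sigma> v) \<in> ?A \<longleftrightarrow> (u, v) \<in> ?A" if "u \<in> ?V" "v \<in> ?V" for u v
      using adj_tau_tau[OF that] by (simp add: \<sigma>_def)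
    have \<sigma>al: "\<sigma> (al x u) = al x (\<sigma> u)" if "u \<in> ?V" for x u using al_tau[OF that] by (simp add: \<sigma>_def)
    have "\<sigma> (\<phi> ?D u1) = u1" using Du1 \<tau>[OF u1(1)] by (auto simp: \<sigma>_def)
    moreover have "(\<sigma> (\<phi> ?D u1), \<sigma> (\<phi> ?D n0)) \<in> ?A"
      using \<sigma>A[OF DV[OF u1(1)] DV[OF n0(1)]] \<phi>A[OF dD u1(1) n0(1)] n0(3) by simp
    ultimately obtain c where c: "\<sigma> (\<phi> ?D n0) = n c" using nbr_u1 by auto
    have \<sigma>n: "\<sigma> (\<phi> ?D (n x)) = n (t * t * x + c)" for x
    proof -
      have "\<sigma> (\<phi> ?D (n x)) = al (t * t * x) (\<sigma> (\<phi> ?D n0))"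
        unfolding n_def comm[OF n0(1)] by (rule \<sigma>al[OF DV[OF n0(1)]])
      then show ?thesis unfolding c by (simp add: n_def al_add[OF n0(1)])
    qed
    have "S z \<longleftrightarrow> (\<sigma> (\<phi> ?D (n 0)), \<sigma> (\<phi> ?D (n z))) \<in> ?A"
      unfolding \<sigma>A[OF DV[OF nV] DV[OF nV]] \<phi>A[OF dD nV nV] S_def ..
    also have "\<dots> \<longleftrightarrow> S (t * t * z)" unfolding \<sigma>n nn by simp
    finally show ?thesis by blast
  qed
  have S0: "\<not> S z" if "z \<asymp> 0" for z using S_cong[OF that] noloop unfolding S_def by simp
  have S_res: "S z \<longleftrightarrow> S 1" if z: "chi z = 1" for z
  proof -
    obtain t where t: "t * t \<asymp> z" "\<not> t \<asymp> 0" using chi_eq_1D[OF z] .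
    show ?thesis using S_cong[OF t(1)] S_square[OF t(2), of 1] by simp
  qed
  have S_nres: "S z \<longleftrightarrow> S nu" if z: "chi z = - 1" for z
  proof -
    have "chi (mu * z) = 1" using z chi_inverse[OF nu_mu] by (simp add: chi_mult)
    then obtain t where t: "t * t \<asymp> mu * z" "\<not> t \<asymp> 0" by (rule chi_eq_1D)
    have "t * t * nu \<asymp> z" using t(1) nu_mu by Groebner_Basis.algebra
    then show ?thesis using S_cong S_square[OF t(2), of nu] by blast
  qed
  have S_minus: "S (- z) \<longleftrightarrow> S z" for z
    using nn[of 0 z] nn[of z 0] symA[of "n 0" "n z"] by simp
  have not_none: "S 1 \<or> S nu"
  proof (rule ccontr)
    assume none: "\<not> (S 1 \<or> S nu)"
    have noS: "\<not> S z" for z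
      using chi_cases[of z] S0[of z] S_res[of z] S_nres[of z] none chi_eq_0_iff by blast
    \<comment> \<open>With \<open>S\<close> empty, the points \<open>n x\<close> are pairwise
      nonadjacent and \<open>\<tau> u1\<close> is adjacent to none of them; \<open>\<tau>\<close>
      maps this half to the other.\<close>
    let ?P = "insert (\<tau> u1) (range n)" and ?Q = "insert u1 (range (\<lambda>x. \<tau> (n x)))"
    have "bipartite_graph G" unfolding bipartite_graph_def
    proof (intro exI conjI)
      show "?V = ?P \<union> ?Q" using V_cases nV \<tau>[OF nV] \<tau>[OF u1(1)] u1(1) by blast
      show "?P \<inter> ?Q = {}" using n_u1 n_tau \<tau>[OF u1(1)] by fastforce
      have PP: "(x, y) \<notin> ?A" if "x \<in> ?P" "y \<in> ?P" for x y
        using that nn noS noloop adj_tau_tau[OF u1(1) nV] u1tn \<tau>[OF nV] symA tu1(1)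
          adj_tau_tau[OF u1(1), of "\<tau> (n _)"] by (metis insert_iff rangeE)
      have QQ: "(x, y) \<notin> ?A" if "x \<in> ?Q" "y \<in> ?Q" for x y
        using that nn noS noloop adj_tau_tau[OF nV nV] u1tn symA by (metis insert_iff rangeE)
      show "?A \<subseteq> ?P \<times> ?Q \<union> ?Q \<times> ?P"
      proof
        fix e assume e: "e \<in> ?A"
        obtain x y where xy: "e = (x, y)" by (cases e)
        have "x \<in> ?P \<union> ?Q" "y \<in> ?P \<union> ?Q"
          using arcsV[of x y] e xy V_cases[of x] V_cases[of y] by blast+
        then show "e \<in> ?P \<times> ?Q \<union> ?Q \<times> ?P" using PP[of x y] QQ[of x y] e xy by blast
      qed
    qed
    then show False using nb by blast
  qed
  have not_all: "\<not> (S 1 \<and> S nu)"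
  proof
    assume all: "S 1 \<and> S nu"
    have allS: "S z" if "\<not> z \<asymp> 0" for z using chi_cases'[OF that] S_res[of z] S_nres[of z] all by blast
    \<comment> \<open>With every nonzero residue in \<open>S\<close>, no arc leaves
      \<open>?K\<close>. It contains one vertex of each fibre, so \<open>\<tau> u1\<close> is out of
      reach from \<open>u1\<close>.\<close>
    let ?K = "insert u1 (range n)"
    have nu1: "(n x, \<tau> u1) \<notin> ?A" for x
      using adj_tau_tau[OF u1(1), of "\<tau> (n x)"] u1tn[of x] \<tau>[OF nV, of x] symA by metis
    have ntn0: "(n x, \<tau> (n y)) \<notin> ?A" for x y
    proof (cases "x \<asymp> y")
      case False
      then have "\<not> y - x \<asymp> 0" by (metis cong_iff_dvd_diff cong_sym diff_zero)
      then show ?thesis using ntn allS by blast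
    qed (use ntn in blast)
    have step: "y \<in> ?K" if "x \<in> ?K" "(x, y) \<in> ?A" for x y
      using that nbr_u1[of y] nu1 ntn0 V_cases[OF arcsV(2)[OF that(2)]] by blast
    have "y \<in> ?K" if "x \<in> ?K" "(x, y) \<in> ?A ^^ k" for x y k
      using that
    proof (induction k arbitrary: x)
      case (Suc k)
      then obtain z where "(x, z) \<in> ?A" "(z, y) \<in> ?A ^^ k" by (meson relpow_Suc_D2)
      then show ?case using Suc.IH step Suc.prems(1) by blast
    qed simp
    moreover have "\<exists>k. (u1, \<tau> u1) \<in> ?A ^^ k"
    proof -
      have "u1 \<rightarrow>\<^sup>*\<^bsub>with_proj (mk_symmetric (with_proj G))\<^esub> \<tau> u1"
        using con u1(1) tu1(1) unfolding connected_def strongly_connected_def by (simp add: mk_symmetric_def)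
      then have "u1 \<rightarrow>\<^sup>*\<^bsub>with_proj G\<^esub> \<tau> u1" using reachable_mk_symmetric_eq[OF pair_sym_arcs] by blast
      then obtain q where "awalk u1 q (\<tau> u1)" unfolding reachable_awalk by (elim exE)
      then show ?thesis using awalk_iff_relpow[OF u1(1)] by blast
    qed
    ultimately have "\<tau> u1 \<in> ?K" by blast
    then show False using \<tau>[OF u1(1)] n_u1(2) by (metis insert_iff rangeE)
  qed
  \<comment> \<open>Exactly one of \<open>S 1\<close> and \<open>S nu\<close> holds. Rescaling the
    parameter by \<open>e\<close> turns the set into the squares in both cases.\<close>
  define e where "e = (if S 1 then 1 else nu)"
  have e0: "\<not> e \<asymp> 0" using one_not_eqv_0 nu_not_0 by (simp add: e_def)
  have Se: "S (e * z) \<longleftrightarrow> chi z = 1" for z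
  proof -
    have "S (e * z) \<longleftrightarrow> (if chi (e * z) = 1 then S 1 else if chi (e * z) = - 1 then S nu else False)"
      using S_res[of "e * z"] S_nres[of "e * z"] S0[of "e * z"] chi_cases[of "e * z"] chi_eq_0_iff[of "e * z"] by auto
    then show ?thesis using not_none not_all chi_cases[of z] by (auto simp: e_def chi_mult)
  qed
  define n' where "n' x = n (e * x)" for x
  have n'n': "(n' x, n' y) \<in> ?A \<longleftrightarrow> chi (x - y) = 1" for x y
  proof -
    have "(n' x, n' y) \<in> ?A \<longleftrightarrow> S (e * (y - x))" unfolding n'_def nn by (simp add: right_diff_distrib)
    also have "\<dots> \<longleftrightarrow> chi (x - y) = 1" unfolding Se using chi_minus[of "x - y"] by simp
    finally show ?thesis .
  qed
  have n'_eq: "n' x = n' y \<longleftrightarrow> x \<asymp> y" for x y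
  proof -
    have "e * x \<asymp> e * y \<longleftrightarrow> x \<asymp> y" using mult_eqv_cancel[OF _ e0] by (auto intro: cong_scalar_left)
    then show ?thesis unfolding n'_def n_eq .
  qed
  have n'tn': "(n' x, \<tau> (n' y)) \<in> ?A \<longleftrightarrow> chi (x - y) = - 1" for x y
  proof (cases "x \<asymp> y")
    case True
    then have "n' y = n' x" "chi (x - y) = 0" using n'_eq[of x y] chi_eq_0_iff[of "x - y"] by (auto simp: cong_iff_dvd_diff)
    then show ?thesis using \<tau>[OF nV] by (simp add: n'_def)
  next
    case False
    then have "n' y \<noteq> n' x" "chi (x - y) \<noteq> 0" using n'_eq[of x y] chi_eq_0_iff[of "x - y"] by (auto simp: cong_iff_dvd_diff)
    moreover have "(n' x, \<tau> (n' y)) \<in> ?A \<longleftrightarrow> (n' x, n' y) \<notin> ?A"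
      using calculation(1) n_tau unfolding n'_def by (intro adj_tau nV) auto
    ultimately show ?thesis using n'n'[of x y] chi_cases[of "x - y"] by auto
  qed
  have n'_surj: "\<exists>y\<in>?R. n x = n' y" for x
  proof -
    obtain k where k: "e * k \<asymp> 1" using ex_inverse[OF e0] by blast
    define y where "y = k * x mod int p"
    have y: "y \<asymp> k * x" "y \<in> ?R" using p_ge_5 by (simp_all add: y_def)
    then have "x \<asymp> e * y" using k by Groebner_Basis.algebra
    then show ?thesis using y(2) n_eq unfolding n'_def by blast
  qed
  have n'V: "n' x \<in> ?V" for x unfolding n'_def by (rule nV)
  define c where "c l b = (let v = (case l of None \<Rightarrow> u1 | Some x \<Rightarrow> n' x) in if b then v else \<tau> v)" for l b
  have cN: "c None b = (if b then u1 else \<tau> u1)" and cS: "c (Some x) b = (if b then n' x else \<tau> (n' x))" for x b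
    by (simp_all add: c_def)
  have base: "(c l True, c l' True) \<in> ?A \<longleftrightarrow> chi (vdet (line_rep l) (line_rep l')) = 1"
    "(c l True, c l' False) \<in> ?A \<longleftrightarrow> chi (vdet (line_rep l) (line_rep l')) = - 1" for l l'
  proof -
    have d: "vdet (line_rep None) (line_rep None) = 0" "vdet (line_rep None) (line_rep (Some x)) = 1"
      "vdet (line_rep (Some x)) (line_rep None) = - 1" "vdet (line_rep (Some x)) (line_rep (Some y)) = x - y" for x y
      by (simp_all add: line_rep_def vdet_def)
    have 1: "(u1, n' x) \<in> ?A" "(n' x, u1) \<in> ?A" "(u1, \<tau> (n' x)) \<notin> ?A" "(n' x, \<tau> u1) \<notin> ?A" for x
    proof -
      show a: "(u1, n' x) \<in> ?A" "(u1, \<tau> (n' x)) \<notin> ?A" using u1n u1tn unfolding n'_def by auto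
      show b: "(n' x, u1) \<in> ?A" using a(1) symA by blast
      show "(n' x, \<tau> u1) \<notin> ?A" using adj_tau[OF n'V u1(1), of x] n_u1 b \<tau>[OF n'V, of x] unfolding n'_def by metis
    qed
    show "(c l True, c l' True) \<in> ?A \<longleftrightarrow> chi (vdet (line_rep l) (line_rep l')) = 1"
      using 1 n'n' noloop by (cases l; cases l') (simp_all add: cN cS d)
    show "(c l True, c l' False) \<in> ?A \<longleftrightarrow> chi (vdet (line_rep l) (line_rep l')) = - 1"
      using 1 n'tn' \<tau>[OF u1(1)] by (cases l; cases l') (simp_all add: cN cS d)
  qed
  have cV: "c l b \<in> ?V" for l b using n'V \<tau>[OF n'V] u1(1) tu1(1) by (cases l) (simp_all add: cN cS)
  have ct: "c l (\<not> b) = \<tau> (c l b)" for l b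
    using \<tau>[OF n'V] \<tau>[OF u1(1)] by (cases l; cases b) (simp_all add: cN cS)
  show ?thesis
  proof (rule vector_graphI[of G c])
    show "?A \<subseteq> ?V \<times> ?V" using arcsV by auto
    show "?V = {c l b |l b. l \<in> line_indices}"
    proof
      show "?V \<subseteq> {c l b |l b. l \<in> line_indices}"
      proof
        fix v assume "v \<in> ?V"
        then consider x where "v = n x" | x where "v = \<tau> (n x)" | "v = u1" | "v = \<tau> u1" using V_cases by blast
        then have "\<exists>l b. l \<in> line_indices \<and> v = c l b"
        proof cases
          case (1 x)
          then obtain y where "y \<in> ?R" "v = n' y" using n'_surj by metis
          then show ?thesis by (intro exI[of _ "Some y"] exI[of _ True]) (simp add: cS line_indices_def)
        next
          case (2 x)
          then obtain y where "y \<in> ?R" "v = \<tau> (n' y)" using n'_surj by metis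
          then show ?thesis by (intro exI[of _ "Some y"] exI[of _ False]) (simp add: cS line_indices_def)
        next
          case 3
          then show ?thesis by (intro exI[of _ None] exI[of _ True]) (simp add: cN line_indices_def)
        next
          case 4
          then show ?thesis by (intro exI[of _ None] exI[of _ False]) (simp add: cN line_indices_def)
        qed
        then show "v \<in> {c l b |l b. l \<in> line_indices}" by blast
      qed
    qed (use cV in blast)
    show "l = l' \<and> b = b'" if l: "l \<in> line_indices" "l' \<in> line_indices" and eq: "c l b = c l' b'" for l l' b b'
    proof -
      have nn_tau: "\<tau> (n x) \<noteq> n y" for x y using n_tau[of y x] by metis
      have tt: "\<tau> (n x) = \<tau> (n y) \<longleftrightarrow> n x = n y" for x y by (rule tau_inj[OF nV nV])
      have u: "u1 \<noteq> n x" "\<tau> u1 \<noteq> n x" "u1 \<noteq> \<tau> (n x)" "\<tau> u1 \<noteq> \<tau> (n x)" "u1 \<noteq> \<tau> u1" "\<tau> u1 \<noteq> u1" for x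
        using n_u1[of x] \<tau>[OF u1(1)] by metis+
      show ?thesis
      proof (cases l)
        case None
        then show ?thesis using eq u by (cases l'; cases b; cases b') (simp_all add: cN cS n'_def)
      next
        case (Some x)
        show ?thesis
        proof (cases l')
          case None
          then show ?thesis using eq Some n_u1 by (cases b; cases b') (simp_all add: cN cS n'_def)
        next
          case (Some y)
          have lx: "l = Some x" by fact
          have bb: "b = b'" using eq Some lx n_tau nn_tau by (cases b; cases b') (simp_all add: cS n'_def)
          then have "n' x = n' y" using eq Some lx tt by (cases b) (simp_all add: cS n'_def)
          then have "x \<asymp> y" using n'_eq by blast
          then have "x = y" using eqv_small l Some lx by (auto simp: line_indices_def)
          then show ?thesis using bb Some lx by simp
        qed
      qed
    qed
    show "(c l b, c l' b') \<in> ?A \<longleftrightarrow> chi (vdet (line_rep l) (line_rep l')) = (if b = b' then 1 else - 1)" for l l' b b'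
    proof (cases b)
      case True
      then show ?thesis using base[of l l'] by (cases b') simp_all
    next
      case False
      have "(c l b, c l' b') \<in> ?A \<longleftrightarrow> (\<tau> (c l b), \<tau> (c l' b')) \<in> ?A" using adj_tau_tau[OF cV cV] by blast
      also have "\<dots> \<longleftrightarrow> (c l True, c l' (\<not> b')) \<in> ?A" using False ct[of l b] ct[of l' b'] by simp
      also have "\<dots> \<longleftrightarrow> chi (vdet (line_rep l) (line_rep l')) = (if b = b' then 1 else - 1)"
        using base[of l l'] False by (cases b') simp_all
      finally show ?thesis .
    qed
  qed
qed

end

section \<open>Unipotent elements\<close>

text \<open>The orbits have length 1 or \<open>p\<close>, since \<open>p\<close> is prime; the
  induction removes one orbit of length \<open>p\<close> at a time.\<close>

lemma cong_card_fixpoints: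
  fixes \<phi> :: "'b \<Rightarrow> 'b"
  assumes p: "Factorial_Ring.prime (p :: nat)" and fin: "finite Y"
    and Y: "\<And>x. x \<in> Y \<Longrightarrow> \<phi> x \<in> Y" and per: "\<And>x. x \<in> Y \<Longrightarrow> (\<phi> ^^ p) x = x"
  shows "[card Y = card {x \<in> Y. \<phi> x = x}] (mod p)"
  using fin Y per
proof (induction "card Y" arbitrary: Y rule: less_induct)
  case less
  show ?case
  proof (cases "\<forall>x\<in>Y. \<phi> x = x")
    case True
    then have "{x \<in> Y. \<phi> x = x} = Y" by blast
    then show ?thesis by simp
  next
    case False
    then obtain x where x: "x \<in> Y" "\<phi> x \<noteq> x" by blast
    have itY: "(\<phi> ^^ k) y \<in> Y" if "y \<in> Y" for k y using that less.prems(2) by (induction k) auto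
    have per': "(\<phi> ^^ (k mod p)) y = (\<phi> ^^ k) y" if "y \<in> Y" for k y
      by (rule funpow_mod_eq) (rule less.prems(3)[OF that])
    \<comment> \<open>An exponent strictly between 0 and \<open>p\<close> has a multiple that is 1
      modulo \<open>p\<close>, so a point fixed by that power of \<open>\<phi>\<close> is fixed by
      \<open>\<phi>\<close> itself.\<close>
    have fix_all: "\<phi> y = y" if y: "y \<in> Y" and k: "0 < k" "k < p" "(\<phi> ^^ k) y = y" for y k
    proof -
      have "\<not> p dvd k" using k by (simp add: nat_dvd_not_less)
      then have "coprime k p" using prime_imp_coprime[OF p, of k] by (simp add: coprime_commute)
      then obtain l where l: "[k * l = Suc 0] (mod p)" using cong_solve_coprime_nat by blast
      have "(\<phi> ^^ (k * l)) y = y"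
      proof (induction l)
        case (Suc l) then show ?case using k(3) by (simp add: funpow_add)
      qed simp
      moreover have "k * l mod p = 1" using l prime_gt_1_nat[OF p] by (simp add: cong_def)
      ultimately show ?thesis using per'[OF y, of "k * l"] by simp
    qed
    define Orb where "Orb = (\<lambda>k. (\<phi> ^^ k) x) ` {..<p}"
    have memO: "(\<phi> ^^ k) x \<in> Orb" for k
      unfolding Orb_def using per'[OF x(1), of k] prime_gt_0_nat[OF p] by (metis imageI lessThan_iff mod_less_divisor)
    have not_fixed: "\<phi> y \<noteq> y" if y: "y \<in> Orb" for y
    proof
      assume e: "\<phi> y = y"
      obtain k where k: "k < p" "y = (\<phi> ^^ k) x" using y unfolding Orb_def by blast
      have "(\<phi> ^^ l) y = y" for l using e by (induction l) auto
      then have "(\<phi> ^^ (p - k)) y = y" .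
      then have "(\<phi> ^^ p) x = y" using k by (simp add: funpow_add[symmetric, THEN fun_cong, unfolded o_apply])
      then show False using less.prems(3)[OF x(1)] e x(2) by simp
    qed
    have inj: "inj_on (\<lambda>k. (\<phi> ^^ k) x) {..<p}"
    proof (rule linorder_inj_onI)
      fix i j assume ij: "i < j" "i \<in> {..<p}" "j \<in> {..<p}"
      show "(\<phi> ^^ i) x \<noteq> (\<phi> ^^ j) x"
      proof
        assume "(\<phi> ^^ i) x = (\<phi> ^^ j) x"
        then have "(\<phi> ^^ (j - i + i)) x = (\<phi> ^^ i) x" using ij by simp
        then have "(\<phi> ^^ (j - i)) ((\<phi> ^^ i) x) = (\<phi> ^^ i) x" by (simp only: funpow_add o_apply)
        moreover have "0 < j - i" "j - i < p" using ij by auto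
        ultimately show False using fix_all[OF itY[OF x(1)], of "j - i" i] not_fixed[OF memO, of i] by blast
      qed
    qed auto
    have cO: "card Orb = p" unfolding Orb_def using inj by (simp add: card_image)
    have OY: "Orb \<subseteq> Y" unfolding Orb_def using itY[OF x(1)] by blast
    let ?Z = "Y - Orb"
    have cY: "card Y = card ?Z + p" using card_Diff_subset[OF _ OY] cO card_mono[OF less.prems(1) OY]
      by (simp add: Orb_def)
    have "[card ?Z = card {x \<in> ?Z. \<phi> x = x}] (mod p)"
    proof (rule less.hyps)
      show "card ?Z < card Y" using cY prime_gt_0_nat[OF p] by simp
      show "finite ?Z" using less.prems(1) by simp
      show "(\<phi> ^^ p) y = y" if "y \<in> ?Z" for y using less.prems(3) that by blast
      show "\<phi> y \<in> ?Z" if y: "y \<in> ?Z" for y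
      proof -
        have "\<phi> y \<notin> Orb"
        proof
          assume "\<phi> y \<in> Orb"
          then obtain k where k: "\<phi> y = (\<phi> ^^ k) x" unfolding Orb_def by blast
          have "y = (\<phi> ^^ (p - 1)) (\<phi> y)"
            using less.prems(3)[of y] y prime_gt_0_nat[OF p] by (metis DiffD1 Suc_diff_1 comp_apply funpow_Suc_right)
          then have "y = (\<phi> ^^ (p - 1 + k)) x" unfolding k by (simp add: funpow_add)
          then show False using memO y by blast
        qed
        then show ?thesis using y less.prems(2) by blast
      qed
    qed
    moreover have "{x \<in> ?Z. \<phi> x = x} = {x \<in> Y. \<phi> x = x}" using not_fixed by blast
    ultimately show ?thesis unfolding cY by (simp add: cong_def)
  qed
qed

context prime_1_mod_4
begin

text \<open>The transvection \<open>w \<mapsto> w + u det(v, w) v\<close>.\<close>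

definition tv :: "int \<times> int \<Rightarrow> int \<Rightarrow> int \<times> int \<times> int \<times> int" where
  "tv v u = (1 - u * fst v * snd v, u * fst v * fst v, - (u * snd v * snd v), 1 + u * fst v * snd v)"

lemma mdet_tv [simp]: "mdet (tv v u) = 1"
  by (simp add: mdet_def tv_def algebra_simps)

lemma act_tv: "act (tv v u) w = (fst w + u * vdet v w * fst v, snd w + u * vdet v w * snd v)"
  by (simp add: act_def tv_def vdet_def algebra_simps)

lemma act_tv_self: "act (tv v u) v = v"
  by (simp add: act_tv vdet_def)

lemma tv_add: "mmul (tv v u) (tv v u') = tv v (u + u')"
  by (simp add: mmul_def tv_def algebra_simps)

lemma tv_0: "tv v 0 = (1, 0, 0, 1)"
  by (simp add: tv_def)

lemma tv_cong: "u \<asymp> u' \<Longrightarrow> v \<asymp>\<^sub>v v' \<Longrightarrow> tv v u \<asymp>\<^sub>m tv v' u'"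
  unfolding tv_def meqv_iff veqv_def by (intro conjI cong_diff cong_add cong_mult cong_refl cong_minus_minus_iff[THEN iffD2]) auto

lemma tv_smul: "tv (smul k v) u = tv v (k * k * u)"
  by (simp add: tv_def smul_def algebra_simps)

text \<open>A matrix of determinant 1 preserves \<open>vdet\<close>, so it carries the transvection
  along \<open>v\<close> to the one along \<open>act M v\<close>.\<close>

lemma tv_conj: assumes "mdet M \<asymp> 1"
  shows "mmul (mmul M (tv v u)) (adj M) \<asymp>\<^sub>m tv (act M v) u"
proof -
  obtain a b c d where M: "M = (a, b, c, d)" by (cases M)
  obtain x y where v: "v = (x, y)" by (cases v)
  have D: "a * d - b * c \<asymp> 1" using assms by (simp add: M mdet_def)
  have "a * d - b * c - u * (a * x + b * y) * (c * x + d * y) \<asymp> 1 - u * (a * x + b * y) * (c * x + d * y)"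
    "a * d - b * c + u * (a * x + b * y) * (c * x + d * y) \<asymp> 1 + u * (a * x + b * y) * (c * x + d * y)"
    using D by Groebner_Basis.algebra+
  then show ?thesis
    by (simp add: M v mmul_def tv_def adj_def act_def meqv_iff) (simp add: algebra_simps)
qed

text \<open>Complete \<open>v\<close> to a basis \<open>v\<close>, \<open>w\<close> of determinant
  1. Subtracting the identity from \<open>M\<close> gives a map that kills \<open>v\<close>, hence
  one that multiplies its value \<open>(r, s)\<close> at \<open>w\<close> by the determinant with
  \<open>v\<close>. Determinant 1 of \<open>M\<close> forces \<open>(r, s)\<close> to be parallel to
  \<open>v\<close>.\<close>

lemma fixed_vector_imp_tv:
  assumes M: "mdet M \<asymp> 1" and v: "nz v" and fv: "act M v \<asymp>\<^sub>v v"
  obtains u where "M \<asymp>\<^sub>m tv v u"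
proof -
  obtain x y z t where Me: "M = (x, y, z, t)" by (cases M)
  obtain v1 v2 where ve: "v = (v1, v2)" by (cases v)
  obtain w where "vdet v w \<asymp> 1" using ex_vdet_1[OF v] by blast
  moreover obtain w1 w2 where we: "w = (w1, w2)" by (cases w)
  ultimately have h: "v1 * w2 - v2 * w1 \<asymp> 1" by (simp add: ve vdet_def)
  have f: "x * v1 + y * v2 \<asymp> v1" "z * v1 + t * v2 \<asymp> v2" and d: "x * t - y * z \<asymp> 1"
    using fv M by (simp_all add: Me ve act_def veqv_def mdet_def)
  \<comment> \<open>This is the determinant of \<open>(r, s)\<close> and \<open>w\<close>, the
    factor by which \<open>(r, s)\<close> is a multiple of \<open>v\<close>.\<close>
  define u where "u = w2 * (x * w1 + y * w2) - w1 * (z * w1 + t * w2)"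
  have k: "x - 1 \<asymp> (x * w1 + y * w2 - w1) * (- v2)" "y \<asymp> (x * w1 + y * w2 - w1) * v1"
    "z \<asymp> (z * w1 + t * w2 - w2) * (- v2)" "t - 1 \<asymp> (z * w1 + t * w2 - w2) * v1"
    using f h by Groebner_Basis.algebra+
  define r s where "r = x * w1 + y * w2 - w1" and "s = z * w1 + t * w2 - w2"
  have k': "x \<asymp> 1 - r * v2" "y \<asymp> r * v1" "z \<asymp> - (s * v2)" "t \<asymp> 1 + s * v1"
  proof -
    show "x \<asymp> 1 - r * v2" using k(1)[folded r_def] by Groebner_Basis.algebra
    show "y \<asymp> r * v1" using k(2)[folded r_def] .
    show "z \<asymp> - (s * v2)" using k(3)[folded s_def] by simp
    show "t \<asymp> 1 + s * v1" using k(4)[folded s_def] by Groebner_Basis.algebra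
  qed
  have p: "r * v2 \<asymp> s * v1" using k' d by Groebner_Basis.algebra
  have u: "u = w2 * r - w1 * s" by (simp add: u_def r_def s_def algebra_simps)
  have rs: "r \<asymp> u * v1" "s \<asymp> u * v2" unfolding u using p h by Groebner_Basis.algebra+
  have "x \<asymp> 1 - u * v1 * v2" "y \<asymp> u * v1 * v1" "z \<asymp> - (u * v2 * v2)" "t \<asymp> 1 + u * v1 * v2"
    using k' rs by Groebner_Basis.algebra+
  then have "M \<asymp>\<^sub>m tv v u" by (simp add: Me ve tv_def meqv_iff)
  then show ?thesis by (rule that)
qed

lemma tv_eqv_iff: assumes "nz v" shows "tv v u \<asymp>\<^sub>m tv v u' \<longleftrightarrow> u \<asymp> u'"
proof
  assume "tv v u \<asymp>\<^sub>m tv v u'"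
  then have e: "u * fst v * fst v \<asymp> u' * fst v * fst v" "- (u * snd v * snd v) \<asymp> - (u' * snd v * snd v)"
    by (simp_all add: tv_def meqv_iff)
  have "(u - u') * (fst v * fst v) \<asymp> 0" "(u - u') * (snd v * snd v) \<asymp> 0"
    using e by Groebner_Basis.algebra+
  then have "u - u' \<asymp> 0" using assms unfolding mult_eqv_0_iff nz_def by blast
  then show "u \<asymp> u'" by (simp add: cong_iff_dvd_diff)
qed (simp add: tv_cong)

text \<open>A transvection has trace 2, the negative of one has trace - 2, and 4 is nonzero modulo
  \<open>p\<close>. So the sign ambiguity of \<open>pr\<close> does not confuse
  transvections.\<close>

lemma mtrace_tv: assumes "tv v u \<asymp>\<^sub>m smat (- 1) (tv w u')" shows False
proof -
  have "1 - u * fst v * snd v \<asymp> - (1 - u' * fst w * snd w)" "1 + u * fst v * snd v \<asymp> - (1 + u' * fst w * snd w)"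
    using assms by (simp_all add: tv_def smat_def meqv_iff)
  then have "2 * 2 \<asymp> 0" by Groebner_Basis.algebra
  then show False using two_not_eqv_0 mult_eqv_0_iff by blast
qed

lemma pr_tv_eq_iff: "nz v \<Longrightarrow> pr (tv v u) = pr (tv v u') \<longleftrightarrow> u \<asymp> u'"
  unfolding pr_eq_iff using tv_eqv_iff mtrace_tv by blast

section \<open>Powers and elements of order p\<close>

primrec mpow :: "int \<times> int \<times> int \<times> int \<Rightarrow> nat \<Rightarrow> int \<times> int \<times> int \<times> int" where
  "mpow M 0 = (1, 0, 0, 1)"
| "mpow M (Suc n) = mmul (mpow M n) M"

lemma pr_pow: "pr M [^]\<^bsub>PSL2 p\<^esub> (n :: nat) = pr (mpow M n)"
  by (induction n) (simp_all add: nat_pow_def one_PSL2 mult_PSL2)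

lemma mdet_mpow: "mdet M \<asymp> 1 \<Longrightarrow> mdet (mpow M n) \<asymp> 1"
proof (induction n)
  case (Suc n)
  then show ?case using cong_mult[of "mdet (mpow M n)" 1 _ "mdet M" 1] by (simp add: mdet_mmul)
qed simp

lemma mpow_smat: "mpow (smat k M) n = smat (k ^ n) (mpow M n)"
  by (induction n) (simp_all add: mmul_smat smat_smat mult.commute)

lemma mpow_tv: "mpow (tv v u) n = tv v (int n * u)"
  by (induction n) (simp_all add: tv_0 tv_add algebra_simps)

lemma act_mpow_eigen: "act M v \<asymp>\<^sub>v smul k v \<Longrightarrow> act (mpow M n) v \<asymp>\<^sub>v smul (k ^ n) v"
proof (induction n)
  case 0
  then show ?case by (simp add: act_def veqv_def smul_def)
next
  case (Suc n)
  have 1: "act (mpow M n) (act M v) \<asymp>\<^sub>v act (mpow M n) (smul k v)" by (rule veqv_act[OF Suc.prems])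
  have 2: "act (mpow M n) (smul k v) \<asymp>\<^sub>v smul k (smul (k ^ n) v)"
    unfolding act_smul by (rule veqv_smul[OF cong_refl Suc.IH[OF Suc.prems]])
  show ?case using veqv_trans[OF 1 2] by (simp only: act_mmul smul_smul mpow.simps power_Suc)
qed

text \<open>There are \<open>p * p - 1\<close> nonzero vectors modulo \<open>p\<close>, a number not
  divisible by \<open>p\<close>, so a permutation whose \<open>p\<close>-th power is trivial fixes
  one of them.\<close>

lemma order_p_fixes_vector:
  assumes M: "mdet M \<asymp> 1" and pow: "mpow M p \<asymp>\<^sub>m (1, 0, 0, 1)"
  shows "\<exists>v. nz v \<and> act M v \<asymp>\<^sub>v v"
proof -
  let ?R = "{0..<int p}"
  define Y where "Y = {v \<in> ?R \<times> ?R. v \<noteq> (0, 0)}"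
  define md where "md v = (fst v mod int p, snd v mod int p)" for v :: "int \<times> int"
  define \<phi> where "\<phi> v = md (act M v)" for v
  have md: "md v \<asymp>\<^sub>v v" for v by (simp add: md_def veqv_def)
  have mdR: "md v \<in> ?R \<times> ?R" for v using p_ge_5 by (simp add: md_def)
  have eq: "v = w" if "v \<asymp>\<^sub>v w" "v \<in> ?R \<times> ?R" "w \<in> ?R \<times> ?R" for v w
    using that eqv_small unfolding veqv_def by (cases v; cases w) auto
  have nzY: "nz v \<longleftrightarrow> v \<noteq> (0, 0)" if "v \<in> ?R \<times> ?R" for v
    using that p_ge_5 by (cases v) (auto simp: nz_def cong_def)
  have Y: "v \<in> Y \<longleftrightarrow> v \<in> ?R \<times> ?R \<and> nz v" for v using nzY by (auto simp: Y_def)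
  have det0: "\<not> mdet M \<asymp> 0" using M one_not_eqv_0 not_eqv_0_eqv by blast
  have it: "(\<phi> ^^ n) v \<asymp>\<^sub>v act (mpow M n) v" for n v
  proof (induction n arbitrary: v)
    case 0 then show ?case by (simp add: act_def)
  next
    case (Suc n)
    have 1: "(\<phi> ^^ n) (\<phi> v) \<asymp>\<^sub>v act (mpow M n) (\<phi> v)" by (rule Suc)
    have 2: "act (mpow M n) (\<phi> v) \<asymp>\<^sub>v act (mpow M n) (act M v)" unfolding \<phi>_def by (rule veqv_act[OF md])
    show ?case using veqv_trans[OF 1 2] by (simp only: funpow_Suc_right o_apply act_mmul mpow.simps)
  qed
  have \<phi>Y: "\<phi> v \<in> Y" if "v \<in> Y" for v
    using act_nz[OF det0] that nz_cong[OF md] mdR unfolding Y \<phi>_def by blast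
  have "(\<phi> ^^ n) v \<in> Y" if "v \<in> Y" for n v using that \<phi>Y by (induction n) auto
  then have "(\<phi> ^^ p) v = v" if "v \<in> Y" for v
  proof -
    have "(\<phi> ^^ p) v \<asymp>\<^sub>v act (1, 0, 0, 1) v" using veqv_trans[OF it meqv_act[OF pow]] .
    then show ?thesis using eq that \<open>\<And>v n. v \<in> Y \<Longrightarrow> (\<phi> ^^ n) v \<in> Y\<close> unfolding Y by (simp add: act_def)
  qed
  moreover have finY: "finite Y" by (simp add: Y_def)
  ultimately have c: "[card Y = card {v \<in> Y. \<phi> v = v}] (mod p)"
    using cong_card_fixpoints[OF prime_p finY] \<phi>Y by blast
  have "Y = ?R \<times> ?R - {(0, 0)}" by (auto simp: Y_def)
  then have "card Y = p * p - 1" using p_ge_5 by (simp add: card_Diff_singleton card_cartesian_product)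
  moreover have "\<not> [p * p - 1 = 0] (mod p)"
  proof
    assume "[p * p - 1 = 0] (mod p)"
    then have "p dvd p * p - 1" by (simp add: cong_0_iff)
    then have "p dvd 1" using p_ge_5 by (metis One_nat_def Suc_le_eq dvd_diffD1 dvd_triv_left nat_0_less_mult_iff
      less_le_trans zero_less_numeral)
    then show False using p_ge_5 by simp
  qed
  ultimately have "card {v \<in> Y. \<phi> v = v} \<noteq> 0" using c by metis
  then obtain v where v: "v \<in> Y" "\<phi> v = v" by (metis (mono_tags, lifting) Collect_empty_eq card.empty)
  then have "v \<asymp>\<^sub>v act M v" using md[of "act M v"] unfolding \<phi>_def by simp
  then show ?thesis using v(1) Y veqv_sym by blast
qed

text \<open>A matrix representing \<open>x\<close> has \<open>p\<close>-th power 1 or - 1 up to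
  congruence. As \<open>p\<close> is odd, a change of sign turns the second case into the
  first.\<close>

lemma order_p_unipotent:
  assumes x: "x \<in> carrier (PSL2 p)" and o: "group.ord (PSL2 p) x = p"
  obtains v u where "nz v" "\<not> u \<asymp> 0" "x = pr (tv v u)"
proof -
  interpret group "PSL2 p" by (rule group_PSL2)
  obtain N where N: "mdet N \<asymp> 1" "x = pr N" using PSL2_cases[OF x] .
  have "x [^]\<^bsub>PSL2 p\<^esub> p = \<one>\<^bsub>PSL2 p\<^esub>" using pow_eq_id[OF x] o by simp
  then have "mpow N p \<asymp>\<^sub>m (1, 0, 0, 1) \<or> mpow N p \<asymp>\<^sub>m smat (- 1) (1, 0, 0, 1)"
    unfolding N(2) pr_pow one_PSL2 pr_eq_iff .
  moreover have "odd p" using p_eq by presburger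
  then have "mpow (smat (- 1) N) p = smat (- 1) (mpow N p)" unfolding mpow_smat by simp
  ultimately have "mpow N p \<asymp>\<^sub>m (1, 0, 0, 1) \<or> mpow (smat (- 1) N) p \<asymp>\<^sub>m (1, 0, 0, 1)"
    using meqv_smat[OF _ cong_refl, of "mpow N p" "smat (- 1) (1, 0, 0, 1)" "- 1"] by (auto simp: smat_smat)
  then obtain M where M: "mdet M \<asymp> 1" "x = pr M" "mpow M p \<asymp>\<^sub>m (1, 0, 0, 1)"
  proof
    assume "mpow N p \<asymp>\<^sub>m (1, 0, 0, 1)" then show ?thesis using that N by blast
  next
    assume "mpow (smat (- 1) N) p \<asymp>\<^sub>m (1, 0, 0, 1)"
    then show ?thesis using that[of "smat (- 1) N"] N by (simp add: mdet_smat)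
  qed
  obtain v where v: "nz v" "act M v \<asymp>\<^sub>v v" using order_p_fixes_vector[OF M(1,3)] by blast
  obtain u where u: "M \<asymp>\<^sub>m tv v u" using fixed_vector_imp_tv[OF M(1) v] .
  then have xu: "x = pr (tv v u)" using M(2) pr_eq_iff by simp
  have "\<not> u \<asymp> 0"
  proof
    assume "u \<asymp> 0"
    then have "x = \<one>\<^bsub>PSL2 p\<^esub>" unfolding xu one_PSL2 tv_0[of v, symmetric] pr_tv_eq_iff[OF v(1)] .
    then have "ord x = 1" using ord_eq_1[OF x] by simp
    then show False using o p_ge_5 by simp
  qed
  then show ?thesis using that v(1) xu by blast
qed

lemma generate_nat: assumes "x \<in> carrier (PSL2 p)"
  shows "generate (PSL2 p) {x} = {x [^]\<^bsub>PSL2 p\<^esub> n | n :: nat. True}"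
proof -
  interpret group "PSL2 p" by (rule group_PSL2)
  have "ord x \<noteq> 0" using ord_ge_1[OF finite_PSL2 assms] by simp
  then show ?thesis using generate_pow_nat[OF assms] by simp
qed

lemma generate_tv: assumes v: "nz v" and u: "\<not> u \<asymp> 0"
  shows "generate (PSL2 p) {pr (tv v u)} = {pr (tv v x) | x. True}"
proof -
  have c: "pr (tv v u) \<in> carrier (PSL2 p)" by (rule pr_in_PSL2) simp
  have g: "generate (PSL2 p) {pr (tv v u)} = {pr (tv v (int n * u)) | n :: nat. True}"
    unfolding generate_nat[OF c] pr_pow mpow_tv ..
  have "\<exists>n :: nat. pr (tv v x) = pr (tv v (int n * u))" for x
  proof -
    obtain k where k: "u * k \<asymp> 1" using ex_inverse[OF u] by blast
    define n where "n = nat (x * k mod int p)"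
    have "int n \<asymp> x * k" using p_ge_5 by (simp add: n_def)
    then have "x \<asymp> int n * u" using k by Groebner_Basis.algebra
    then show ?thesis using pr_tv_eq_iff[OF v] by blast
  qed
  then show ?thesis unfolding g by blast
qed

end

section \<open>The coset graphs\<close>

context prime_1_mod_4
begin

lemma sim_act_pr: assumes "pr M = pr N" shows "sim (act M w) (act N w)"
proof -
  have "M \<asymp>\<^sub>m smat 1 N \<or> M \<asymp>\<^sub>m smat (- 1) N" using assms pr_eq_iff by simp
  then obtain s where s: "chi s = 1" "M \<asymp>\<^sub>m smat s N" by (metis chi_1 chi_minus_1)
  have "act M w \<asymp>\<^sub>v smul s (act N w)" using meqv_act[OF s(2), of w] by (simp add: act_smat)
  then show ?thesis using sim_trans[OF sim_veqv sim_sym[OF sim_smul[OF s(1)]]] by blast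
qed

text \<open>The matrix is \<open>P\<close> times the inverse of \<open>N\<close>, whose columns are
  the given vectors; \<open>k\<close> stands for division by the determinant of \<open>N\<close>.
  Equal determinants make its determinant 1.\<close>

lemma transitive_on_pairs:
  assumes e: "vdet v v' \<asymp> vdet w w'" and n: "\<not> vdet v v' \<asymp> 0"
  obtains M where "mdet M \<asymp> 1" "act M v \<asymp>\<^sub>v w" "act M v' \<asymp>\<^sub>v w'"
proof -
  define D where "D = vdet v v'"
  obtain k where k: "D * k \<asymp> 1" using ex_inverse n D_def by metis
  define N where "N = (fst v, fst v', snd v, snd v')"
  define P where "P = (fst w, fst w', snd w, snd w')"
  define M where "M = smat k (mmul P (adj N))"
  have dN: "mdet N = D" "mdet P = vdet w w'" by (simp_all add: N_def P_def mdet_def vdet_def D_def algebra_simps)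
  have e': "vdet w w' \<asymp> D" using e D_def cong_sym by simp
  have "k * k * (vdet w w' * D) \<asymp> 1" using k e' by Groebner_Basis.algebra
  then have "mdet M \<asymp> 1" by (simp add: M_def mdet_smat mdet_mmul dN)
  moreover have kD: "k * D \<asymp> 1" using k by (simp add: mult.commute)
  have "act (adj N) v = (D, 0)" "act (adj N) v' = (0, D)"
    by (simp_all add: act_def adj_def N_def D_def vdet_def algebra_simps)
  then have "act M v = smul (k * D) w" "act M v' = smul (k * D) w'"
    unfolding M_def act_smat act_mmul by (simp_all add: act_def P_def smul_def algebra_simps)
  then have "act M v \<asymp>\<^sub>v w" "act M v' \<asymp>\<^sub>v w'" using veqv_smul[OF kD veqv_refl] by (simp_all add: smul_1)
  ultimately show ?thesis by (rule that)
qed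

lemma transitive_on_vectors:
  assumes "nz v" "nz w"
  obtains M where "mdet M \<asymp> 1" "act M v \<asymp>\<^sub>v w"
proof -
  obtain v' where v': "vdet v v' \<asymp> 1" using ex_vdet_1[OF assms(1)] by blast
  obtain w' where w': "vdet w w' \<asymp> 1" using ex_vdet_1[OF assms(2)] by blast
  have "vdet v v' \<asymp> vdet w w'" by (rule cong_trans[OF v' cong_sym[OF w']])
  moreover have "\<not> vdet v v' \<asymp> 0" using v' one_not_eqv_0 not_eqv_0_eqv by blast
  ultimately show ?thesis using transitive_on_pairs that by metis
qed

text \<open>The set \<open>sim_set v v\<close> is the stabilizer of the class of \<open>v\<close>,
  and its right cosets are the sets \<open>sim_set v w\<close>, so \<open>w\<close> can parametrize
  the vertices of a coset graph.\<close>

definition sim_set :: "int \<times> int \<Rightarrow> int \<times> int \<Rightarrow> (int \<times> int \<times> int \<times> int) set set" where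
  "sim_set v w = {pr M | M. mdet M \<asymp> 1 \<and> sim v (act M w)}"

lemma pr_in_sim_set: assumes "mdet M \<asymp> 1" shows "pr M \<in> sim_set v w \<longleftrightarrow> sim v (act M w)"
proof
  assume "pr M \<in> sim_set v w"
  then obtain N where N: "pr M = pr N" "sim v (act N w)" unfolding sim_set_def by blast
  then show "sim v (act M w)" using sim_trans[OF N(2) sim_sym[OF sim_act_pr[OF N(1)]]] by blast
next
  assume "sim v (act M w)"
  then show "pr M \<in> sim_set v w" using assms unfolding sim_set_def by blast
qed

lemma chi_mdet: "mdet M \<asymp> 1 \<Longrightarrow> chi (mdet M) = 1"
  using chi_cong[of "mdet M" 1] by simp

lemma mdet_mmul_1: "mdet M \<asymp> 1 \<Longrightarrow> mdet N \<asymp> 1 \<Longrightarrow> mdet (mmul M N) \<asymp> 1"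
  unfolding mdet_mmul using cong_mult[of "mdet M" 1 _ "mdet N" 1] by simp

lemma mmul_adj_eqv: "mdet M \<asymp> 1 \<Longrightarrow> mmul (adj M) M \<asymp>\<^sub>m (1, 0, 0, 1) \<and> mmul M (adj M) \<asymp>\<^sub>m (1, 0, 0, 1)"
  unfolding mmul_adj using meqv_smat[OF meqv_refl, of "mdet M" 1 "(1, 0, 0, 1)"] by simp

lemma sim_set_eq_iff: assumes "nz v" "nz w" "nz w'"
  shows "sim_set v w = sim_set v w' \<longleftrightarrow> sim w w'"
proof
  assume e: "sim_set v w = sim_set v w'"
  obtain M where M: "mdet M \<asymp> 1" "act M w \<asymp>\<^sub>v v" using transitive_on_vectors[OF assms(2,1)] .
  have s: "sim v (act M w)" by (rule sim_veqv[OF veqv_sym[OF M(2)]])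
  then have "sim v (act M w')" using pr_in_sim_set[OF M(1)] e by blast
  then have "sim (act M w) (act M w')" using sim_trans[OF sim_sym[OF s]] by blast
  then show "sim w w'" using sim_act_iff[OF chi_mdet[OF M(1)]] by blast
next
  assume s: "sim w w'"
  have "sim v (act M w) \<longleftrightarrow> sim v (act M w')" for M by (rule sim_cong_right[OF act_sim[OF s]])
  then show "sim_set v w = sim_set v w'" unfolding sim_set_def by simp
qed

text \<open>If \<open>N\<close> stabilizes the class of \<open>v\<close>, then \<open>N\<close>
  times \<open>Z\<close> carries the preimage of \<open>v\<close> under \<open>Z\<close> into this
  class. Right cosets are thus indexed by preimages of \<open>v\<close>.\<close>

lemma coset_sim_set: assumes Z: "mdet Z \<asymp> 1"
  shows "sim_set v v #>\<^bsub>PSL2 p\<^esub> pr Z = sim_set v (act (adj Z) v)"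
proof (rule Set.set_eqI)
  fix x
  have aZ: "mdet (adj Z) \<asymp> 1" using Z by simp
  show "x \<in> sim_set v v #>\<^bsub>PSL2 p\<^esub> pr Z \<longleftrightarrow> x \<in> sim_set v (act (adj Z) v)"
  proof
    assume "x \<in> sim_set v v #>\<^bsub>PSL2 p\<^esub> pr Z"
    then obtain N where N: "mdet N \<asymp> 1" "sim v (act N v)" "x = pr N \<otimes>\<^bsub>PSL2 p\<^esub> pr Z"
      unfolding r_coset_def sim_set_def by blast
    have NZ: "mdet (mmul N Z) \<asymp> 1" by (rule mdet_mmul_1[OF N(1) Z])
    have "act (mmul N Z) (act (adj Z) v) = smul (mdet Z) (act N v)" by (simp add: act_mmul act_adj act_smul)
    then have "sim v (act (mmul N Z) (act (adj Z) v))"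
      using sim_trans[OF N(2) sim_smul[OF chi_mdet[OF Z]]] by simp
    then show "x \<in> sim_set v (act (adj Z) v)" using N(3) pr_in_sim_set[OF NZ] by (simp add: mult_PSL2)
  next
    assume "x \<in> sim_set v (act (adj Z) v)"
    then obtain M where M: "mdet M \<asymp> 1" "sim v (act M (act (adj Z) v))" "x = pr M" unfolding sim_set_def by blast
    have MZ: "mdet (mmul M (adj Z)) \<asymp> 1" by (rule mdet_mmul_1[OF M(1) aZ])
    have "pr (mmul M (adj Z)) \<in> sim_set v v" using M(2) pr_in_sim_set[OF MZ] by (simp add: act_mmul)
    moreover have "mmul (mmul M (adj Z)) Z \<asymp>\<^sub>m M"
      unfolding mmul_assoc using meqv_mmul[OF meqv_refl conjunct1[OF mmul_adj_eqv[OF Z]], of M] by simp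
    then have "x = pr (mmul M (adj Z)) \<otimes>\<^bsub>PSL2 p\<^esub> pr Z"
      unfolding M(3) mult_PSL2 pr_eq_iff using meqv_sym by blast
    ultimately show "x \<in> sim_set v v #>\<^bsub>PSL2 p\<^esub> pr Z" unfolding r_coset_def by blast
  qed
qed

text \<open>If the characters agree, some square multiple of \<open>act K v\<close> has the same
  determinant with \<open>v\<close> as \<open>act g v\<close> has. Some \<open>h\<close> then fixes
  \<open>v\<close> and sends \<open>act g v\<close> to this multiple, and the remaining factor
  \<open>h2\<close> of \<open>K\<close> stabilizes the class of \<open>v\<close>.\<close>

lemma double_coset_iff:
  assumes v: "nz v" and g: "mdet g \<asymp> 1" and \<epsilon>: "\<not> vdet v (act g v) \<asymp> 0" and K: "mdet K \<asymp> 1"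
  shows "pr K \<in> double_coset (PSL2 p) (sim_set v v) (pr g) \<longleftrightarrow>
    chi (vdet v (act K v)) = chi (vdet v (act g v))"
proof
  assume "pr K \<in> double_coset (PSL2 p) (sim_set v v) (pr g)"
  then obtain h1 h2 where h: "mdet h1 \<asymp> 1" "sim v (act h1 v)" "mdet h2 \<asymp> 1" "sim v (act h2 v)"
    and e: "pr K = pr h1 \<otimes>\<^bsub>PSL2 p\<^esub> pr g \<otimes>\<^bsub>PSL2 p\<^esub> pr h2"
    unfolding double_coset_def set_mult_def r_coset_def sim_set_def by blast
  have "pr K = pr (mmul (mmul h1 g) h2)" using e by (simp add: mult_PSL2)
  then have s: "sim (act K v) (act h1 (act g (act h2 v)))" using sim_act_pr[of K "mmul (mmul h1 g) h2" v] by (simp add: act_mmul)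
  have "chi (vdet v (act K v)) = chi (vdet (act h1 v) (act h1 (act g (act h2 v))))"
    by (rule chi_vdet_sim[OF h(2) s])
  also have "\<dots> = chi (vdet v (act g (act h2 v)))" by (simp add: vdet_act chi_mult chi_mdet[OF h(1)])
  also have "\<dots> = chi (vdet v (act g v))" by (rule chi_vdet_sim_right[OF sim_sym[OF act_sim[OF h(4)]]])
  finally show "chi (vdet v (act K v)) = chi (vdet v (act g v))" .
next
  assume e: "chi (vdet v (act K v)) = chi (vdet v (act g v))"
  define c c' where "c = vdet v (act K v)" and "c' = vdet v (act g v)"
  have c0: "\<not> c \<asymp> 0" "\<not> c' \<asymp> 0" using \<epsilon> e chi_eq_0_iff by (metis c_def c'_def)+
  obtain k where k: "c * k \<asymp> 1" using ex_inverse[OF c0(1)] by blast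
  define r where "r = c' * k"
  have cr: "chi r = 1"
    using chi_inverse[OF k] e chi_cases'[OF c0(1)] by (auto simp: r_def chi_mult c_def c'_def)
  have "c' \<asymp> r * c" unfolding r_def using k by Groebner_Basis.algebra
  then have "vdet v (act g v) \<asymp> vdet v (smul r (act K v))" by (simp add: vdet_smul c_def c'_def)
  then obtain h where h: "mdet h \<asymp> 1" "act h v \<asymp>\<^sub>v v" "act h (act g v) \<asymp>\<^sub>v smul r (act K v)"
    using transitive_on_pairs[OF _ \<epsilon>] by metis
  define hg where "hg = mmul h g"
  have dhg: "mdet hg \<asymp> 1" unfolding hg_def by (rule mdet_mmul_1[OF h(1) g])
  define h2 where "h2 = mmul (adj hg) K"
  have dh2: "mdet h2 \<asymp> 1" unfolding h2_def by (rule mdet_mmul_1[OF _ K]) (use dhg in simp)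
  have "smul r (act h2 v) = act (adj hg) (smul r (act K v))" by (simp add: h2_def act_mmul act_smul)
  moreover have "act (adj hg) (smul r (act K v)) \<asymp>\<^sub>v act (adj hg) (act hg v)"
    using veqv_act[OF veqv_sym[OF h(3)]] by (simp add: hg_def act_mmul)
  moreover have "act (adj hg) (act hg v) = smul (mdet hg) v" by (rule act_adj)
  ultimately have "sim (smul r (act h2 v)) (smul (mdet hg) v)" using sim_veqv by simp
  then have "sim (smul r (act h2 v)) v" using sim_trans sim_sym[OF sim_smul[OF chi_mdet[OF dhg], of v]] by blast
  then have "sim v (act h2 v)" using sim_trans[OF sim_smul[OF cr, of "act h2 v"]] sim_sym by blast
  then have "pr h2 \<in> sim_set v v" using pr_in_sim_set[OF dh2] by blast
  moreover have "pr h \<in> sim_set v v" using pr_in_sim_set[OF h(1)] sim_veqv[OF veqv_sym[OF h(2)]] by blast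
  moreover have "mmul hg h2 \<asymp>\<^sub>m K"
    unfolding h2_def mmul_assoc[symmetric]
    using meqv_mmul[OF conjunct2[OF mmul_adj_eqv[OF dhg]] meqv_refl, of K] by simp
  then have "pr K = pr h \<otimes>\<^bsub>PSL2 p\<^esub> pr g \<otimes>\<^bsub>PSL2 p\<^esub> pr h2"
    unfolding mult_PSL2 hg_def[symmetric] pr_eq_iff using meqv_sym by blast
  ultimately show "pr K \<in> double_coset (PSL2 p) (sim_set v v) (pr g)"
    unfolding double_coset_def set_mult_def r_coset_def by blast
qed

lemma sim_smul_iff: assumes "\<not> k \<asymp> 0" shows "sim (smul k v) (smul k w) \<longleftrightarrow> sim v w"
proof
  assume s: "sim (smul k v) (smul k w)"
  obtain l where l: "l * k \<asymp> 1" using ex_inverse[OF assms] by (metis mult.commute)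
  have u: "sim (smul l (smul k x)) x" for x
    using sim_veqv[OF veqv_smul[OF l veqv_refl, of x]] by (simp add: smul_smul)
  show "sim v w" using sim_trans[OF sim_sym[OF u] sim_trans[OF sim_smul_cong[OF s] u]] .
qed (rule sim_smul_cong)

lemma adj_adj [simp]: "adj (adj M) = M"
  by (simp add: adj_def split: prod.splits)

text \<open>The coset of \<open>x\<close> stands for the preimage of \<open>v\<close> under
  \<open>x\<close>. By \<open>double_coset_iff\<close> two cosets are adjacent when the determinant
  of their vectors has the same character as \<open>vdet v (act g v)\<close>; it remains to
  normalize this character to 1.\<close>

theorem coset_vector_graph:
  assumes v: "nz v" and g: "mdet g \<asymp> 1" and \<epsilon>: "\<not> vdet v (act g v) \<asymp> 0"
  shows "\<exists>f. vector_graph p f (coset_graph (PSL2 p) (sim_set v v) (double_coset (PSL2 p) (sim_set v v) (pr g)))"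
proof -
  let ?H = "sim_set v v" and ?D = "double_coset (PSL2 p) (sim_set v v) (pr g)"
  let ?G = "coset_graph (PSL2 p) ?H ?D"
  have nzact: "nz (act M w)" if "mdet M \<asymp> 1" "nz w" for M w
    using act_nz[OF chi_1_not_0(1)[OF chi_mdet[OF that(1)]] that(2)] .
  \<comment> \<open>Apply the adjugate of \<open>Y\<close> to both vectors; the factor
    \<open>mdet Y\<close> is 1 modulo \<open>p\<close>.\<close>
  have adjD: "chi (vdet v (act (mmul Y (adj Z)) v)) = chi (vdet (act (adj Z) v) (act (adj Y) v))"
    if "mdet Y \<asymp> 1" for Y Z
  proof -
    have "mdet Y * vdet v (act Y (act (adj Z) v)) = vdet (act (adj Y) v) (act (adj Y) (act Y (act (adj Z) v)))"
      by (simp add: vdet_act)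
    also have "\<dots> = mdet Y * vdet (act (adj Y) v) (act (adj Z) v)" by (simp add: act_adj vdet_smul)
    finally have "chi (mdet Y) * chi (vdet v (act Y (act (adj Z) v))) = chi (mdet Y) * chi (vdet (act (adj Y) v) (act (adj Z) v))"
      by (simp only: chi_mult[symmetric])
    then show ?thesis using chi_mdet[OF that] chi_vdet_swap by (simp add: act_mmul)
  qed
  have coset_cases: "\<exists>Z. mdet Z \<asymp> 1 \<and> x = pr Z" if "x \<in> carrier (PSL2 p)" for x
    using PSL2_cases[OF that] by blast
  have coset_of: "\<exists>Z. mdet Z \<asymp> 1 \<and> ?H #>\<^bsub>PSL2 p\<^esub> pr Z = sim_set v w \<and> sim w (act (adj Z) v)" if w: "nz w" for w
  proof -
    obtain M where M: "mdet M \<asymp> 1" "act M v \<asymp>\<^sub>v w" using transitive_on_vectors[OF v w] .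
    then have a: "mdet (adj M) \<asymp> 1" by simp
    have s: "sim w (act M v)" by (rule sim_veqv[OF veqv_sym[OF M(2)]])
    then have "sim_set v (act M v) = sim_set v w"
      using sim_set_eq_iff[OF v w nzact[OF M(1) v]] by simp
    then show ?thesis using coset_sim_set[OF a, of v] a s by (intro exI[of _ "adj M"]) simp
  qed
  have verts: "pverts ?G = sim_set v ` {w. nz w}"
  proof
    show "pverts ?G \<subseteq> sim_set v ` {w. nz w}"
    proof
      fix B assume "B \<in> pverts ?G"
      then obtain x where x: "x \<in> carrier (PSL2 p)" "B = ?H #>\<^bsub>PSL2 p\<^esub> x"
        unfolding coset_graph_def RCOSETS_def by auto
      obtain Z where Z: "mdet Z \<asymp> 1" "x = pr Z" using coset_cases[OF x(1)] by blast
      have "nz (act (adj Z) v)" using nzact[of "adj Z"] Z(1) v by simp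
      then show "B \<in> sim_set v ` {w. nz w}" using coset_sim_set[OF Z(1), of v] x(2) Z(2) by blast
    qed
    show "sim_set v ` {w. nz w} \<subseteq> pverts ?G"
    proof
      fix B assume "B \<in> sim_set v ` {w. nz w}"
      then obtain w where w: "nz w" "B = sim_set v w" by blast
      obtain Z where Z: "mdet Z \<asymp> 1" "?H #>\<^bsub>PSL2 p\<^esub> pr Z = sim_set v w" using coset_of[OF w(1)] by blast
      then show "B \<in> pverts ?G" using pr_in_PSL2[OF Z(1)] w(2) unfolding coset_graph_def RCOSETS_def by auto
    qed
  qed
  have arcs: "(sim_set v w, sim_set v w') \<in> parcs ?G \<longleftrightarrow> chi (vdet w w') = chi (vdet v (act g v))"
    if w: "nz w" and w': "nz w'" for w w'
  proof
    assume "(sim_set v w, sim_set v w') \<in> parcs ?G"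
    then obtain x y where xy: "x \<in> carrier (PSL2 p)" "y \<in> carrier (PSL2 p)" "y \<otimes>\<^bsub>PSL2 p\<^esub> inv\<^bsub>PSL2 p\<^esub> x \<in> ?D"
      "sim_set v w = ?H #>\<^bsub>PSL2 p\<^esub> x" "sim_set v w' = ?H #>\<^bsub>PSL2 p\<^esub> y"
      unfolding coset_graph_def by auto
    obtain Z where Z: "mdet Z \<asymp> 1" "x = pr Z" using coset_cases[OF xy(1)] by blast
    obtain Y where Y: "mdet Y \<asymp> 1" "y = pr Y" using coset_cases[OF xy(2)] by blast
    have n: "nz (act (adj Z) v)" "nz (act (adj Y) v)" using nzact[of "adj Z"] nzact[of "adj Y"] Z(1) Y(1) v by simp_all
    have s: "sim w (act (adj Z) v)" "sim w' (act (adj Y) v)"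
      using xy(4,5) coset_sim_set[OF Z(1), of v] coset_sim_set[OF Y(1), of v] Z(2) Y(2)
        sim_set_eq_iff[OF v w n(1)] sim_set_eq_iff[OF v w' n(2)] by simp_all
    have YZ: "mdet (mmul Y (adj Z)) \<asymp> 1" using mdet_mmul_1[OF Y(1), of "adj Z"] Z(1) by simp
    have "pr (mmul Y (adj Z)) \<in> ?D" using xy(3) Y(2) Z(2) inv_PSL2[OF Z(1)] by (simp add: mult_PSL2)
    then show "chi (vdet w w') = chi (vdet v (act g v))"
      using double_coset_iff[OF v g \<epsilon> YZ] adjD[OF Y(1), of Z] chi_vdet_sim[OF s] by simp
  next
    assume e: "chi (vdet w w') = chi (vdet v (act g v))"
    obtain Z where Z: "mdet Z \<asymp> 1" "?H #>\<^bsub>PSL2 p\<^esub> pr Z = sim_set v w" "sim w (act (adj Z) v)" using coset_of[OF w] by blast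
    obtain Y where Y: "mdet Y \<asymp> 1" "?H #>\<^bsub>PSL2 p\<^esub> pr Y = sim_set v w'" "sim w' (act (adj Y) v)" using coset_of[OF w'] by blast
    have YZ: "mdet (mmul Y (adj Z)) \<asymp> 1" using mdet_mmul_1[OF Y(1), of "adj Z"] Z(1) by simp
    have "pr (mmul Y (adj Z)) \<in> ?D"
      using double_coset_iff[OF v g \<epsilon> YZ] adjD[OF Y(1), of Z] chi_vdet_sim[OF Z(3) Y(3)] e by simp
    then have "pr Y \<otimes>\<^bsub>PSL2 p\<^esub> inv\<^bsub>PSL2 p\<^esub> pr Z \<in> ?D" using inv_PSL2[OF Z(1)] by (simp add: mult_PSL2)
    moreover have "pr Z \<in> carrier (PSL2 p)" "pr Y \<in> carrier (PSL2 p)" by (rule pr_in_PSL2, fact)+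
    ultimately show "(sim_set v w, sim_set v w') \<in> parcs ?G"
      unfolding coset_graph_def using Z(2) Y(2) by auto
  qed
  \<comment> \<open>Reparametrizing by the diagonal matrix \<open>?L\<close> multiplies every
    determinant by \<open>e\<close>, which interchanges the two possible graphs when the character
    is - 1.\<close>
  define e where "e = (if chi (vdet v (act g v)) = 1 then 1 else nu)"
  have ce: "chi e = chi (vdet v (act g v))" using chi_cases'[OF \<epsilon>] by (auto simp: e_def)
  have e0: "\<not> e \<asymp> 0" using ce \<epsilon> chi_eq_0_iff by metis
  let ?L = "(e, 0, 0, 1)"
  have dL: "mdet ?L = e" by (simp add: mdet_def)
  have nL: "nz (act ?L w)" if "nz w" for w using act_nz[of ?L] that e0 dL by simp
  have sL: "sim (act ?L w) (act ?L w') \<longleftrightarrow> sim w w'" for w w'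
  proof
    assume "sim (act ?L w) (act ?L w')"
    from act_sim[OF this, of "adj ?L"] show "sim w w'" using sim_smul_iff[OF e0] by (simp add: act_adj dL)
  qed (rule act_sim)
  have "vector_graph p (\<lambda>w. sim_set v (act ?L w)) ?G"
  proof
    show "parcs ?G \<subseteq> pverts ?G \<times> pverts ?G"
      unfolding coset_graph_def RCOSETS_def by auto
    show "pverts ?G = (\<lambda>w. sim_set v (act ?L w)) ` {v. nz v}"
    proof
      show "pverts ?G \<subseteq> (\<lambda>w. sim_set v (act ?L w)) ` {v. nz v}"
      proof
        fix B assume "B \<in> pverts ?G"
        then obtain w where w: "nz w" "B = sim_set v w" unfolding verts by blast
        obtain k where k: "e * k \<asymp> 1" using ex_inverse[OF e0] by blast
        have "act ?L (k * fst w, snd w) = (e * k * fst w, snd w)" by (simp add: act_def)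
        moreover have "e * k * fst w \<asymp> fst w" using k by Groebner_Basis.algebra
        ultimately have q: "act ?L (k * fst w, snd w) \<asymp>\<^sub>v w" by (simp add: veqv_def)
        then have nq: "nz (act ?L (k * fst w, snd w))" using nz_cong w(1) by blast
        have "nz (k * fst w, snd w)"
        proof (rule ccontr)
          assume "\<not> nz (k * fst w, snd w)"
          then have "\<not> nz (act ?L (k * fst w, snd w))" by (simp add: nz_def act_def mult_eqv_0_iff)
          then show False using nq by blast
        qed
        moreover have "B = sim_set v (act ?L (k * fst w, snd w))"
          using sim_set_eq_iff[OF v w(1) nq] sim_sym[OF sim_veqv[OF q]] w(2) by simp
        ultimately show "B \<in> (\<lambda>w. sim_set v (act ?L w)) ` {v. nz v}" by blast
      qed
      show "(\<lambda>w. sim_set v (act ?L w)) ` {v. nz v} \<subseteq> pverts ?G" unfolding verts using nL by blast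
    qed
    fix w w' assume w: "nz w" and w': "nz w'"
    show "sim_set v (act ?L w) = sim_set v (act ?L w') \<longleftrightarrow> sim w w'"
      unfolding sim_set_eq_iff[OF v nL[OF w] nL[OF w']] sL ..
    show "(sim_set v (act ?L w), sim_set v (act ?L w')) \<in> parcs ?G \<longleftrightarrow> chi (vdet w w') = 1"
      unfolding arcs[OF nL[OF w] nL[OF w']] vdet_act dL chi_mult ce using chi_cases'[OF \<epsilon>] by auto
  qed
  then show ?thesis by blast
qed

section \<open>Normalizers and the prescribed data\<close>

lemma normalizer_eq:
  assumes "A \<subseteq> carrier (PSL2 p)"
  shows "normalizer (PSL2 p) A = {x \<in> carrier (PSL2 p). {x \<otimes>\<^bsub>PSL2 p\<^esub> y \<otimes>\<^bsub>PSL2 p\<^esub> inv\<^bsub>PSL2 p\<^esub> x | y. y \<in> A} = A}"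
proof -
  have "x <#\<^bsub>PSL2 p\<^esub> A #>\<^bsub>PSL2 p\<^esub> inv\<^bsub>PSL2 p\<^esub> x = {x \<otimes>\<^bsub>PSL2 p\<^esub> y \<otimes>\<^bsub>PSL2 p\<^esub> inv\<^bsub>PSL2 p\<^esub> x | y. y \<in> A}" for x
    unfolding l_coset_def r_coset_def by auto
  then show ?thesis unfolding normalizer_def stabilizer_def using assms by simp
qed

text \<open>Conjugation by \<open>M\<close> carries the transvection group of \<open>v\<close> to
  that of \<open>act M v\<close>, and a nontrivial transvection determines its line.\<close>

lemma normalizer_tv:
  assumes v: "nz v" and M: "mdet M \<asymp> 1"
  shows "pr M \<in> normalizer (PSL2 p) {pr (tv v x) | x. True} \<longleftrightarrow> vdet v (act M v) \<asymp> 0"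
proof -
  let ?A = "{pr (tv v x) | x. True}"
  have "pr (tv v x) \<in> carrier (PSL2 p)" for x by (rule pr_in_PSL2) simp
  then have A: "?A \<subseteq> carrier (PSL2 p)" by blast
  have nM: "nz (act M v)" using act_nz[OF chi_1_not_0(1)[OF chi_mdet[OF M]] v] .
  have c: "pr M \<otimes>\<^bsub>PSL2 p\<^esub> pr (tv v x) \<otimes>\<^bsub>PSL2 p\<^esub> inv\<^bsub>PSL2 p\<^esub> pr M = pr (tv (act M v) x)" for x
    unfolding inv_PSL2[OF M] mult_PSL2 pr_eq_iff using tv_conj[OF M] by blast
  have "{pr M \<otimes>\<^bsub>PSL2 p\<^esub> y \<otimes>\<^bsub>PSL2 p\<^esub> inv\<^bsub>PSL2 p\<^esub> pr M | y. y \<in> ?A} = {pr (tv (act M v) x) | x. True}"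
    using c by force
  then have N: "pr M \<in> normalizer (PSL2 p) ?A \<longleftrightarrow> {pr (tv (act M v) x) | x. True} = ?A"
    unfolding normalizer_eq[OF A] using pr_in_PSL2[OF M] by simp
  show ?thesis
  proof
    assume "pr M \<in> normalizer (PSL2 p) ?A"
    then have "pr (tv (act M v) 1) \<in> ?A" using N by blast
    then obtain x where "pr (tv (act M v) 1) = pr (tv v x)" by blast
    then have "tv (act M v) 1 \<asymp>\<^sub>m tv v x" using pr_eq_iff mtrace_tv by blast
    from meqv_act[OF this, of v] have "act (tv (act M v) 1) v \<asymp>\<^sub>v v" by (simp add: act_tv_self)
    then have "vdet (act M v) v * fst (act M v) \<asymp> 0" "vdet (act M v) v * snd (act M v) \<asymp> 0"
      unfolding act_tv veqv_def by (simp_all add: cong_iff_dvd_diff)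
    then have "vdet (act M v) v \<asymp> 0" using nM unfolding mult_eqv_0_iff nz_def by blast
    then show "vdet v (act M v) \<asymp> 0" using vdet_eqv_0_swap by blast
  next
    assume "vdet v (act M v) \<asymp> 0"
    then obtain k where k: "\<not> k \<asymp> 0" "act M v \<asymp>\<^sub>v smul k v" using parallel[OF v nM] by blast
    have t: "pr (tv (act M v) x) = pr (tv v (k * k * x))" for x
      unfolding tv_smul[symmetric] pr_eq_iff using tv_cong[OF cong_refl k(2)] by blast
    obtain l where l: "k * l \<asymp> 1" using ex_inverse[OF k(1)] by blast
    have "pr (tv v x) = pr (tv (act M v) (l * l * x))" for x
    proof -
      have "x \<asymp> k * k * (l * l * x)" using l by Groebner_Basis.algebra
      then show ?thesis unfolding t pr_tv_eq_iff[OF v] .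
    qed
    then have "{pr (tv (act M v) x) | x. True} = ?A" using t by blast
    then show "pr M \<in> normalizer (PSL2 p) ?A" using N by blast
  qed
qed

text \<open>The normalizer of \<open>A\<close> is the stabilizer of the line of \<open>v\<close>, so
  \<open>b\<close> has \<open>v\<close> as an eigenvector, with eigenvalue \<open>l\<close>. The
  order of \<open>b\<close> makes \<open>l\<close> a nonresidue, which identifies \<open>H\<close>,
  and the dihedral relation prevents \<open>c\<close> from fixing the line.\<close>

theorem C_datum_imp_vector_graph:
  assumes datum: "C_datum p a b c H" and p5: "p \<noteq> 5"
  shows "\<exists>f. vector_graph p f (coset_graph (PSL2 p) H (double_coset (PSL2 p) H (c \<otimes>\<^bsub>PSL2 p\<^esub> b [^]\<^bsub>PSL2 p\<^esub> (2 * i :: int))))"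
proof -
  interpret G: group "PSL2 p" by (rule group_PSL2)
  let ?G = "PSL2 p"
  define A where "A = generate ?G {a}"
  define B where "B = generate ?G {b}"
  define B2 where "B2 = generate ?G {b [^]\<^bsub>?G\<^esub> (2::nat)}"
  have a: "a \<in> carrier ?G" "group.ord ?G a = p" and b: "b \<in> carrier ?G" "group.ord ?G b = (p - 1) div 2"
    and sAB: "inner_semidirect ?G (normalizer ?G A) A B"
    and c: "c \<in> carrier ?G" "group.ord ?G c = 2"
    and cbc: "c \<otimes>\<^bsub>?G\<^esub> b \<otimes>\<^bsub>?G\<^esub> c = inv\<^bsub>?G\<^esub> b"
    and sH: "inner_semidirect ?G H A B2"
    using datum unfolding C_datum_def Let_def A_def B_def B2_def by blast+
  obtain v u where v: "nz v" and u: "\<not> u \<asymp> 0" and au: "a = pr (tv v u)" using order_p_unipotent[OF a] .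
  have A: "A = {pr (tv v x) | x. True}" unfolding A_def au by (rule generate_tv[OF v u])
  have AB1: "A \<inter> B = {\<one>\<^bsub>?G\<^esub>}" and NAB: "A <#>\<^bsub>?G\<^esub> B = normalizer ?G A" and HAB: "A <#>\<^bsub>?G\<^esub> B2 = H"
    using sAB sH unfolding inner_semidirect_def by auto
  have oneA: "\<one>\<^bsub>?G\<^esub> \<in> A" unfolding A_def by (rule generate.one)
  have BN: "x \<in> normalizer ?G A" if "x \<in> B" for x
  proof -
    have "B \<subseteq> carrier ?G" unfolding B_def using G.generate_incl[of "{b}"] b(1) by blast
    then have "x = \<one>\<^bsub>?G\<^esub> \<otimes>\<^bsub>?G\<^esub> x" using that by auto
    then show ?thesis using oneA that unfolding NAB[symmetric] set_mult_def by blast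
  qed
  obtain Mb where Mb: "mdet Mb \<asymp> 1" "b = pr Mb" using PSL2_cases[OF b(1)] .
  obtain Mc where Mc: "mdet Mc \<asymp> 1" "c = pr Mc" using PSL2_cases[OF c(1)] .
  have nzact: "nz (act M v)" if "mdet M \<asymp> 1" for M
    using act_nz[OF chi_1_not_0(1)[OF chi_mdet[OF that]] v] .
  have "b \<in> B" unfolding B_def by (rule generate.incl) simp
  then have "vdet v (act Mb v) \<asymp> 0" using BN normalizer_tv[OF v Mb(1)] Mb(2) A by simp
  then obtain l where l: "\<not> l \<asymp> 0" "act Mb v \<asymp>\<^sub>v smul l v" using parallel[OF v nzact[OF Mb(1)]] by blast
  have powB: "b [^]\<^bsub>?G\<^esub> (n::nat) \<in> B" for n unfolding B_def generate_nat[OF b(1)] by blast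
  have inA: "pr M \<in> A" if M: "mdet M \<asymp> 1" and s: "act M v \<asymp>\<^sub>v smul s v" "s \<asymp> 1 \<or> s \<asymp> - 1" for M s
  proof -
    have pos: "pr N \<in> A" if N: "mdet N \<asymp> 1" "act N v \<asymp>\<^sub>v v" for N
    proof -
      obtain x where "N \<asymp>\<^sub>m tv v x" using fixed_vector_imp_tv[OF N(1) v N(2)] .
      then show ?thesis unfolding A using pr_eq_iff by blast
    qed
    show ?thesis using s(2)
    proof
      assume "s \<asymp> 1"
      then have "act M v \<asymp>\<^sub>v v" using veqv_trans[OF s(1) veqv_smul[OF _ veqv_refl, of s 1]] by simp
      then show ?thesis by (rule pos[OF M])
    next
      assume "s \<asymp> - 1"
      then have "- s \<asymp> 1" using cong_minus_minus_iff[of s "- 1"] by simp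
      moreover have "act (smat (- 1) M) v \<asymp>\<^sub>v smul (- s) v"
        using veqv_smul[OF cong_refl s(1), of "- 1"] by (simp add: act_smat smul_smul)
      ultimately have "act (smat (- 1) M) v \<asymp>\<^sub>v v" using veqv_trans[OF _ veqv_smul[OF _ veqv_refl, of "- s" 1]] by simp
      then have "pr (smat (- 1) M) \<in> A" using M by (intro pos) (simp_all add: mdet_smat)
      then show ?thesis by simp
    qed
  qed
  \<comment> \<open>A power of \<open>b\<close> with eigenvalue 1 or - 1 at \<open>v\<close> is a
    transvection up to sign. It then lies in both \<open>A\<close> and \<open>B\<close>, so it is
    trivial.\<close>
  have powA: "(p - 1) div 2 dvd n" if "l ^ n \<asymp> 1 \<or> l ^ n \<asymp> - 1" for n
  proof -
    have "b [^]\<^bsub>?G\<^esub> n \<in> A" unfolding Mb(2) pr_pow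
      by (rule inA[OF mdet_mpow[OF Mb(1)] act_mpow_eigen[OF l(2)] that])
    then have "b [^]\<^bsub>?G\<^esub> n = \<one>\<^bsub>?G\<^esub>" using AB1 powB by blast
    then show ?thesis using G.pow_eq_id[OF b(1)] b(2) by simp
  qed
  have chil: "chi l = - 1"
  proof (rule ccontr)
    assume "chi l \<noteq> - 1"
    then have "chi l = 1" using chi_cases'[OF l(1)] by blast
    then obtain t where t: "t * t \<asymp> l" "\<not> t \<asymp> 0" by (rule chi_eq_1D)
    \<comment> \<open>If \<open>l\<close> is the square of \<open>t\<close>, half the exponent
      \<open>m\<close> already yields \<open>t ^ m\<close>, a sign, although \<open>b\<close> has
      order \<open>m\<close>.\<close>
    have "l ^ (m div 2) \<asymp> (t * t) ^ (m div 2)" by (rule cong_pow[OF cong_sym[OF t(1)]])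
    also have "(t * t) ^ (m div 2) = t ^ m" using even_m by (simp add: power_mult_distrib power_add[symmetric] mult_2[symmetric])
    also have "t ^ m \<asymp> chi t" by (rule cong_sym[OF chi_euler])
    finally have "l ^ (m div 2) \<asymp> 1 \<or> l ^ (m div 2) \<asymp> - 1" using chi_cases'[OF t(2)] by auto
    then have "m dvd m div 2" using powA unfolding m_def by blast
    then show False using m_ge_2 even_m by (auto dest!: dvd_imp_le)
  qed
  \<comment> \<open>If \<open>c\<close> fixed the line of \<open>v\<close> with eigenvalue
    \<open>k\<close>, its order 2 would make \<open>k ^ 2\<close> a sign, and the dihedral relation
    would make \<open>l ^ 2\<close> a sign. Then \<open>m\<close> divides 4, which leaves only
    \<open>p = 5\<close> and the composite 9.\<close>
  have cv: "\<not> vdet v (act Mc v) \<asymp> 0"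
  proof
    assume "vdet v (act Mc v) \<asymp> 0"
    then obtain k where k: "\<not> k \<asymp> 0" "act Mc v \<asymp>\<^sub>v smul k v" using parallel[OF v nzact[OF Mc(1)]] by blast
    have "c [^]\<^bsub>?G\<^esub> (2::nat) = \<one>\<^bsub>?G\<^esub>" using G.pow_eq_id[OF c(1)] c(2) by simp
    then have "pr (mpow Mc 2) = pr (1, 0, 0, 1)" unfolding Mc(2) pr_pow one_PSL2 .
    then have "mpow Mc 2 \<asymp>\<^sub>m smat 1 (1, 0, 0, 1) \<or> mpow Mc 2 \<asymp>\<^sub>m smat (- 1) (1, 0, 0, 1)" unfolding pr_eq_iff by simp
    moreover have sc: "s \<asymp> s'" if "M \<asymp>\<^sub>m N" "act M v \<asymp>\<^sub>v smul s v" "act N v \<asymp>\<^sub>v smul s' v" for M N s s'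
    proof -
      have "smul s v \<asymp>\<^sub>v smul s' v" using veqv_trans[OF veqv_sym[OF that(2)] veqv_trans[OF meqv_act[OF that(1)] that(3)]] .
      then have "(s - s') * fst v \<asymp> 0" "(s - s') * snd v \<asymp> 0"
        by (simp_all add: veqv_def smul_def cong_iff_dvd_diff left_diff_distrib)
      then show ?thesis using v unfolding mult_eqv_0_iff nz_def by (auto simp: cong_iff_dvd_diff)
    qed
    have one: "act (smat s (1, 0, 0, 1)) v \<asymp>\<^sub>v smul s v" for s by (simp add: act_def smat_def smul_def)
    ultimately have k2: "k ^ 2 \<asymp> 1 \<or> k ^ 2 \<asymp> - 1"
      using sc[OF _ act_mpow_eigen[OF k(2)] one] by blast
    have "pr (mmul (mmul Mc Mb) Mc) = pr (adj Mb)" using cbc unfolding Mc(2) Mb(2) inv_PSL2[OF Mb(1)] mult_PSL2 .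
    then have "mmul (mmul Mc Mb) Mc \<asymp>\<^sub>m smat 1 (adj Mb) \<or> mmul (mmul Mc Mb) Mc \<asymp>\<^sub>m smat (- 1) (adj Mb)"
      unfolding pr_eq_iff by simp
    moreover have e1: "act (mmul (mmul Mc Mb) Mc) v \<asymp>\<^sub>v smul (k * (l * k)) v"
    proof -
      have "act Mc (act Mb (act Mc v)) \<asymp>\<^sub>v act Mc (act Mb (smul k v))" using veqv_act k(2) by blast
      moreover have "act Mc (act Mb (smul k v)) \<asymp>\<^sub>v act Mc (smul k (smul l v))"
        unfolding act_smul[of Mb] using veqv_act veqv_smul[OF cong_refl l(2)] by blast
      moreover have "act Mc (smul k (smul l v)) = smul (k * l) (act Mc v)" by (simp add: smul_smul act_smul)
      then have "act Mc (smul k (smul l v)) \<asymp>\<^sub>v smul (k * l) (smul k v)"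
        using veqv_smul[OF cong_refl k(2), of "k * l"] by simp
      moreover have "smul (k * l) (smul k v) = smul (k * (l * k)) v" by (simp add: smul_smul mult.assoc)
      ultimately show ?thesis unfolding act_mmul using veqv_trans by metis
    qed
    obtain l' where l': "l * l' \<asymp> 1" using ex_inverse[OF l(1)] by blast
    have e2: "act (smat s (adj Mb)) v \<asymp>\<^sub>v smul (s * l') v" for s
    proof -
      have "smul l (act (adj Mb) v) \<asymp>\<^sub>v act (adj Mb) (act Mb v)"
        using veqv_act[OF veqv_sym[OF l(2)], of "adj Mb"] by (simp add: act_smul)
      then have "smul l (act (adj Mb) v) \<asymp>\<^sub>v smul 1 v"
        using veqv_trans[OF _ veqv_smul[OF Mb(1) veqv_refl]] by (simp add: act_adj)
      from veqv_smul[OF cong_refl this, of "s * l'"]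
      have "smul (s * l' * l) (act (adj Mb) v) \<asymp>\<^sub>v smul (s * l') v" by (simp add: smul_smul)
      moreover have "s \<asymp> s * l' * l" using l' by Groebner_Basis.algebra
      then have "smul s (act (adj Mb) v) \<asymp>\<^sub>v smul (s * l' * l) (act (adj Mb) v)" by (rule veqv_smul) simp
      ultimately show ?thesis unfolding act_smat using veqv_trans by blast
    qed
    have "k * (l * k) \<asymp> 1 * l' \<or> k * (l * k) \<asymp> - 1 * l'"
      using calculation sc[OF _ e1 e2] by blast
    then have "l * l * (l * l) \<asymp> 1"
    proof
      assume h: "k * (l * k) \<asymp> 1 * l'"
      from k2 show ?thesis
      proof
        assume "k ^ 2 \<asymp> 1"
        then show ?thesis using h l' unfolding power2_eq_square by Groebner_Basis.algebra
      next
        assume "k ^ 2 \<asymp> - 1"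
        then show ?thesis using h l' unfolding power2_eq_square by Groebner_Basis.algebra
      qed
    next
      assume h: "k * (l * k) \<asymp> - 1 * l'"
      from k2 show ?thesis
      proof
        assume "k ^ 2 \<asymp> 1"
        then show ?thesis using h l' unfolding power2_eq_square by Groebner_Basis.algebra
      next
        assume "k ^ 2 \<asymp> - 1"
        then show ?thesis using h l' unfolding power2_eq_square by Groebner_Basis.algebra
      qed
    qed
    then have "l ^ 4 \<asymp> 1" by (simp add: power4_eq_xxxx mult.assoc)
    then have "m dvd 4" using powA unfolding m_def by blast
    then have "m \<in> {..4}" by (auto dest: dvd_imp_le)
    then have "m = 2 \<or> m = 4" using m_ge_2 even_m by (auto elim!: evenE)
    moreover have "m \<noteq> 4"
    proof
      assume "m = 4"
      then have "p = 3 * 3" using p_eq by simp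
      then show False using prime_p by (metis numeral_eq_one_iff prime_product semiring_norm(86))
    qed
    ultimately show False using p_eq p5 by simp
  qed
  have B2: "B2 = {pr (mpow (mpow Mb 2) n) | n. True}"
    unfolding B2_def using generate_nat[OF G.nat_pow_closed[OF b(1), of 2]] by (simp add: Mb(2) pr_pow)
  have B2act: "sim v (act (mpow (mpow Mb 2) n) v)" for n
  proof -
    have "act (mpow (mpow Mb 2) n) v \<asymp>\<^sub>v smul ((l ^ 2) ^ n) v"
      by (rule act_mpow_eigen[OF act_mpow_eigen[OF l(2)]])
    moreover have "(l ^ 2) ^ n = l ^ n * l ^ n" by (simp add: power_mult[symmetric] mult_2 power_add)
    moreover have "chi (l ^ n * l ^ n) = 1"
    proof (rule chi_square)
      show "\<not> l ^ n \<asymp> 0" using l(1) power_eqv_0_iff[of n l] one_not_eqv_0 by (cases n) auto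
    qed
    ultimately show ?thesis unfolding sim_def by metis
  qed
  have H: "H = sim_set v v"
  proof
    show "H \<subseteq> sim_set v v"
    proof
      fix x assume "x \<in> H"
      then obtain y n where x: "x = pr (tv v y) \<otimes>\<^bsub>?G\<^esub> pr (mpow (mpow Mb 2) n)"
        unfolding HAB[symmetric] set_mult_def A B2 by blast
      have "mdet (mpow (mpow Mb 2) n) \<asymp> 1" by (intro mdet_mpow Mb)
      then have d: "mdet (mmul (tv v y) (mpow (mpow Mb 2) n)) \<asymp> 1" by (simp add: mdet_mmul)
      have "sim (act (tv v y) v) (act (tv v y) (act (mpow (mpow Mb 2) n) v))" by (rule act_sim[OF B2act])
      then show "x \<in> sim_set v v" unfolding x mult_PSL2 pr_in_sim_set[OF d] act_mmul by (simp add: act_tv_self)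
    qed
    show "sim_set v v \<subseteq> H"
    proof
      fix x assume "x \<in> sim_set v v"
      then obtain M where M: "mdet M \<asymp> 1" "x = pr M" "sim v (act M v)" unfolding sim_set_def by blast
      have "x \<in> normalizer ?G A" unfolding A M(2) normalizer_tv[OF v M(1)] by (rule sim_vdet[OF M(3)])
      then obtain a' b' where ab: "a' \<in> A" "b' \<in> B" "x = a' \<otimes>\<^bsub>?G\<^esub> b'"
        unfolding NAB[symmetric] set_mult_def by blast
      obtain y where y: "a' = pr (tv v y)" using ab(1) unfolding A by blast
      obtain n where "b' = pr (mpow Mb n)"
        using ab(2) unfolding B_def generate_nat[OF b(1)] unfolding Mb(2) pr_pow by blast
      then have x: "x = pr (tv v y) \<otimes>\<^bsub>?G\<^esub> pr (mpow Mb n)" using ab(3) y by simp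
      have "pr M = pr (mmul (tv v y) (mpow Mb n))" using x M(2) by (simp add: mult_PSL2)
      from sim_trans[OF M(3) sim_act_pr[OF this, of v]]
      have "sim (act (tv v y) v) (act (tv v y) (act (mpow Mb n) v))" by (simp add: act_mmul act_tv_self)
      then have "sim v (act (mpow Mb n) v)" using sim_act_iff[of "tv v y"] by simp
      then have "sim v (smul (l ^ n) v)" using sim_trans[OF _ sim_veqv[OF act_mpow_eigen[OF l(2)]]] by blast
      then obtain k where k: "chi k = 1" "smul (l ^ n) v \<asymp>\<^sub>v smul k v" unfolding sim_def by blast
      then have "(l ^ n - k) * fst v \<asymp> 0" "(l ^ n - k) * snd v \<asymp> 0"
        by (simp_all add: veqv_def smul_def cong_iff_dvd_diff left_diff_distrib)
      then have "l ^ n \<asymp> k" using v unfolding mult_eqv_0_iff nz_def by (auto simp: cong_iff_dvd_diff)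
      then have "chi (l ^ n) = 1" using chi_cong k(1) by simp
      \<comment> \<open>Since \<open>l\<close> is a nonresidue, a power of \<open>b\<close>
        preserves the class of \<open>v\<close> only if its exponent is even; this is why
        \<open>H\<close> contains the square of \<open>b\<close>.\<close>
      moreover have "chi (l ^ n) = (- 1) ^ n" by (induction n) (simp_all add: chi_mult chil)
      ultimately have "even n" by (metis neg_one_odd_power one_neq_neg_one)
      then obtain k where n: "n = 2 * k" by (elim evenE)
      have "b [^]\<^bsub>?G\<^esub> n = (b [^]\<^bsub>?G\<^esub> (2::nat)) [^]\<^bsub>?G\<^esub> k" unfolding n by (simp add: G.nat_pow_pow[OF b(1)])
      then have "pr (mpow Mb n) \<in> B2" unfolding B2 Mb(2) pr_pow by blast
      moreover have "pr (tv v y) \<in> A" unfolding A by blast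
      ultimately show "x \<in> H" unfolding HAB[symmetric] set_mult_def x by blast
    qed
  qed
  have "b [^]\<^bsub>?G\<^esub> (2 * i) \<in> B2"
  proof -
    have "b [^]\<^bsub>?G\<^esub> (2 * i) = (b [^]\<^bsub>?G\<^esub> (2 :: int)) [^]\<^bsub>?G\<^esub> i" by (simp add: G.int_pow_pow[OF b(1)])
    also have "b [^]\<^bsub>?G\<^esub> (2 :: int) = b [^]\<^bsub>?G\<^esub> (2 :: nat)" using int_pow_int[of ?G b 2] by simp
    finally show ?thesis unfolding B2_def using G.generate_pow[OF G.nat_pow_closed[OF b(1), of 2]] by blast
  qed
  then obtain n where n: "b [^]\<^bsub>?G\<^esub> (2 * i) = pr (mpow (mpow Mb 2) n)" unfolding B2 by blast
  \<comment> \<open>The power of \<open>b\<close> lies in \<open>H\<close>, so \<open>g\<close>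
    moves the class of \<open>v\<close> as \<open>c\<close> does.\<close>
  define g where "g = mmul Mc (mpow (mpow Mb 2) n)"
  have g: "mdet g \<asymp> 1" unfolding g_def by (intro mdet_mmul_1 mdet_mpow Mb Mc)
  have "sim (act Mc v) (act g v)" unfolding g_def act_mmul by (rule act_sim[OF B2act])
  then have "\<not> vdet v (act g v) \<asymp> 0" using chi_vdet_sim_right[of "act Mc v" "act g v" v] cv chi_eq_0_iff by metis
  from coset_vector_graph[OF v g this] show ?thesis
    unfolding n Mc(2) mult_PSL2 H g_def .
qed

end

section \<open>Existence of the data\<close>

lemma (in group) inner_semidirectI:
  assumes N: "subgroup N G" and K: "subgroup K G"
    and conj: "\<And>k n. k \<in> K \<Longrightarrow> n \<in> N \<Longrightarrow> k \<otimes> n \<otimes> inv k \<in> N"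
    and triv: "N \<inter> K = {\<one>}" and S: "N <#> K = S"
  shows "inner_semidirect G S N K"
proof -
  have nG: "n \<in> carrier G" if "n \<in> N" for n using subgroup.mem_carrier[OF N that] .
  have kG: "k \<in> carrier G" if "k \<in> K" for k using subgroup.mem_carrier[OF K that] .
  have S_iff: "x \<in> S \<longleftrightarrow> (\<exists>n\<in>N. \<exists>k\<in>K. x = n \<otimes> k)" for x unfolding S[symmetric] set_mult_def by blast
  have NS: "N \<subseteq> S"
  proof
    fix n assume n: "n \<in> N"
    then have "n = n \<otimes> \<one>" using nG by simp
    then show "n \<in> S" using S_iff n subgroup.one_closed[OF K] by blast
  qed
  have KS: "K \<subseteq> S"
  proof
    fix k assume k: "k \<in> K"
    then have "k = \<one> \<otimes> k" using kG by simp
    then show "k \<in> S" using S_iff k subgroup.one_closed[OF N] by blast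
  qed
  have SG: "S \<subseteq> carrier G"
  proof
    fix x assume "x \<in> S"
    then obtain n k where "n \<in> N" "k \<in> K" "x = n \<otimes> k" unfolding S_iff by (elim bexE)
    then show "x \<in> carrier G" using nG kG by simp
  qed
  have move: "k \<otimes> n = (k \<otimes> n \<otimes> inv k) \<otimes> k" if "k \<in> K" "n \<in> N" for k n
    using kG[OF that(1)] nG[OF that(2)] by (simp add: m_assoc)
  have subS: "subgroup S G"
  proof (rule subgroupI)
    show "S \<subseteq> carrier G" by (rule SG)
    show "S \<noteq> {}" using NS subgroup.one_closed[OF N] by blast
  next
    fix x assume "x \<in> S"
    then obtain n k where x: "n \<in> N" "k \<in> K" "x = n \<otimes> k" unfolding S_iff by (elim bexE)
    have ik: "inv k \<in> K" and inn: "inv n \<in> N" using subgroup.m_inv_closed[OF K x(2)] subgroup.m_inv_closed[OF N x(1)] by auto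
    have "inv x = inv k \<otimes> inv n" unfolding x(3) by (rule inv_mult_group[OF nG[OF x(1)] kG[OF x(2)]])
    also have "\<dots> = (inv k \<otimes> inv n \<otimes> inv (inv k)) \<otimes> inv k" by (rule move[OF ik inn])
    finally show "inv x \<in> S" using S_iff conj[OF ik inn] ik by blast
  next
    fix x y assume "x \<in> S" "y \<in> S"
    then obtain n k n' k' where x: "n \<in> N" "k \<in> K" "x = n \<otimes> k" and y: "n' \<in> N" "k' \<in> K" "y = n' \<otimes> k'"
      using S_iff by blast
    have c: "k \<otimes> n' \<otimes> inv k \<in> N" by (rule conj[OF x(2) y(1)])
    have "x \<otimes> y = n \<otimes> (k \<otimes> n') \<otimes> k'"
      unfolding x(3) y(3) using nG kG x y by (simp add: m_assoc)
    also have "\<dots> = n \<otimes> ((k \<otimes> n' \<otimes> inv k) \<otimes> k) \<otimes> k'"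
      by (rule arg_cong[OF move[OF x(2) y(1)], of "\<lambda>z. n \<otimes> z \<otimes> k'"])
    also have "\<dots> = (n \<otimes> (k \<otimes> n' \<otimes> inv k)) \<otimes> (k \<otimes> k')"
    proof -
      have "inv k \<otimes> (k \<otimes> k') = k'" using kG x(2) y(2) by (simp flip: m_assoc)
      then show ?thesis using nG kG x y by (simp add: m_assoc)
    qed
    finally show "x \<otimes> y \<in> S"
      using S_iff subgroup.m_closed[OF N x(1) c] subgroup.m_closed[OF K x(2) y(2)] by blast
  qed
  interpret GS: group "G\<lparr>carrier := S\<rparr>" by (rule subgroup.subgroup_is_group[OF subS group_axioms])
  have NsS: "subgroup N (G\<lparr>carrier := S\<rparr>)" by (rule subgroup_incl[OF N subS NS])
  have KsS: "subgroup K (G\<lparr>carrier := S\<rparr>)" by (rule subgroup_incl[OF K subS KS])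
  have "N \<lhd> G\<lparr>carrier := S\<rparr>"
  proof (rule GS.normal_invI[OF NsS])
    fix x h assume x: "x \<in> carrier (G\<lparr>carrier := S\<rparr>)" and h: "h \<in> N"
    then obtain n k where nk: "n \<in> N" "k \<in> K" "x = n \<otimes> k" using S_iff by auto
    have c: "k \<otimes> h \<otimes> inv k \<in> N" by (rule conj[OF nk(2) h])
    have xS: "x \<in> S" using x by simp
    have "x \<otimes> h \<otimes> inv x = n \<otimes> (k \<otimes> h \<otimes> inv k) \<otimes> inv n"
      unfolding nk(3) inv_mult_group[OF nG[OF nk(1)] kG[OF nk(2)]] using nG kG nk h by (simp add: m_assoc)
    also have "\<dots> \<in> N" by (intro subgroup.m_closed[OF N] nk c subgroup.m_inv_closed[OF N])
    finally show "x \<otimes>\<^bsub>G\<lparr>carrier := S\<rparr>\<^esub> h \<otimes>\<^bsub>G\<lparr>carrier := S\<rparr>\<^esub> inv\<^bsub>G\<lparr>carrier := S\<rparr>\<^esub> x \<in> N"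
      using m_inv_consistent[OF subS xS] by simp
  qed
  then show ?thesis unfolding inner_semidirect_def using subS KsS triv S by blast
qed

context prime_1_mod_4
begin

text \<open>The standard data: a transvection along \<open>(1, 0)\<close>, the diagonal matrix of a
  primitive root, and the matrix \<open>W\<close> that exchanges the coordinate axes.\<close>

theorem C_datum_exists:
  assumes p5: "p \<noteq> 5"
  shows "\<exists>a b c H. C_datum p a b c H"
proof -
  interpret G: group "PSL2 p" by (rule group_PSL2)
  let ?G = "PSL2 p" and ?e = "(1, 0) :: int \<times> int"
  obtain r where r: "\<not> r \<asymp> 0" "\<forall>n. r ^ n \<asymp> 1 \<longrightarrow> p - 1 dvd n" by (rule ex_primitive_root)
  obtain s where s: "r * s \<asymp> 1" using ex_inverse[OF r(1)] by blast
  \<comment> \<open>With 5 excluded and 9 composite, \<open>p \<ge> 13\<close>. Then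
    \<open>m\<close> does not divide 4, so the diagonal entries \<open>r ^ 2\<close> and
    \<open>s ^ 2\<close> differ modulo \<open>p\<close>; the normalizer of \<open>B2\<close> depends
    on this.\<close>
  have p13: "m > 4"
  proof -
    have "m \<noteq> 4"
    proof
      assume "m = 4"
      then have "p = 3 * 3" using p_eq by simp
      then show False using prime_p by (metis numeral_eq_one_iff prime_product semiring_norm(86))
    qed
    moreover have "m \<noteq> 2" using p_eq p5 by auto
    moreover have "m \<noteq> 3" using even_m by auto
    ultimately show ?thesis using m_ge_2 by simp
  qed
  define Dg where "Dg x y = (x, 0 :: int, 0 :: int, y)" for x y :: int
  define W where "W = (0 :: int, 1 :: int, - 1 :: int, 0 :: int)"
  have Dg_mult: "mmul (Dg x y) (Dg x' y') = Dg (x * x') (y * y')" for x y x' y' by (simp add: Dg_def mmul_def)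
  have adj_Dg: "adj (Dg x y) = Dg y x" for x y by (simp add: Dg_def adj_def)
  have mdet_Dg: "mdet (Dg x y) = x * y" for x y by (simp add: Dg_def mdet_def)
  have Dg_pow: "mpow (Dg x y) n = Dg (x ^ n) (y ^ n)" for x y n
    by (induction n) (simp_all add: Dg_mult mult.commute, simp add: Dg_def)
  have rs: "r ^ n * s ^ n \<asymp> 1" for n using cong_pow[OF s, of n] by (simp add: power_mult_distrib)
  have inv1: "y \<asymp> 1" if "x * y \<asymp> 1" "x \<asymp> 1" for x y using that by Groebner_Basis.algebra
  have inv2: "y \<asymp> - 1" if "x * y \<asymp> 1" "x \<asymp> - 1" for x y using that by Groebner_Basis.algebra
  have inv3: "y \<asymp> y'" if "x * y \<asymp> 1" "x \<asymp> x'" "x' * y' \<asymp> 1" for x y x' y' using that by Groebner_Basis.algebra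
  have inv4: "x * z * y \<asymp> z" "y * z * x \<asymp> z" if "x * y \<asymp> 1" for x y z using that by Groebner_Basis.algebra+
  have dD: "mdet (Dg (r ^ n) (s ^ n)) \<asymp> 1" for n unfolding mdet_Dg by (rule rs)
  have dW: "mdet W = 1" by (simp add: W_def mdet_def)
  define a where "a = pr (tv ?e 1)"
  define b where "b = pr (Dg r s)"
  define c where "c = pr W"
  define A where "A = generate ?G {a}"
  define B where "B = generate ?G {b}"
  define B2 where "B2 = generate ?G {b [^]\<^bsub>?G\<^esub> (2::nat)}"
  define C where "C = generate ?G {c}"
  have ac: "a \<in> carrier ?G" unfolding a_def by (rule pr_in_PSL2) simp
  have bc: "b \<in> carrier ?G" unfolding b_def using dD[of 1] by (intro pr_in_PSL2) simp
  have cc: "c \<in> carrier ?G" unfolding c_def by (rule pr_in_PSL2) (simp add: dW)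
  have ne: "nz ?e" using one_not_eqv_0 by (simp add: nz_def)
  have A: "A = {pr (tv ?e x) | x. True}" unfolding A_def a_def by (rule generate_tv[OF ne one_not_eqv_0])
  have b_pow: "b [^]\<^bsub>?G\<^esub> (n::nat) = pr (Dg (r ^ n) (s ^ n))" for n unfolding b_def pr_pow Dg_pow ..
  have B: "B = {pr (Dg (r ^ n) (s ^ n)) | n. True}" unfolding B_def generate_nat[OF bc] b_pow ..
  have B2: "B2 = {pr (Dg (r ^ (2 * n)) (s ^ (2 * n))) | n. True}"
    unfolding B2_def generate_nat[OF G.nat_pow_closed[OF bc]] unfolding G.nat_pow_pow[OF bc] unfolding b_pow ..
  have sA: "subgroup A ?G" and sB: "subgroup B ?G" and sB2: "subgroup B2 ?G" and sC: "subgroup C ?G"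
    unfolding A_def B_def B2_def C_def by (intro G.generate_is_subgroup; use ac bc cc G.nat_pow_closed[OF bc] in blast)+
  have oa: "G.ord a = p"
  proof -
    have "a [^]\<^bsub>?G\<^esub> n = \<one>\<^bsub>?G\<^esub> \<longleftrightarrow> p dvd n" for n :: nat
    proof -
      have "a [^]\<^bsub>?G\<^esub> n = \<one>\<^bsub>?G\<^esub> \<longleftrightarrow> pr (tv ?e (int n)) = pr (tv ?e 0)"
        unfolding a_def pr_pow mpow_tv one_PSL2 tv_0 by simp
      also have "\<dots> \<longleftrightarrow> p dvd n" unfolding pr_tv_eq_iff[OF ne] by (simp add: cong_0_iff)
      finally show ?thesis .
    qed
    then show ?thesis using G.ord_unique[OF ac] by blast
  qed
  have Dg_1: "pr (Dg x y) = \<one>\<^bsub>?G\<^esub> \<longleftrightarrow> (x \<asymp> 1 \<and> y \<asymp> 1) \<or> (x \<asymp> - 1 \<and> y \<asymp> - 1)" for x y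
    unfolding one_PSL2 pr_eq_iff by (simp add: Dg_def smat_def meqv_iff)
  \<comment> \<open>Up to sign the order of \<open>r\<close> drops from \<open>p - 1\<close> to
    \<open>m\<close>; this gives the order of \<open>b\<close>.\<close>
  have pow_r: "r ^ n \<asymp> 1 \<or> r ^ n \<asymp> - 1 \<longleftrightarrow> m dvd n" for n
  proof
    assume "r ^ n \<asymp> 1 \<or> r ^ n \<asymp> - 1"
    then have "r ^ n * r ^ n \<asymp> 1" using cong_mult[of "r ^ n" _ _ "r ^ n"] by fastforce
    then have "r ^ (2 * n) \<asymp> 1" by (simp add: mult_2 power_add)
    then have "2 * m dvd 2 * n" using r(2) p_eq by (metis add_diff_cancel_right')
    then show "m dvd n" by simp
  next
    assume "m dvd n"
    then obtain k where k: "n = m * k" by (elim dvdE)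
    have "r ^ n \<asymp> chi r ^ k" unfolding k power_mult by (rule cong_pow[OF cong_sym[OF chi_euler]])
    moreover have "chi r ^ k = 1 \<or> chi r ^ k = - 1" using chi_cases'[OF r(1)] by (cases "even k") auto
    ultimately show "r ^ n \<asymp> 1 \<or> r ^ n \<asymp> - 1" by auto
  qed
  have pr_r: "pr (Dg (r ^ n) (s ^ n)) = \<one>\<^bsub>?G\<^esub> \<longleftrightarrow> m dvd n" for n
  proof -
    have "s ^ n \<asymp> 1" if "r ^ n \<asymp> 1" by (rule inv1[OF rs that])
    moreover have "s ^ n \<asymp> - 1" if "r ^ n \<asymp> - 1" by (rule inv2[OF rs that])
    ultimately show ?thesis unfolding Dg_1 pow_r[symmetric] by blast
  qed
  have ob: "G.ord b = (p - 1) div 2"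
    unfolding m_def[symmetric] using G.ord_unique[OF bc] b_pow pr_r by simp
  have c2: "c [^]\<^bsub>?G\<^esub> (2::nat) = \<one>\<^bsub>?G\<^esub>"
    unfolding c_def pr_pow one_PSL2 pr_eq_iff by (simp add: numeral_2_eq_2 W_def mmul_def smat_def meqv_iff)
  have c1: "c \<noteq> \<one>\<^bsub>?G\<^esub>"
    unfolding c_def one_PSL2 pr_eq_iff using one_not_eqv_0 by (simp add: W_def smat_def meqv_iff)
  have oc: "G.ord c = 2"
  proof -
    have "G.ord c dvd 2" using c2 G.pow_eq_id[OF cc] by blast
    moreover have "G.ord c \<noteq> 1" using c1 G.ord_eq_1[OF cc] by blast
    ultimately show ?thesis using prime_nat_iff[of 2] two_is_prime_nat by blast
  qed
  have C: "C = {\<one>\<^bsub>?G\<^esub>, c}"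
  proof -
    have "c [^]\<^bsub>?G\<^esub> n \<in> {\<one>\<^bsub>?G\<^esub>, c}" for n :: nat
    proof (induction n)
      case (Suc n)
      have "c \<otimes>\<^bsub>?G\<^esub> c = \<one>\<^bsub>?G\<^esub>" using c2 cc by (simp add: numeral_2_eq_2)
      then show ?case using Suc cc by auto
    qed simp
    then have "C \<subseteq> {\<one>\<^bsub>?G\<^esub>, c}" unfolding C_def generate_nat[OF cc] by blast
    moreover have "c \<in> C" unfolding C_def by (rule generate.incl) simp
    ultimately show ?thesis using subgroup.one_closed[OF sC] by blast
  qed
  have inv_b: "inv\<^bsub>?G\<^esub> (pr (Dg (r ^ n) (s ^ n))) = pr (Dg (s ^ n) (r ^ n))" for n
    unfolding inv_PSL2[OF dD] adj_Dg ..
  have cDc: "c \<otimes>\<^bsub>?G\<^esub> pr (Dg x y) \<otimes>\<^bsub>?G\<^esub> c = pr (Dg y x)" for x y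
    unfolding c_def mult_PSL2 pr_eq_iff by (simp add: W_def Dg_def mmul_def smat_def meqv_iff)
  have cbc: "c \<otimes>\<^bsub>?G\<^esub> b \<otimes>\<^bsub>?G\<^esub> c = inv\<^bsub>?G\<^esub> b"
    using cDc[of r s] inv_b[of 1] by (simp add: b_def)
  have inv_c: "inv\<^bsub>?G\<^esub> c = c" using G.inv_equality[of c c] c2 cc by (simp add: numeral_2_eq_2)
  have act_e: "act (Dg x y) ?e = smul x ?e" for x y by (simp add: act_def Dg_def smul_def)
  have AB1: "A \<inter> B = {\<one>\<^bsub>?G\<^esub>}"
  proof
    show "A \<inter> B \<subseteq> {\<one>\<^bsub>?G\<^esub>}"
    proof
      fix x assume "x \<in> A \<inter> B"
      then obtain y n where x: "x = pr (tv ?e y)" "x = pr (Dg (r ^ n) (s ^ n))" unfolding A B by blast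
      then have "pr (tv ?e y) = pr (Dg (r ^ n) (s ^ n))" by simp
      then have "tv ?e y \<asymp>\<^sub>m Dg (r ^ n) (s ^ n) \<or> tv ?e y \<asymp>\<^sub>m smat (- 1) (Dg (r ^ n) (s ^ n))"
        unfolding pr_eq_iff .
      then have "y \<asymp> 0" by (auto simp: tv_def Dg_def smat_def meqv_iff)
      then have "x = pr (tv ?e 0)" unfolding x(1) pr_tv_eq_iff[OF ne] .
      then show "x \<in> {\<one>\<^bsub>?G\<^esub>}" unfolding tv_0 one_PSL2 by simp
    qed
  qed (use subgroup.one_closed[OF sA] subgroup.one_closed[OF sB] in blast)
  have conjA: "k \<otimes>\<^bsub>?G\<^esub> n \<otimes>\<^bsub>?G\<^esub> inv\<^bsub>?G\<^esub> k \<in> A" if k: "k \<in> B" and n: "n \<in> A" for k n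
  proof -
    obtain i where i: "k = pr (Dg (r ^ i) (s ^ i))" using k unfolding B by blast
    obtain y where y: "n = pr (tv ?e y)" using n unfolding A by blast
    have "k \<otimes>\<^bsub>?G\<^esub> n \<otimes>\<^bsub>?G\<^esub> inv\<^bsub>?G\<^esub> k = pr (tv (act (Dg (r ^ i) (s ^ i)) ?e) y)"
      unfolding i y inv_PSL2[OF dD] mult_PSL2 pr_eq_iff using tv_conj[OF dD] by blast
    then show ?thesis unfolding A act_e tv_smul by blast
  qed
  \<comment> \<open>The powers with exponents below \<open>p - 1\<close> are distinct and nonzero
    modulo \<open>p\<close>, hence exhaust the \<open>p - 1\<close> nonzero residues.\<close>
  have ex_pow: "\<exists>n. x \<asymp> r ^ n" if x: "\<not> x \<asymp> 0" for x
  proof -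
    have "inj_on (\<lambda>n. r ^ n mod int p) {..<p - 1}"
    proof (rule linorder_inj_onI)
      fix i j assume ij: "i < j" "i \<in> {..<p - 1}" "j \<in> {..<p - 1}"
      show "r ^ i mod int p \<noteq> r ^ j mod int p"
      proof
        assume "r ^ i mod int p = r ^ j mod int p"
        then have "r ^ i * 1 \<asymp> r ^ i * r ^ (j - i)" using ij by (simp add: cong_def power_add[symmetric])
        then have "r ^ (j - i) \<asymp> 1"
          using mult_eqv_cancel power_eqv_0_iff[of i r] r(1) one_not_eqv_0 by (metis cong_sym not_gr0 power_0)
        then have "p - 1 dvd j - i" using r(2) by blast
        then have "p - 1 \<le> j - i" using ij(1) dvd_imp_le[of "p - 1" "j - i"] by simp
        then show False using ij by auto
      qed
    qed auto
    then have "card ((\<lambda>n. r ^ n mod int p) ` {..<p - 1}) = p - 1" by (simp add: card_image)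
    moreover have "(\<lambda>n. r ^ n mod int p) ` {..<p - 1} \<subseteq> {1..<int p}"
    proof (rule image_subsetI)
      fix n
      have "\<not> r ^ n \<asymp> 0" using power_eqv_0_iff[of n r] r(1) one_not_eqv_0 by (cases n) auto
      then have "r ^ n mod int p \<noteq> 0" by (simp add: cong_def)
      moreover have "0 \<le> r ^ n mod int p" "r ^ n mod int p < int p" using p_ge_5 by auto
      ultimately show "r ^ n mod int p \<in> {1..<int p}" by simp
    qed
    ultimately have "(\<lambda>n. r ^ n mod int p) ` {..<p - 1} = {1..<int p}"
      by (intro card_subset_eq) (use p_ge_5 in auto)
    moreover have "x mod int p \<in> {1..<int p}"
    proof -
      have "x mod int p \<noteq> 0" using x by (simp add: cong_def)
      moreover have "0 \<le> x mod int p" "x mod int p < int p" using p_ge_5 by auto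
      ultimately show ?thesis by simp
    qed
    ultimately obtain n where "x mod int p = r ^ n mod int p" by blast
    then show ?thesis by (auto simp: cong_def)
  qed
  have pr_Dg_B: "pr (Dg x y) \<in> B" if xy: "x * y \<asymp> 1" for x y
  proof -
    have "\<not> x \<asymp> 0" using xy one_not_eqv_0 not_eqv_0_eqv mult_eqv_0_iff by blast
    then obtain n where n: "x \<asymp> r ^ n" using ex_pow by blast
    have "y \<asymp> s ^ n" by (rule inv3[OF xy n rs])
    then have "Dg x y \<asymp>\<^sub>m Dg (r ^ n) (s ^ n)" using n by (simp add: Dg_def meqv_iff)
    then show ?thesis unfolding B using pr_eq_iff by blast
  qed
  have NA: "A <#>\<^bsub>?G\<^esub> B = normalizer ?G A"
  proof
    show "A <#>\<^bsub>?G\<^esub> B \<subseteq> normalizer ?G A"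
    proof
      fix x assume "x \<in> A <#>\<^bsub>?G\<^esub> B"
      then obtain y n where x: "x = pr (mmul (tv ?e y) (Dg (r ^ n) (s ^ n)))"
        unfolding set_mult_def A B by (auto simp: mult_PSL2)
      have d: "mdet (mmul (tv ?e y) (Dg (r ^ n) (s ^ n))) \<asymp> 1" using dD[of n] by (simp add: mdet_mmul)
      have "vdet ?e (act (mmul (tv ?e y) (Dg (r ^ n) (s ^ n))) ?e) = 0"
        by (simp add: act_mmul act_e act_smul act_tv_self) (simp add: vdet_def smul_def)
      then show "x \<in> normalizer ?G A" unfolding x A normalizer_tv[OF ne d] by simp
    qed
    show "normalizer ?G A \<subseteq> A <#>\<^bsub>?G\<^esub> B"
    proof
      fix x assume x: "x \<in> normalizer ?G A"
      then have "x \<in> carrier ?G" unfolding normalizer_def stabilizer_def by blast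
      then obtain M where M: "mdet M \<asymp> 1" "x = pr M" by (rule PSL2_cases)
      obtain w y z t where Me: "M = (w, y, z, t)" by (cases M)
      have "vdet ?e (act M ?e) \<asymp> 0" using x unfolding M(2) A normalizer_tv[OF ne M(1)] .
      then have z: "z \<asymp> 0" by (simp add: Me vdet_def act_def)
      have wt: "w * t \<asymp> 1" using M(1) z unfolding Me mdet_def prod.case by Groebner_Basis.algebra
      \<comment> \<open>An upper triangular matrix is a transvection times its diagonal part; the
        parameter is \<open>y\<close> divided by \<open>t\<close>, that is
        \<open>y * w\<close>.\<close>
      have "y \<asymp> y * w * t" using wt by Groebner_Basis.algebra
      then have "M \<asymp>\<^sub>m mmul (tv ?e (y * w)) (Dg w t)"
        using z by (simp add: Me tv_def Dg_def mmul_def meqv_iff)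
      then have "x = pr (tv ?e (y * w)) \<otimes>\<^bsub>?G\<^esub> pr (Dg w t)" unfolding M(2) mult_PSL2 pr_eq_iff by blast
      moreover have "pr (tv ?e (y * w)) \<in> A" unfolding A by blast
      ultimately show "x \<in> A <#>\<^bsub>?G\<^esub> B" using pr_Dg_B[OF wt] unfolding set_mult_def by blast
    qed
  qed
  have B2B: "B2 \<subseteq> B" unfolding B2 B by blast
  have BC1: "B \<inter> C = {\<one>\<^bsub>?G\<^esub>}"
  proof -
    have "c \<notin> B"
    proof
      assume "c \<in> B"
      then obtain n where "pr W = pr (Dg (r ^ n) (s ^ n))" unfolding B c_def by blast
      then show False unfolding pr_eq_iff using one_not_eqv_0
        by (auto simp: W_def Dg_def smat_def meqv_iff)
    qed
    then show ?thesis unfolding C using subgroup.one_closed[OF sB] by blast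
  qed
  have conjC: "k \<otimes>\<^bsub>?G\<^esub> n \<otimes>\<^bsub>?G\<^esub> inv\<^bsub>?G\<^esub> k \<in> B" if k: "k \<in> C" and n: "n \<in> B" for k n
  proof -
    obtain i where i: "n = pr (Dg (r ^ i) (s ^ i))" using n unfolding B by blast
    have "n \<in> carrier ?G" using subgroup.mem_carrier[OF sB n] .
    moreover have "c \<otimes>\<^bsub>?G\<^esub> n \<otimes>\<^bsub>?G\<^esub> inv\<^bsub>?G\<^esub> c \<in> B"
      unfolding inv_c i cDc by (rule pr_Dg_B) (use rs[of i] in \<open>simp add: mult.commute\<close>)
    ultimately show ?thesis using k n unfolding C by auto
  qed
  have B2c: "B2 \<subseteq> carrier ?G" using subgroup.subset[OF sB2] .
  have NB: "B <#>\<^bsub>?G\<^esub> C = normalizer ?G B2"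
  proof
    \<comment> \<open>Diagonal elements commute and \<open>c\<close> inverts them, so both factors
      map \<open>B2\<close> onto itself.\<close>
    have conjB: "{x \<otimes>\<^bsub>?G\<^esub> y \<otimes>\<^bsub>?G\<^esub> inv\<^bsub>?G\<^esub> x | y. y \<in> B2} = B2" if x: "x = pr (Dg (r ^ i) (s ^ i)) \<otimes>\<^bsub>?G\<^esub> k" and k: "k \<in> C" for x i k
    proof -
      have c1: "pr (Dg (r ^ i) (s ^ i)) \<otimes>\<^bsub>?G\<^esub> pr (Dg (r ^ j) (s ^ j)) \<otimes>\<^bsub>?G\<^esub> inv\<^bsub>?G\<^esub> pr (Dg (r ^ i) (s ^ i)) = pr (Dg (r ^ j) (s ^ j))"
        "pr (Dg (r ^ i) (s ^ i)) \<otimes>\<^bsub>?G\<^esub> pr (Dg (s ^ j) (r ^ j)) \<otimes>\<^bsub>?G\<^esub> inv\<^bsub>?G\<^esub> pr (Dg (r ^ i) (s ^ i)) = pr (Dg (s ^ j) (r ^ j))" for j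
      proof -
        have "r ^ i * r ^ j * s ^ i \<asymp> r ^ j" "s ^ i * s ^ j * r ^ i \<asymp> s ^ j"
          "r ^ i * s ^ j * s ^ i \<asymp> s ^ j" "s ^ i * r ^ j * r ^ i \<asymp> r ^ j"
          by (rule inv4[OF rs])+
        then show "pr (Dg (r ^ i) (s ^ i)) \<otimes>\<^bsub>?G\<^esub> pr (Dg (r ^ j) (s ^ j)) \<otimes>\<^bsub>?G\<^esub> inv\<^bsub>?G\<^esub> pr (Dg (r ^ i) (s ^ i)) = pr (Dg (r ^ j) (s ^ j))"
        "pr (Dg (r ^ i) (s ^ i)) \<otimes>\<^bsub>?G\<^esub> pr (Dg (s ^ j) (r ^ j)) \<otimes>\<^bsub>?G\<^esub> inv\<^bsub>?G\<^esub> pr (Dg (r ^ i) (s ^ i)) = pr (Dg (s ^ j) (r ^ j))"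
          unfolding inv_b mult_PSL2 Dg_mult pr_eq_iff by (simp_all add: Dg_def meqv_iff)
      qed
      have inv_swap: "pr (Dg (s ^ (2 * j)) (r ^ (2 * j))) \<in> B2" for j
        unfolding inv_b[symmetric] by (rule subgroup.m_inv_closed[OF sB2]) (use B2 in blast)
      have bi: "pr (Dg (r ^ i) (s ^ i)) \<in> carrier ?G" by (rule pr_in_PSL2[OF dD])
      show ?thesis
      proof (cases "k = \<one>\<^bsub>?G\<^esub>")
        case True
        then have xx: "x = pr (Dg (r ^ i) (s ^ i))" using x bi by simp
        have "x \<otimes>\<^bsub>?G\<^esub> y \<otimes>\<^bsub>?G\<^esub> inv\<^bsub>?G\<^esub> x = y" if "y \<in> B2" for y
          using that c1(1) unfolding B2 xx by auto
        then show ?thesis by auto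
      next
        case False
        then have kc: "k = c" using k C by blast
        have e: "x \<otimes>\<^bsub>?G\<^esub> pr (Dg (r ^ j) (s ^ j)) \<otimes>\<^bsub>?G\<^esub> inv\<^bsub>?G\<^esub> x = pr (Dg (s ^ j) (r ^ j))" for j
        proof -
          let ?b = "pr (Dg (r ^ i) (s ^ i))" and ?y = "pr (Dg (r ^ j) (s ^ j))"
          have y: "?y \<in> carrier ?G" by (rule pr_in_PSL2[OF dD])
          have "x \<otimes>\<^bsub>?G\<^esub> ?y \<otimes>\<^bsub>?G\<^esub> inv\<^bsub>?G\<^esub> x = ?b \<otimes>\<^bsub>?G\<^esub> (c \<otimes>\<^bsub>?G\<^esub> ?y \<otimes>\<^bsub>?G\<^esub> c) \<otimes>\<^bsub>?G\<^esub> inv\<^bsub>?G\<^esub> ?b"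
            unfolding x kc G.inv_mult_group[OF bi cc] inv_c using bi cc y by (simp add: G.m_assoc)
          then show ?thesis unfolding cDc c1(2) .
        qed
        show ?thesis
        proof
          show "{x \<otimes>\<^bsub>?G\<^esub> y \<otimes>\<^bsub>?G\<^esub> inv\<^bsub>?G\<^esub> x | y. y \<in> B2} \<subseteq> B2"
            using e inv_swap unfolding B2 by auto
          show "B2 \<subseteq> {x \<otimes>\<^bsub>?G\<^esub> y \<otimes>\<^bsub>?G\<^esub> inv\<^bsub>?G\<^esub> x | y. y \<in> B2}"
          proof
            fix y assume "y \<in> B2"
            then obtain j where j: "y = pr (Dg (r ^ (2 * j)) (s ^ (2 * j)))" unfolding B2 by blast
            obtain j' where j': "pr (Dg (s ^ (2 * j)) (r ^ (2 * j))) = pr (Dg (r ^ (2 * j')) (s ^ (2 * j')))"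
              using inv_swap[of j] unfolding B2 by blast
            have "x \<otimes>\<^bsub>?G\<^esub> pr (Dg (r ^ (2 * j')) (s ^ (2 * j'))) \<otimes>\<^bsub>?G\<^esub> inv\<^bsub>?G\<^esub> x = pr (Dg (s ^ (2 * j')) (r ^ (2 * j')))"
              by (rule e)
            also have "\<dots> = inv\<^bsub>?G\<^esub> (pr (Dg (s ^ (2 * j)) (r ^ (2 * j))))" unfolding j' inv_b ..
            also have "\<dots> = y" unfolding j inv_b[symmetric] by (rule G.inv_inv[OF pr_in_PSL2[OF dD]])
            finally have "y = x \<otimes>\<^bsub>?G\<^esub> pr (Dg (r ^ (2 * j')) (s ^ (2 * j'))) \<otimes>\<^bsub>?G\<^esub> inv\<^bsub>?G\<^esub> x" by simp
            moreover have "pr (Dg (r ^ (2 * j')) (s ^ (2 * j'))) \<in> B2" unfolding B2 by blast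
            ultimately show "y \<in> {x \<otimes>\<^bsub>?G\<^esub> y \<otimes>\<^bsub>?G\<^esub> inv\<^bsub>?G\<^esub> x | y. y \<in> B2}" by blast
          qed
        qed
      qed
    qed
    show "B <#>\<^bsub>?G\<^esub> C \<subseteq> normalizer ?G B2"
    proof
      fix x assume "x \<in> B <#>\<^bsub>?G\<^esub> C"
      then obtain i k where x: "x = pr (Dg (r ^ i) (s ^ i)) \<otimes>\<^bsub>?G\<^esub> k" "k \<in> C" unfolding set_mult_def B by blast
      have "x \<in> carrier ?G" unfolding x(1)
        by (intro G.m_closed pr_in_PSL2[OF dD] subgroup.mem_carrier[OF sC x(2)])
      then show "x \<in> normalizer ?G B2" unfolding normalizer_eq[OF B2c] using conjB[OF x] by blast
    qed
    show "normalizer ?G B2 \<subseteq> B <#>\<^bsub>?G\<^esub> C"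
    proof
      fix x assume "x \<in> normalizer ?G B2"
      then have xc: "x \<in> carrier ?G" and xB: "{x \<otimes>\<^bsub>?G\<^esub> y \<otimes>\<^bsub>?G\<^esub> inv\<^bsub>?G\<^esub> x | y. y \<in> B2} = B2"
        unfolding normalizer_eq[OF B2c] by auto
      obtain M where M: "mdet M \<asymp> 1" "x = pr M" using PSL2_cases[OF xc] .
      obtain w y z t where Me: "M = (w, y, z, t)" by (cases M)
      have d: "w * t - y * z \<asymp> 1" using M(1) by (simp add: Me mdet_def)
      have "pr (Dg (r ^ 2) (s ^ 2)) \<in> B2" unfolding B2 by (auto intro!: exI[of _ 1])
      then have "x \<otimes>\<^bsub>?G\<^esub> pr (Dg (r ^ 2) (s ^ 2)) \<otimes>\<^bsub>?G\<^esub> inv\<^bsub>?G\<^esub> x \<in> B2" using xB by blast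
      then obtain j where "x \<otimes>\<^bsub>?G\<^esub> pr (Dg (r ^ 2) (s ^ 2)) \<otimes>\<^bsub>?G\<^esub> inv\<^bsub>?G\<^esub> x = pr (Dg (r ^ (2 * j)) (s ^ (2 * j)))"
        unfolding B2 by blast
      then have "x \<otimes>\<^bsub>?G\<^esub> pr (Dg (r ^ 2) (s ^ 2)) = pr (Dg (r ^ (2 * j)) (s ^ (2 * j))) \<otimes>\<^bsub>?G\<^esub> x"
        using G.inv_solve_right'[OF pr_in_PSL2[OF dD] _ xc] xc pr_in_PSL2[OF dD]
        by (metis G.inv_closed G.inv_inv G.inv_solve_right G.m_closed)
      then obtain q where q: "q \<asymp> 1 \<or> q \<asymp> - 1" "mmul M (Dg (r ^ 2) (s ^ 2)) \<asymp>\<^sub>m smat q (mmul (Dg (r ^ (2 * j)) (s ^ (2 * j))) M)"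
        unfolding M(2) mult_PSL2 pr_eq_iff by (metis cong_refl smat_1)
      define R S where "R = q * r ^ (2 * j)" and "S = q * s ^ (2 * j)"
      have e: "w * r ^ 2 \<asymp> R * w" "y * s ^ 2 \<asymp> R * y" "z * r ^ 2 \<asymp> S * z" "t * s ^ 2 \<asymp> S * t"
        using q(2) by (simp_all add: Me Dg_def mmul_def smat_def meqv_iff R_def S_def mult.assoc)
      \<comment> \<open>By \<open>e\<close>, a row of \<open>M\<close> with two nonzero entries
        would force \<open>r ^ 2\<close> and \<open>s ^ 2\<close> to agree. So each row has a zero,
        and \<open>M\<close> is diagonal or antidiagonal.\<close>
      have contra: False if "r ^ 2 \<asymp> s ^ 2"
      proof -
        have "r ^ 2 * r ^ 2 \<asymp> 1" using inv3[OF rs[of 2] that] cong_mult[OF cong_refl[of "r ^ 2"] that] rs[of 2] cong_trans by blast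
        then have "r ^ 4 \<asymp> 1" by (simp add: power_add[symmetric])
        then have "m dvd 4" using pow_r by blast
        then show False using p13 by (auto dest!: dvd_imp_le)
      qed
      have can: "f \<asymp> g" if "x * f \<asymp> g * x" "\<not> x \<asymp> 0" for x f g :: int
        using mult_eqv_cancel[of x f g] that by (simp add: mult.commute)
      have "w \<asymp> 0 \<or> y \<asymp> 0" using can[OF e(1)] can[OF e(2)] contra cong_sym cong_trans by blast
      then show "x \<in> B <#>\<^bsub>?G\<^esub> C"
      proof
        assume y0: "y \<asymp> 0"
        then have wt: "w * t \<asymp> 1" using d by Groebner_Basis.algebra
        then have "\<not> t \<asymp> 0" using one_not_eqv_0 not_eqv_0_eqv mult_eqv_0_iff by blast
        then have z0: "z \<asymp> 0" using can[OF e(3)] can[OF e(4)] contra cong_sym cong_trans by blast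
        have "M \<asymp>\<^sub>m Dg w t" using y0 z0 by (simp add: Me Dg_def meqv_iff)
        then have "x = pr (Dg w t)" unfolding M(2) pr_eq_iff by blast
        then have "x = pr (Dg w t) \<otimes>\<^bsub>?G\<^esub> \<one>\<^bsub>?G\<^esub>" using xc by simp
        then show ?thesis using pr_Dg_B[OF wt] C unfolding set_mult_def by blast
      next
        assume w0: "w \<asymp> 0"
        then have yz: "y * (- z) \<asymp> 1" using d by Groebner_Basis.algebra
        then have "\<not> z \<asymp> 0" using one_not_eqv_0 not_eqv_0_eqv mult_eqv_0_iff by (metis cong_0_iff dvd_minus_iff)
        then have t0: "t \<asymp> 0" using can[OF e(3)] can[OF e(4)] contra cong_sym cong_trans by blast
        have "M \<asymp>\<^sub>m mmul (Dg y (- z)) W" using w0 t0 by (simp add: Me Dg_def W_def mmul_def meqv_iff)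
        then have "x = pr (Dg y (- z)) \<otimes>\<^bsub>?G\<^esub> c" unfolding M(2) c_def mult_PSL2 pr_eq_iff by blast
        then show ?thesis using pr_Dg_B[OF yz] C unfolding set_mult_def by blast
      qed
    qed
  qed
  have i1: "inner_semidirect ?G (normalizer ?G A) A B"
    by (rule G.inner_semidirectI[OF sA sB conjA AB1 NA])
  have i2: "inner_semidirect ?G (normalizer ?G B2) B C"
    by (rule G.inner_semidirectI[OF sB sC conjC BC1 NB])
  have i3: "inner_semidirect ?G (A <#>\<^bsub>?G\<^esub> B2) A B2"
  proof (rule G.inner_semidirectI[OF sA sB2 _ _ refl])
    show "A \<inter> B2 = {\<one>\<^bsub>?G\<^esub>}"
      using AB1 B2B subgroup.one_closed[OF sA] subgroup.one_closed[OF sB2] by blast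
  qed (use conjA B2B in blast)
  have "C_datum p a b c (A <#>\<^bsub>?G\<^esub> B2)"
    unfolding C_datum_def Let_def A_def[symmetric] B_def[symmetric] B2_def[symmetric] C_def[symmetric]
    using ac oa bc ob i1 cc oc i2 cbc i3 by blast
  then show ?thesis by blast
qed

end

section \<open>The icosahedron\<close>

text \<open>\<open>None\<close> labels the two apexes. \<open>Some x\<close> labels the upper
  pentagon, in cyclic order because 1 and - 1 are the nonzero squares modulo 5, and for
  \<open>b = False\<close> the opposite vertex of the lower pentagon.\<close>

definition icosahedron_label :: "int option \<Rightarrow> bool \<Rightarrow> nat" where
  "icosahedron_label l b = (case l of None \<Rightarrow> if b then 0 else 11
     | Some x \<Rightarrow> (if b then [1, 2, 3, 4, 5] else [9, 10, 6, 7, 8]) ! nat x)"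

lemma (in prime_1_mod_4) icosahedron_vector_graph:
  assumes p5: "p = 5"
  shows "\<exists>f. vector_graph p f icosahedron"
proof -
  have L: "line_indices = {None, Some 0, Some 1, Some 2, Some 3, Some 4}"
  proof -
    have "{0..<int p} = {0, 1, 2, 3, 4}" unfolding p5 by auto
    then show ?thesis unfolding line_indices_def by (simp only: image_insert image_empty)
  qed
  have "m = 2" using p_eq p5 by linarith
  \<comment> \<open>The determinants of two representatives range over the integers from - 4 to
    4.\<close>
  have c: "chi 1 = 1" "chi 4 = 1" "chi 2 = - 1" "chi 3 = - 1" "chi 0 = 0"
    "chi (- 1) = 1" "chi (- 2) = - 1" "chi (- 3) = - 1" "chi (- 4) = 1"
  proof -
    have "4 = 2 * (2 :: int)" by simp
    then show 4: "chi 4 = 1" using chi_square[OF two_not_eqv_0] by simp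
    show 2: "chi 2 = - 1"
    proof (rule sign_eqv_imp_eq[OF chi_cases])
      have "2 ^ 2 \<asymp> (- 1 :: int)" by (simp add: cong_iff_dvd_diff p5)
      then show "chi 2 \<asymp> - 1" using chi_euler[of 2] \<open>m = 2\<close> cong_trans by metis
    qed simp
    have "3 \<asymp> - 2" by (simp add: cong_iff_dvd_diff p5)
    then show 3: "chi 3 = - 1" using chi_cong[of 3 "- 2"] chi_minus[of 2] 2 by simp
    show "chi (- 2) = - 1" "chi (- 3) = - 1" "chi (- 4) = 1"
      using chi_minus[of 2] chi_minus[of 3] chi_minus[of 4] 2 3 4 by simp_all
  qed simp_all
  have adj: "\<forall>l\<in>line_indices. \<forall>l'\<in>line_indices. \<forall>b b'.
      (icosahedron_label l b, icosahedron_label l' b') \<in> parcs icosahedron \<longleftrightarrow>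
      chi (vdet (line_rep l) (line_rep l')) = (if b = b' then 1 else - 1)"
    unfolding L
    by (simp add: all_bool_eq icosahedron_label_def icosahedron_def line_rep_def vdet_def c nth_Cons' Let_def)
  have inj: "\<forall>l\<in>line_indices. \<forall>l'\<in>line_indices. \<forall>b b'.
      icosahedron_label l b = icosahedron_label l' b' \<longrightarrow> l = l' \<and> b = b'"
    unfolding L by (simp add: all_bool_eq icosahedron_label_def nth_Cons')
  have "pverts icosahedron = {0..11}" by (simp add: icosahedron_def Let_def)
  also have "\<dots> = {icosahedron_label l b | l b. l \<in> line_indices}"
  proof -
    have "{icosahedron_label l b | l b. l \<in> line_indices} = (\<Union>l\<in>line_indices. \<Union>b\<in>UNIV. {icosahedron_label l b})"
      by blast
    also have "\<dots> = {0, 11, 1, 9, 2, 10, 3, 6, 4, 7, 5, 8}"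
      unfolding L UNIV_bool by (simp add: icosahedron_label_def nth_Cons') blast
    also have "\<dots> = {0..11}"
    proof (rule Set.set_eqI)
      fix x :: nat
      show "x \<in> {0, 11, 1, 9, 2, 10, 3, 6, 4, 7, 5, 8} \<longleftrightarrow> x \<in> {0..11}"
        by (simp only: insert_iff empty_iff atLeastAtMost_iff) presburger
    qed
    finally show ?thesis by blast
  qed
  finally have verts: "pverts icosahedron = {icosahedron_label l b | l b. l \<in> line_indices}" .
  have arcs: "parcs icosahedron \<subseteq> pverts icosahedron \<times> pverts icosahedron"
    by (auto simp: icosahedron_def Let_def)
  show ?thesis
  proof (rule vector_graphI[of icosahedron icosahedron_label, OF arcs verts])
    show "l = l' \<and> b = b'" if "l \<in> line_indices" "l' \<in> line_indices"
      "icosahedron_label l b = icosahedron_label l' b'" for l l' b b'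
      using inj[rule_format, OF that] .
    show "(icosahedron_label l b, icosahedron_label l' b') \<in> parcs icosahedron \<longleftrightarrow>
      chi (vdet (line_rep l) (line_rep l')) = (if b = b' then 1 else - 1)"
      if "l \<in> line_indices" "l' \<in> line_indices" for l l' b b'
      using adj[rule_format, OF that] .
  qed
qed

section \<open>The characterization\<close>

context prime_1_mod_4
begin

text \<open>All vector graphs for \<open>p\<close> are isomorphic and the family is closed under
  isomorphism, so for the converse it suffices that the family has a member: the icosahedron, or a
  graph from \<open>C_datum_exists\<close>.\<close>

lemma family_C_iff: "\<Gamma> \<in> family_C p \<longleftrightarrow> (\<exists>f. vector_graph p f \<Gamma>)"
proof (cases "p = 5")
  case True
  have ico: "\<exists>f. vector_graph p f icosahedron"
    using icosahedron_vector_graph[OF True] .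
  have "\<Gamma> \<in> family_C p \<longleftrightarrow> digraph_iso (with_proj icosahedron) (with_proj \<Gamma>)"
    using True by (simp add: family_C_def)
  then show ?thesis using ico vector_graph_transport vector_graphs_isomorphic by metis
next
  case False
  let ?K = "\<lambda>b c H i. coset_graph (PSL2 p) H (double_coset (PSL2 p) H (c \<otimes>\<^bsub>PSL2 p\<^esub> b [^]\<^bsub>PSL2 p\<^esub> (2 * i :: int)))"
  have mem: "\<Gamma> \<in> family_C p \<longleftrightarrow> (\<exists>a b c H i. C_datum p a b c H \<and> digraph_iso (with_proj (?K b c H i)) (with_proj \<Gamma>))"
    using False by (simp add: family_C_def Let_def)
  show ?thesis
  proof
    assume "\<Gamma> \<in> family_C p"
    then obtain a b c H i where "C_datum p a b c H" "digraph_iso (with_proj (?K b c H i)) (with_proj \<Gamma>)"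
      unfolding mem by blast
    then show "\<exists>f. vector_graph p f \<Gamma>"
      using C_datum_imp_vector_graph[OF _ False] vector_graph_transport by metis
  next
    assume "\<exists>f. vector_graph p f \<Gamma>"
    then obtain f where f: "vector_graph p f \<Gamma>" by blast
    obtain a b c H where d: "C_datum p a b c H" using C_datum_exists[OF False] by blast
    obtain f' where "vector_graph p f' (?K b c H 0)" using C_datum_imp_vector_graph[OF d False] by blast
    then have "digraph_iso (with_proj (?K b c H 0)) (with_proj \<Gamma>)" using f by (rule vector_graphs_isomorphic)
    then show "\<Gamma> \<in> family_C p" unfolding mem using d by blast
  qed
qed

end

theorem theorem1p2:
  fixes p :: nat
  assumes "Factorial_Ring.prime p" and "[p = 1] (mod 4)"
  shows "(\<forall>\<Gamma> :: 'a pair_pre_digraph.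
            \<Gamma> \<in> family_C p \<longleftrightarrow>
              pair_graph \<Gamma> \<and> connected (with_proj \<Gamma>) \<and> \<not> bipartite_graph \<Gamma> \<and>
              antipodal_double_cover \<Gamma> \<and>
              complete_digraph (p + 1) (with_proj (antipodal_quotient \<Gamma>)) \<and>
              aut_group \<Gamma> \<cong> PSL2 p \<times>\<times> integer_mod_group 2)
       \<and> (\<forall>(\<Gamma> :: 'a pair_pre_digraph) \<in> family_C p.
            (\<forall>(\<Delta> :: 'b pair_pre_digraph) \<in> family_C p.
               digraph_iso (with_proj \<Gamma>) (with_proj \<Delta>)) \<and>
            geodesic_transitive \<Gamma> \<and> gdiam \<Gamma> = 3)"
proof -
  interpret prime_1_mod_4 p using assms by unfold_locales
  have "\<Gamma> \<in> family_C p \<longleftrightarrow>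
      pair_graph \<Gamma> \<and> connected (with_proj \<Gamma>) \<and> \<not> bipartite_graph \<Gamma> \<and> antipodal_double_cover \<Gamma> \<and>
      complete_digraph (p + 1) (with_proj (antipodal_quotient \<Gamma>)) \<and>
      aut_group \<Gamma> \<cong> PSL2 p \<times>\<times> integer_mod_group 2" for \<Gamma> :: "'a pair_pre_digraph"
  proof
    assume "\<Gamma> \<in> family_C p"
    then obtain f where "vector_graph p f \<Gamma>" unfolding family_C_iff by blast
    then interpret vector_graph p f \<Gamma> .
    show "pair_graph \<Gamma> \<and> connected (with_proj \<Gamma>) \<and> \<not> bipartite_graph \<Gamma> \<and> antipodal_double_cover \<Gamma> \<and>
      complete_digraph (p + 1) (with_proj (antipodal_quotient \<Gamma>)) \<and>
      aut_group \<Gamma> \<cong> PSL2 p \<times>\<times> integer_mod_group 2"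
      by (intro conjI pair_graph_G connected_G not_bipartite_G antipodal_double_cover_G complete_quotient aut_group_iso)
  qed (simp add: family_C_iff cover_imp_vector_graph)
  moreover have "digraph_iso (with_proj \<Gamma>) (with_proj \<Delta>)"
    if "\<Gamma> \<in> family_C p" "\<Delta> \<in> family_C p" for \<Gamma> :: "'a pair_pre_digraph" and \<Delta> :: "'b pair_pre_digraph"
    using that vector_graphs_isomorphic unfolding family_C_iff by blast
  moreover have "geodesic_transitive \<Gamma> \<and> gdiam \<Gamma> = 3" if \<Gamma>: "\<Gamma> \<in> family_C p" for \<Gamma> :: "'a pair_pre_digraph"
  proof -
    obtain f where "vector_graph p f \<Gamma>" using \<Gamma> unfolding family_C_iff by (elim exE)
    then interpret vector_graph p f \<Gamma> .
    show ?thesis using geodesic_transitive_G gdiam_eq by simp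
  qed
  ultimately show ?thesis by blast
qed

end
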